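(* There exists $\lambda\in\mathbb{C}\setminus\{0\}$ such that the exponential map $f_\lambda(z)=\lambda e^z$ is escaping and dynamically recurrent.
   Context: For $\lambda\in\mathbb{C}\setminus\{0\}$ the exponential map $f_\lambda:\mathbb{C}\to\mathbb{C}$ is $f_\lambda(z)=\lambda e^z$; its only singular value is $0$, and $f_\lambda^n$ denotes the $n$-th iterate. The map $f_\lambda$ is called escaping if $f_\lambda^n(0)\to\infty$ (i.e. $|f_\lambda^n(0)|\to\infty$) as $n\to\infty$. The map $f_\lambda$ is called dynamically recurrent if every set of positive measure returns to itself infinitely many times: for every measurable set $A\subset\mathbb{C}$ of positive (two-dimensional) Lebesgue measure, $A\cap f_\lambda^n(A)\neq\emptyset$ for infinitely many $n\ge 1$. (It is the opposite of being dynamically non-recurrent, which means that there is a measurable set $A\subset\mathbb{C}$ of positive Lebesgue measure with $A\cap f_\lambda^n(A)=\emptyset$ for every $n\ge1$.) *)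

theory Defs
  imports "HOL-Analysis.Analysis"
begin

definition exp_map :: "complex \<Rightarrow> complex \<Rightarrow> complex" where
  "exp_map c z = c * exp z"

(* The starting point 0 is the only singular value of the map. *)
definition escaping :: "complex \<Rightarrow> bool" where
  "escaping c \<longleftrightarrow> filterlim (\<lambda>n. (exp_map c ^^ n) 0) at_infinity sequentially"

(* "lebesgue" on complex is the completed two-dimensional Lebesgue measure. *)
definition dynamically_recurrent :: "(complex \<Rightarrow> complex) \<Rightarrow> bool" where
  "dynamically_recurrent f \<longleftrightarrow>
     (\<forall>A \<in> sets (lebesgue :: complex measure). emeasure lebesgue A > 0 \<longrightarrow>
        infinite {n::nat. n \<ge> 1 \<and> A \<inter> (f ^^ n) ` A \<noteq> {}})"

end

theory Submission
  imports Defs "HOL-Complex_Analysis.Complex_Analysis"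
begin

text \<open>Write \<open>f c z = c * exp z\<close> and suppose first that \<open>0\<close> is eventually mapped to a fixed point \<open>p\<close> of
  \<open>f c\<close>, where \<open>c\<close> is large. Off the finite singular orbit an explicit metric is expanded, and
  almost no orbit stays in a right half-plane, so almost every orbit returns infinitely often to a compact set
  off the singular orbit, with derivatives tending to infinity. By Koebe distortion, the images
  of a set \<open>A\<close> of positive measure along such returns of a density point fill a fixed disc up to small measure;
  by Schottky's theorem the iterates of this disc cover the density point, so \<open>A\<close> meets its images.
  Hence, for a finite measure \<open>\<mu>\<close> equivalent to Lebesgue measure, the sum of the measures of all
  preimages of \<open>A\<close> diverges. Its partial sums are large uniformly for all \<open>A\<close> that lie in a ball and have
  measure bounded below, and they are stable under perturbation of \<open>c\<close>, because \<open>f c'\<close> is \<open>f c\<close>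
  followed by a dilation and dilations act continuously on \<open>L\<^sup>1\<close>. For any map, divergence of these sums
  implies recurrence.

  On the other hand, arbitrarily close to \<open>c\<close> there is a parameter of the same kind whose singular
  orbit, after coming close to \<open>p\<close>, follows a chain of preimages of a fixed point of at least twice the
  modulus of \<open>p\<close> and stops there. Iterating this with nested discs of parameters, the limit
  is escaping, and it inherits the large partial sums of all stages.\<close>

text \<open>Recurrence quantifies over all sets and infinitely many iterates, and is neither visibly
  open nor closed in the parameter, whereas the limit map inherits from its approximants only
  statements about finitely many iterates. Hence it is traded for lower bounds on
  \<open>return_mass\<close>, each involving only \<open>N\<close> iterates. Two choices make such a
  bound open in the parameter: the reference measure is finite, because preimages of a non-null set
  under \<open>exp_map\<close> are periodic and have infinite Lebesgue measure; and the perturbation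
  estimate is in total variation, so one radius serves all sets at once.

  A singular orbit that ends in a fixed point cannot escape, so the growth has to come from
  infinitely many changes of fixed point. Maps with two fixed points \<open>P\<close> and
  \<open>s * P\<close> form a one-parameter family, since \<open>exp (P * (s - 1)) = s\<close>
  determines \<open>P\<close> from \<open>s\<close> and a branch of the logarithm. As the chain of
  preimages of \<open>s * P\<close> converges to \<open>P\<close>, Hurwitz's theorem moves the
  singular orbit from \<open>P\<close> onto this chain by an arbitrarily small change of
  \<open>s\<close>.\<close>

abbreviation iter :: "complex \<Rightarrow> nat \<Rightarrow> complex \<Rightarrow> complex" where
  "iter c n \<equiv> exp_map c ^^ n"

section \<open>Density points and images under holomorphic maps\<close>

text \<open>Subadditivity is used for the \<open>X i\<close> and additivity for the
  \<open>Y i\<close>, so only the latter have to be disjoint. In both applications the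
  \<open>Y i\<close> come from the disjoint balls of a Vitali covering.\<close>

lemma emeasure_UN_mono_mult:
  assumes "countable C" "\<And>i. i \<in> C \<Longrightarrow> X i \<in> sets M" "\<And>i. i \<in> C \<Longrightarrow> Y i \<in> sets M"
    and "disjoint_family_on Y C"
    and "\<And>i. i \<in> C \<Longrightarrow> emeasure M (X i) \<le> a * emeasure M (Y i)"
  shows "emeasure M (\<Union>i\<in>C. X i) \<le> a * emeasure M (\<Union>i\<in>C. Y i)"
proof -
  have "emeasure M (\<Union>i\<in>C. X i) \<le> (\<integral>\<^sup>+i. emeasure M (X i) \<partial>count_space C)"
  proof (cases "C = {}")
    case False
    then obtain c where c: "bij_betw c (to_nat_on C ` C) C" "C \<noteq> {}"
      using assms(1) by (meson bij_betw_inv_into bij_betw_imageI inj_on_to_nat_on)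
    define D where "D = to_nat_on C ` C"
    define X' where "X' = (\<lambda>n. if n \<in> D then X (c n) else {})"
    have "(\<Union>i\<in>C. X i) = (\<Union>n. X' n)"
    proof -
      have "(\<Union>i\<in>C. X i) = (\<Union>i\<in>c ` D. X i)" using c(1) by (simp add: bij_betw_def D_def)
      then show ?thesis by (auto simp: X'_def)
    qed
    moreover have "emeasure M (\<Union>n. X' n) \<le> (\<Sum>n. emeasure M (X' n))"
      using c(1) assms(2) by (intro emeasure_subadditive_countably) (auto simp: X'_def D_def bij_betw_def)
    moreover have "(\<Sum>n. emeasure M (X' n)) = (\<integral>\<^sup>+n. emeasure M (X' n) \<partial>count_space UNIV)"
      by (simp add: nn_integral_count_space_nat)
    moreover have "\<dots> = (\<integral>\<^sup>+n. emeasure M (X (c n)) * indicator D n \<partial>count_space UNIV)"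
      by (intro nn_integral_cong) (auto simp: X'_def)
    moreover have "\<dots> = (\<integral>\<^sup>+n. emeasure M (X (c n)) \<partial>count_space D)"
      by (simp add: nn_integral_count_space_indicator)
    moreover have "\<dots> = (\<integral>\<^sup>+i. emeasure M (X i) \<partial>count_space C)"
      using c(1) unfolding D_def by (rule nn_integral_bij_count_space)
    ultimately show ?thesis by simp
  qed simp
  also have "\<dots> \<le> (\<integral>\<^sup>+i. a * emeasure M (Y i) \<partial>count_space C)"
    using assms(5) by (intro nn_integral_mono) simp
  also have "\<dots> = a * (\<integral>\<^sup>+i. emeasure M (Y i) \<partial>count_space C)"
    by (rule nn_integral_cmult) simp
  also have "(\<integral>\<^sup>+i. emeasure M (Y i) \<partial>count_space C) = emeasure M (\<Union>i\<in>C. Y i)"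
    using assms by (intro emeasure_UN_countable[symmetric]) auto
  finally show ?thesis .
qed

text \<open>By Vitali, disjoint bad balls inside an open \<open>U\<close> with \<open>U - A\<close>
  small cover the exceptional set up to a null set. Each has at least the proportion \<epsilon> of
  its area in \<open>U - A\<close>, so their total measure is at most \<open>e / 2\<close>.\<close>

lemma negligible_nondensity_points:
  fixes A :: "'a::euclidean_space set"
  assumes A: "A \<in> sets lebesgue" and "\<epsilon> > 0"
  shows "negligible {z \<in> A. \<forall>r0>0. \<exists>r. 0 < r \<and> r < r0 \<and>
           measure lebesgue (ball z r - A) \<ge> \<epsilon> * measure lebesgue (ball z r)}" (is "negligible ?S")
  unfolding negligible_outer
proof (intro allI impI)
  fix e :: real assume "e > 0"
  have pos: "\<epsilon> * e / 2 > 0" using \<open>e > 0\<close> \<open>\<epsilon> > 0\<close> by simp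
  obtain U where U: "open U" "A \<subseteq> U" "U - A \<in> lmeasurable" "emeasure lebesgue (U - A) < ennreal (\<epsilon> * e / 2)"
    using sets_lebesgue_outer_open[OF A pos] by blast
  let ?K = "{(x, r). 0 < r \<and> ball x r \<subseteq> U \<and>
              \<epsilon> * measure lebesgue (ball x r) \<le> measure lebesgue (ball x r - A)}"
  have cov: "\<exists>i. i \<in> ?K \<and> x \<in> ball (fst i) (snd i) \<and> snd i < d" if xin: "x \<in> ?S" and dpos: "0 < d" for x d
  proof -
    have "x \<in> U" using xin U(2) by blast
    then obtain k where k: "k > 0" "ball x k \<subseteq> U"
      using U(1) by (meson openE)
    have "0 < min d k" using k dpos by simp
    then obtain r where r: "0 < r" "r < min d k" "measure lebesgue (ball x r - A) \<ge> \<epsilon> * measure lebesgue (ball x r)"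
      using xin by blast
    have "ball x r \<subseteq> ball x k" using r(2) by (intro subset_ball) simp
    then have "ball x r \<subseteq> U" using k by blast
    with r show ?thesis by (intro exI[of _ "(x, r)"]) auto
  qed
  obtain C where C: "countable C" "C \<subseteq> ?K"
     "pairwise (\<lambda>i j. disjnt (ball (fst i) (snd i)) (ball (fst j) (snd j))) C"
     "negligible (?S - (\<Union>i \<in> C. ball (fst i) (snd i)))"
    by (rule Vitali_covering_theorem_balls[of "?S" "?K" fst snd, OF cov])
  let ?B = "\<Union>i \<in> C. ball (fst i) (snd i)"
  have m: "emeasure lebesgue (ball (fst i) (snd i)) \<le> ennreal (1 / \<epsilon>) * emeasure lebesgue (ball (fst i) (snd i) - A)"
    if "i \<in> C" for i
  proof -
    have lm: "ball (fst i) (snd i) \<in> lmeasurable" "ball (fst i) (snd i) - A \<in> lmeasurable"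
      using A by (auto intro: fmeasurable_Diff)
    have "measure lebesgue (ball (fst i) (snd i)) \<le> (1 / \<epsilon>) * measure lebesgue (ball (fst i) (snd i) - A)"
      using that C \<open>\<epsilon> > 0\<close> by (auto simp: field_simps)
    then have "ennreal (measure lebesgue (ball (fst i) (snd i))) \<le> ennreal ((1 / \<epsilon>) * measure lebesgue (ball (fst i) (snd i) - A))"
      by (intro ennreal_leI)
    also have "ennreal ((1 / \<epsilon>) * measure lebesgue (ball (fst i) (snd i) - A)) =
        ennreal (1 / \<epsilon>) * ennreal (measure lebesgue (ball (fst i) (snd i) - A))"
      using \<open>\<epsilon> > 0\<close> by (intro ennreal_mult) auto
    finally show ?thesis
      using lm by (metis emeasure_eq_measure2)
  qed
  have "emeasure lebesgue ?B \<le> ennreal (1 / \<epsilon>) * emeasure lebesgue (\<Union>i \<in> C. ball (fst i) (snd i) - A)"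
  proof (rule emeasure_UN_mono_mult)
    show "disjoint_family_on (\<lambda>i. ball (fst i) (snd i) - A) C"
      using C(3) unfolding disjoint_family_on_def pairwise_def disjnt_def by blast
  qed (use C m A in auto)
  also have "\<dots> \<le> ennreal (1 / \<epsilon>) * emeasure lebesgue (U - A)"
  proof (intro mult_left_mono emeasure_mono)
    have "ball (fst i) (snd i) \<subseteq> U" if "i \<in> C" for i using C(2) that by force
    then show "(\<Union>i \<in> C. ball (fst i) (snd i) - A) \<subseteq> U - A" by blast
  qed (use U A in auto)
  also have "\<dots> \<le> ennreal (1 / \<epsilon>) * ennreal (\<epsilon> * e / 2)"
    using U by (intro mult_left_mono) auto
  also have "\<dots> = ennreal (e / 2)"
    using \<open>\<epsilon> > 0\<close> \<open>e > 0\<close> by (simp flip: ennreal_mult)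
  finally have B: "emeasure lebesgue ?B \<le> ennreal (e / 2)" .
  have Bm: "?B \<in> lmeasurable"
  proof (rule fmeasurableI)
    show "?B \<in> sets lebesgue" using C(1) by (intro sets.countable_UN'') auto
  qed (use B in \<open>auto simp: less_top[symmetric] top_unique\<close>)
  have "measure lebesgue ?B \<le> e / 2"
    using B \<open>e > 0\<close> Bm by (simp add: emeasure_eq_measure2 fmeasurableD2)
  moreover have N: "?S - ?B \<in> lmeasurable" "measure lebesgue (?S - ?B) = 0"
    using C(4) by (auto simp: negligible_imp_measurable negligible_imp_measure0)
  ultimately have "measure lebesgue ((?S - ?B) \<union> ?B) < e"
    using measure_Un_le[of "?S - ?B" lebesgue ?B] Bm \<open>e > 0\<close> by (auto dest: fmeasurableD)
  then show "\<exists>T. ?S \<subseteq> T \<and> T \<in> lmeasurable \<and> measure lebesgue T < e"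
    using fmeasurable.Un[OF N(1) Bm] by (intro exI[of _ "(?S - ?B) \<union> ?B"] conjI) blast+
qed

lemma emeasure_ball_complex: "r \<ge> 0 \<Longrightarrow> emeasure lebesgue (ball (c::complex) r) = ennreal (pi * r\<^sup>2)"
  using emeasure_ball[of r c] by (simp add: unit_ball_vol_2 numeral_2_eq_2)

lemma measure_ball_complex: "r \<ge> 0 \<Longrightarrow> measure lebesgue (ball (c::complex) r) = pi * r\<^sup>2"
  unfolding measure_def emeasure_ball_complex by simp

text \<open>The bound is on a measurable superset \<open>T\<close>, as measurability of the image is
  not asserted; \<open>e\<close> pays for an open superset of \<open>S\<close>. A Vitali covering
  reduces the claim to balls, where the mean value inequality scales the radius by at most
  \<open>B\<close>, and to a null set, whose image is null.\<close>

lemma holomorphic_image_measure_le: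
  fixes f :: "complex \<Rightarrow> complex"
  assumes X: "open X" "f holomorphic_on X" "\<And>z. z \<in> X \<Longrightarrow> cmod (deriv f z) \<le> B"
    and S: "S \<in> sets lebesgue" "S \<subseteq> X" and "e > 0" "B > 0"
  shows "\<exists>T\<in>sets lebesgue. f ` S \<subseteq> T \<and> emeasure lebesgue T \<le> ennreal (B\<^sup>2) * (emeasure lebesgue S + ennreal e)"
proof -
  obtain U0 where U0: "open U0" "S \<subseteq> U0" "U0 - S \<in> lmeasurable" "emeasure lebesgue (U0 - S) < ennreal e"
    using sets_lebesgue_outer_open[OF S(1) \<open>e > 0\<close>] by blast
  define U where "U = U0 \<inter> X"
  have U: "open U" "S \<subseteq> U" "U \<subseteq> X" using U0 X S by (auto simp: U_def)
  have mU: "emeasure lebesgue U \<le> emeasure lebesgue S + ennreal e"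
  proof -
    have "emeasure lebesgue U \<le> emeasure lebesgue (S \<union> (U0 - S))"
      using U0 S by (intro emeasure_mono) (auto simp: U_def)
    also have "\<dots> \<le> emeasure lebesgue S + emeasure lebesgue (U0 - S)"
      using U0 S by (intro emeasure_subadditive) auto
    also have "\<dots> \<le> emeasure lebesgue S + ennreal e"
      using U0 by (intro add_left_mono) auto
    finally show ?thesis .
  qed
  let ?K = "{(x, r). 0 < r \<and> ball x r \<subseteq> U}"
  have cov: "\<exists>i. i \<in> ?K \<and> x \<in> ball (fst i) (snd i) \<and> snd i < d" if xin: "x \<in> U" and dpos: "0 < d" for x d
  proof -
    obtain k where k: "k > 0" "ball x k \<subseteq> U"
      using U(1) xin by (meson openE)
    have "ball x (min (d/2) k) \<subseteq> ball x k" by (intro subset_ball) simp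
    with k show ?thesis using dpos by (intro exI[of _ "(x, min (d/2) k)"]) auto
  qed
  obtain C where C: "countable C" "C \<subseteq> ?K"
     "pairwise (\<lambda>i j. disjnt (ball (fst i) (snd i)) (ball (fst j) (snd j))) C"
     "negligible (U - (\<Union>i \<in> C. ball (fst i) (snd i)))"
    by (rule Vitali_covering_theorem_balls[of "U" "?K" fst snd, OF cov])
  let ?N = "U - (\<Union>i \<in> C. ball (fst i) (snd i))"
  let ?B' = "\<Union>i \<in> C. ball (f (fst i)) (B * snd i)"
  have dif: "f differentiable_on ?N"
    using X U by (meson Diff_subset differentiable_on_subset holomorphic_on_imp_differentiable_on order_trans)
  have neg: "negligible (f ` ?N)"
    by (rule negligible_differentiable_image_negligible[OF _ C(4) dif]) simp
  have img: "f ` ball x r \<subseteq> ball (f x) (B * r)" if "(x, r) \<in> C" for x r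
  proof -
    have b: "ball x r \<subseteq> X" "r > 0" using that C U by auto
    have "cmod (f y - f x) < B * r" if "y \<in> ball x r" for y
    proof -
      have "cmod (f y - f x) \<le> B * cmod (y - x)"
      proof (rule field_differentiable_bound[of "ball x r" f "deriv f"])
        fix u assume "u \<in> ball x r"
        then have u: "u \<in> X" using b by auto
        then show "(f has_field_derivative deriv f u) (at u within ball x r)"
          using X holomorphic_derivI by blast
        show "cmod (deriv f u) \<le> B" using u X by auto
      qed (use that b in auto)
      also have "\<dots> < B * r" using that \<open>B > 0\<close> by (simp add: dist_norm norm_minus_commute)
      finally show ?thesis .
    qed
    then show ?thesis by (auto simp: dist_norm norm_minus_commute)
  qed
  have "emeasure lebesgue ?B' \<le> ennreal (B\<^sup>2) * emeasure lebesgue (\<Union>i \<in> C. ball (fst i) (snd i))"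
  proof (rule emeasure_UN_mono_mult)
    show "disjoint_family_on (\<lambda>i. ball (fst i) (snd i)) C"
      using C(3) unfolding disjoint_family_on_def pairwise_def disjnt_def by blast
    show "emeasure lebesgue (ball (f (fst i)) (B * snd i)) \<le> ennreal (B\<^sup>2) * emeasure lebesgue (ball (fst i) (snd i))"
      if "i \<in> C" for i
    proof -
      have "snd i > 0" using that C by auto
      then have "ennreal (pi * (B * snd i)\<^sup>2) = ennreal (B\<^sup>2) * ennreal (pi * (snd i)\<^sup>2)"
        by (simp add: power_mult_distrib mult_ac flip: ennreal_mult)
      then show ?thesis using \<open>B > 0\<close> \<open>snd i > 0\<close>
        by (metis emeasure_ball_complex less_imp_le mult_nonneg_nonneg order_refl)
    qed
  qed (use C in auto)
  also have "\<dots> \<le> ennreal (B\<^sup>2) * emeasure lebesgue U"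
  proof (intro mult_left_mono emeasure_mono)
    have "ball (fst i) (snd i) \<subseteq> U" if "i \<in> C" for i using C(2) that by force
    then show "(\<Union>i \<in> C. ball (fst i) (snd i)) \<subseteq> U" by blast
  qed (use U in auto)
  also have "\<dots> \<le> ennreal (B\<^sup>2) * (emeasure lebesgue S + ennreal e)"
    using mU by (intro mult_left_mono) auto
  finally have le: "emeasure lebesgue ?B' \<le> \<dots>" .
  have B'm: "?B' \<in> sets lebesgue" using C(1) by (intro sets.countable_UN'') auto
  have img': "f ` S \<subseteq> f ` ?N \<union> ?B'"
  proof
    fix y assume "y \<in> f ` S"
    then obtain x where x: "x \<in> U" "y = f x" using U(2) by blast
    show "y \<in> f ` ?N \<union> ?B'"
    proof (cases "x \<in> ?N")
      case False
      then obtain i where i: "i \<in> C" "x \<in> ball (fst i) (snd i)" using x by blast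
      then have "f x \<in> ball (f (fst i)) (B * snd i)" using img[of "fst i" "snd i"] by (metis imageI prod.collapse subsetD)
      with i x show ?thesis by blast
    qed (use x in blast)
  qed
  have eq: "emeasure lebesgue (f ` ?N \<union> ?B') = emeasure lebesgue ?B'"
  proof -
    have "f ` ?N \<in> null_sets lebesgue" using neg negligible_iff_null_sets by blast
    from emeasure_Un_null_set[OF B'm this] show ?thesis by (simp only: Un_commute)
  qed
  have "f ` ?N \<union> ?B' \<in> sets lebesgue"
    using negligible_imp_sets[OF neg] B'm by (rule sets.Un)
  then show ?thesis
  proof (rule bexI[rotated], intro conjI)
    show "f ` S \<subseteq> f ` ?N \<union> ?B'" by (rule img')
    show "emeasure lebesgue (f ` ?N \<union> ?B') \<le> ennreal (B\<^sup>2) * (emeasure lebesgue S + ennreal e)"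
      unfolding eq by (rule le)
  qed
qed

section \<open>Distortion of univalent functions\<close>

lemma deriv_bound_ball:
  assumes "f holomorphic_on ball z r" "r > 0" "\<And>u. u \<in> ball z r \<Longrightarrow> cmod (f u - y) \<le> B"
  shows "cmod (deriv f z) \<le> 2 * B / r"
proof -
  have sub: "cball z (r/2) \<subseteq> ball z r" using assms by (auto simp: dist_norm)
  have hol: "(\<lambda>u. f u - y) holomorphic_on ball z r" by (intro holomorphic_intros assms)
  have "cmod ((deriv ^^ 1) (\<lambda>u. f u - y) z) \<le> fact 1 * B / (r/2) ^ 1"
  proof (rule Cauchy_inequality)
    show "(\<lambda>u. f u - y) holomorphic_on ball z (r/2)"
      using hol by (rule holomorphic_on_subset) (use sub in auto)
    show "continuous_on (cball z (r/2)) (\<lambda>u. f u - y)"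
      using hol sub by (meson holomorphic_on_imp_continuous_on holomorphic_on_subset)
    show "cmod (f x - y) \<le> B" if "cmod (z - x) = r/2" for x
      using that assms(2) by (intro assms(3)) (auto simp: dist_norm)
  qed (use assms in auto)
  moreover have "deriv (\<lambda>u. f u - y) z = deriv f z"
  proof -
    have "f field_differentiable at z" using assms(1,2) holomorphic_on_imp_differentiable_at by auto
    then show ?thesis by (simp add: deriv_diff)
  qed
  ultimately show ?thesis by (simp add: mult.commute)
qed

text \<open>The growth bound of Koebe's theorem with a worse constant. If \<open>g\<close> is univalent and omits \<open>a\<close>,
  then a square root of \<open>(a - g) / (a - g w)\<close> omits both \<open>0\<close> and one of \<open>1\<close>, \<open>-1\<close>, so Schottky's
  theorem applies to it.\<close>

lemma univalent_growth:
  "\<exists>C>0. \<forall>g w r. r > 0 \<longrightarrow> g holomorphic_on ball w r \<longrightarrow> inj_on g (ball w r) \<longrightarrow>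
     (\<forall>u\<in>cball w (3/4 * r). cmod (g u - g w) \<le> C * r * cmod (deriv g w))"
proof -
  \<comment> \<open>Schottky's bound for functions of modulus at most 1 at the centre, on the disc
    of radius \<open>6/7\<close>, which is the quotient of \<open>3/4\<close> and
    \<open>7/8\<close>.\<close>
  define M where "M = exp (pi * exp (pi * (2 + 2 * 1 + 12 * (6/7) / (1 - 6/7))))"
  define C where "C = 2 * (1 + M\<^sup>2)"
  have "C > 0" by (simp add: C_def add_pos_nonneg)
  moreover have "cmod (g u - g w) \<le> C * r * cmod (deriv g w)"
    if r: "r > 0" and hol: "g holomorphic_on ball w r" and inj: "inj_on g (ball w r)"
      and u: "u \<in> cball w (3/4 * r)" for g w u and r :: real
  proof -
    obtain h where h: "h holomorphic_on g ` ball w r"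
        "\<And>z. z \<in> ball w r \<Longrightarrow> deriv g z * deriv h (g z) = 1"
        "\<And>z. z \<in> ball w r \<Longrightarrow> h (g z) = z"
      using holomorphic_has_inverse[OF hol _ inj] by auto
    have op: "open (g ` ball w r)" using open_mapping_thm3[OF hol _ inj] by auto
    \<comment> \<open>An inverse defined on the whole plane would be bounded and entire, hence
      constant.\<close>
    have "g ` ball w r \<noteq> UNIV"
    proof
      assume U: "g ` ball w r = UNIV"
      have "bounded (range h)"
      proof (rule bounded_subset[OF bounded_ball[of w r]])
        show "range h \<subseteq> ball w r"
          using h(3) U by (metis (no_types, lifting) image_iff image_subset_iff rangeI)
      qed
      then obtain k where k: "\<And>z. h z = k"
        using Liouville_theorem[of h] h(1) U unfolding constant_on_def by auto
      have "w = k" "w + of_real (r/2) = k"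
        using h(3)[of w] h(3)[of "w + of_real (r/2)"] k r by (auto simp: dist_norm)
      then show False using r by simp
    qed
    then have ne: "- (g ` ball w r) \<noteq> {}" by blast
    have "closed (- (g ` ball w r))" using op by (simp add: closed_Compl)
    from distance_attains_inf[OF this ne, of "g w"]
    obtain a where a: "a \<in> - (g ` ball w r)"
        "\<And>y. y \<in> - (g ` ball w r) \<Longrightarrow> dist (g w) a \<le> dist (g w) y"
      by blast
    define d where "d = dist (g w) a"
    have d: "d > 0" using a(1) r by (auto simp: d_def)
    have subd: "ball (g w) d \<subseteq> g ` ball w r" using a(2) by (force simp: d_def)
    \<comment> \<open>With \<open>a\<close> a nearest omitted value, the inverse \<open>h\<close> is
      defined on the disc of radius \<open>d\<close> about \<open>g w\<close>; Cauchy's estimate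
      there bounds \<open>d\<close> by \<open>2 * r * cmod (deriv g w)\<close>.\<close>
    have "cmod (deriv h (g w)) \<le> 2 * r / d"
    proof (rule deriv_bound_ball)
      show "h holomorphic_on ball (g w) d" using h(1) subd holomorphic_on_subset by blast
      show "cmod (h v - w) \<le> r" if v: "v \<in> ball (g w) d" for v
      proof -
        obtain z where "z \<in> ball w r" "v = g z" using v subd by blast
        then show ?thesis using h(3) by (simp add: dist_norm norm_minus_commute less_imp_le)
      qed
    qed (use d in auto)
    moreover have "cmod (deriv g w) * cmod (deriv h (g w)) = 1"
      using h(2)[of w] r by (simp flip: norm_mult)
    ultimately have "1 \<le> cmod (deriv g w) * (2 * r / d)"
      by (metis mult_left_mono norm_ge_zero)
    then have dle: "d \<le> 2 * r * cmod (deriv g w)" using d by (simp add: field_simps)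
    \<comment> \<open>Shrinking the radius by \<open>7/8\<close> makes \<open>k\<close> holomorphic
      on the closed unit disc.\<close>
    define k where "k = (\<lambda>v. (a - g (w + of_real (7/8 * r) * v)) / (a - g w))"
    have arg: "w + of_real (7/8 * r) * v \<in> ball w r" if "v \<in> cball 0 1" for v
    proof -
      have "cmod (of_real (7/8 * r) * v) \<le> (7/8 * r) * 1"
        using that r by (subst norm_mult) (auto intro!: mult_left_mono)
      then show ?thesis using r by (simp add: dist_norm)
    qed
    have an: "a - g v \<noteq> 0" if "v \<in> ball w r" for v using a(1) that by auto
    have holk: "k holomorphic_on cball 0 1"
    proof -
      have "(g \<circ> (\<lambda>v. w + of_real (7/8 * r) * v)) holomorphic_on cball 0 1"
        by (rule holomorphic_on_compose_gen[OF _ hol]) (use arg in \<open>auto intro!: holomorphic_intros\<close>)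
      then show ?thesis unfolding k_def comp_def
        by (intro holomorphic_intros) (use an[of w] r in auto)
    qed
    have knz: "k v \<noteq> 0" if "v \<in> cball 0 1" for v
      using an[OF arg[OF that]] an[of w] r by (simp add: k_def)
    have contr: "contractible (cball 0 1 :: complex set)" by (simp add: convex_imp_contractible)
    obtain q where q: "q holomorphic_on cball 0 1" "\<And>z. z \<in> cball 0 1 \<Longrightarrow> k z = (q z)\<^sup>2"
      using contractible_imp_holomorphic_sqrt[OF holk contr] knz by blast
    have k0: "k 0 = 1" using an[of w] r by (simp add: k_def)
    have q0: "(q 0)\<^sup>2 = 1" using q(2)[of 0] k0 by simp
    then have q0': "q 0 \<noteq> 0" by auto
    \<comment> \<open>The sign gives \<open>Q 0 = -1\<close>. The value 1 is then omitted: it would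
      give \<open>k = 1\<close>, so by injectivity of \<open>g\<close> the argument would be
      0.\<close>
    define Q where "Q = (\<lambda>v. - q v / q 0)"
    have Q2: "(Q v)\<^sup>2 = k v" if "v \<in> cball 0 1" for v
      using q(2)[OF that] q0 by (simp add: Q_def power_divide)
    have Q0: "Q 0 = -1" using q0' by (simp add: Q_def)
    define v where "v = (u - w) / of_real (7/8 * r)"
    have v: "cmod v \<le> 6/7" "u = w + of_real (7/8 * r) * v"
    proof -
      have "cmod v = cmod (u - w) / (7/8 * r)" unfolding v_def norm_divide norm_of_real using r by simp
      also have "\<dots> \<le> (3/4 * r) / (7/8 * r)"
        using u r by (intro divide_right_mono) (auto simp: dist_norm norm_minus_commute)
      finally show "cmod v \<le> 6/7" using r by simp
    next
      have "of_real (7/8 * r) \<noteq> (0::complex)" using r by simp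
      then show "u = w + of_real (7/8 * r) * v"
        unfolding v_def nonzero_mult_div_cancel_left times_divide_eq_right by simp
    qed
    have "cmod (Q v) \<le> M" unfolding M_def
    proof (rule Schottky[of Q 1 "6/7" v])
      show "Q holomorphic_on cball 0 1" unfolding Q_def by (intro holomorphic_intros q q0')
      show "\<not> (Q z = 0 \<or> Q z = 1)" if z: "z \<in> cball 0 1" for z
      proof
        assume "Q z = 0 \<or> Q z = 1"
        with Q2[OF z] knz[OF z] have "Q z = 1" "k z = 1" by auto
        then have "g (w + of_real (7/8 * r) * z) = g w"
          using an[of w] r by (simp add: k_def field_simps)
        then have "w + of_real (7/8 * r) * z = w"
          using inj arg[OF z] r by (auto dest: inj_onD)
        then have "z = 0" using r by simp
        with \<open>Q z = 1\<close> Q0 show False by simp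
      qed
    qed (use Q0 v in auto)
    then have "cmod (k v) \<le> M\<^sup>2"
    proof -
      have "v \<in> cball 0 1" using v(1) by simp
      then have "cmod (k v) = (cmod (Q v))\<^sup>2" by (metis Q2 norm_power)
      then show ?thesis using \<open>cmod (Q v) \<le> M\<close> by (simp add: power_mono)
    qed
    moreover have "g u - g w = (a - g w) * (1 - k v)"
    proof -
      have "k v = (a - g u) / (a - g w)" unfolding k_def v(2)[symmetric] ..
      then show ?thesis using an[of w] r by (simp add: field_simps)
    qed
    moreover have "cmod (a - g w) = d" by (simp add: d_def dist_norm norm_minus_commute)
    ultimately have "cmod (g u - g w) \<le> d * (1 + M\<^sup>2)"
      using norm_triangle_ineq4[of 1 "k v"] d by (simp add: norm_mult)
    also have "\<dots> \<le> (2 * r * cmod (deriv g w)) * (1 + M\<^sup>2)"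
      using dle by (intro mult_right_mono) auto
    finally show ?thesis by (simp add: C_def algebra_simps)
  qed
  ultimately show ?thesis by blast
qed

text \<open>Growth about \<open>v\<close> bounds \<open>g - g v\<close> on a disc about
  \<open>u\<close>, and Cauchy's estimate turns this into a bound for the derivative at
  \<open>u\<close>. The radii fit because 1/4 + 3/4 = 1 and 1/16 + 1/4 + 1/4 = (3/4) *
  (3/4).\<close>

lemma univalent_distortion:
  "\<exists>C\<ge>1. \<forall>g w r. r > 0 \<longrightarrow> g holomorphic_on ball w r \<longrightarrow> inj_on g (ball w r) \<longrightarrow>
     (\<forall>u\<in>ball w (r/4). \<forall>v\<in>ball w (r/4). cmod (deriv g u) \<le> C * cmod (deriv g v))"
proof -
  obtain C where C: "C > 0" and growth: "\<And>g w r u. r > 0 \<Longrightarrow> g holomorphic_on ball w r \<Longrightarrow> inj_on g (ball w r) \<Longrightarrow>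
     u\<in>cball w (3/4 * r) \<Longrightarrow> cmod (g u - g w) \<le> C * r * cmod (deriv g w)"
    using univalent_growth by blast
  have main: "cmod (deriv g u) \<le> max 1 (24 * C) * cmod (deriv g v)"
    if r: "r > 0" and hol: "g holomorphic_on ball w r" and inj: "inj_on g (ball w r)"
      and u: "u \<in> ball w (r/4)" and v: "v \<in> ball w (r/4)" for g w u v and r :: real
  proof -
    have sub: "ball v (3/4 * r) \<subseteq> ball w r" 
    proof
      fix x assume "x \<in> ball v (3/4 * r)"
      then show "x \<in> ball w r" using v dist_triangle[of w x v] by simp
    qed
    have sub2: "ball u (r/16) \<subseteq> cball v (3/4 * (3/4 * r))"
    proof
      fix x assume "x \<in> ball u (r/16)"
      then have "dist u x < r/16" "dist w u < r/4" "dist w v < r/4" using u v by auto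
      then have "dist v x < r/16 + r/4 + r/4"
        using dist_triangle[of v x w] dist_triangle[of w x u] by (simp add: dist_commute)
      then show "x \<in> cball v (3/4 * (3/4 * r))" using r by simp
    qed
    have sub3: "cball v (3/4 * (3/4 * r)) \<subseteq> ball v (3/4 * r)" using r by auto
    have "cmod (deriv g u) \<le> 2 * (C * (3/4 * r) * cmod (deriv g v)) / (r/16)"
    proof (rule deriv_bound_ball)
      show "g holomorphic_on ball u (r/16)"
        using hol sub sub2 sub3 by (meson holomorphic_on_subset order_trans)
      show "cmod (g x - g v) \<le> C * (3/4 * r) * cmod (deriv g v)" if "x \<in> ball u (r/16)" for x
        using growth[of "3/4*r" g v x] hol inj sub sub2 that r
        by (meson holomorphic_on_subset inj_on_subset mult_pos_pos subsetD zero_less_divide_iff zero_less_numeral)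
    qed (use r in auto)
    also have "\<dots> = 24 * C * cmod (deriv g v)" using r by simp
    also have "\<dots> \<le> max 1 (24 * C) * cmod (deriv g v)" by (intro mult_right_mono) auto
    finally show ?thesis .
  qed
  show ?thesis by (rule exI[of _ "max 1 (24 * C)"]) (use main in auto)
qed

section \<open>Inverse branches and blow-up at density points\<close>

lemma exp_map_iterate_Suc: "(iter c (Suc n)) z = c * exp ((iter c n) z)"
  by (simp only: funpow.simps comp_apply exp_map_def[of c "(iter c n) z"])

lemma exp_map_iterate_holomorphic [holomorphic_intros]: "(iter c n) holomorphic_on S"
proof (induction n)
  case (Suc n)
  then have "(\<lambda>z. c * exp ((iter c n) z)) holomorphic_on S" by (intro holomorphic_intros)
  then show ?case by (simp only: exp_map_iterate_Suc[abs_def, symmetric] )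
qed (simp add: id_def)

lemma exp_map_iterate_differentiable: "(iter c n) field_differentiable at z"
  using exp_map_iterate_holomorphic[where S = UNIV] holomorphic_on_imp_differentiable_at by blast

lemma deriv_exp_map_iterate_Suc:
  "deriv (iter c (Suc n)) z = (iter c (Suc n)) z * deriv (iter c n) z"
proof -
  have "((iter c n) has_field_derivative deriv (iter c n) z) (at z)"
    using exp_map_iterate_differentiable DERIV_deriv_iff_field_differentiable by blast
  then have "((\<lambda>z. c * exp ((iter c n) z)) has_field_derivative
      c * (exp ((iter c n) z) * deriv (iter c n) z)) (at z)"
    by (intro derivative_eq_intros) auto
  then show ?thesis 
    by (metis (no_types, lifting) DERIV_cong_ev DERIV_imp_deriv exp_map_iterate_Suc ext mult.assoc)
qed

text \<open>A branch for \<open>n\<close> steps extends by a logarithm as long as it has no zero,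
  since the ball is simply connected; a zero would put the \<open>n\<close>-th point of the singular
  orbit into the ball.\<close>

lemma exp_map_iterate_inverse_branch:
  assumes "c \<noteq> 0" "r > 0" "\<And>i. i < n \<Longrightarrow> (iter c i) 0 \<notin> ball ((iter c n) z) r"
  shows "\<exists>g. g holomorphic_on ball ((iter c n) z) r \<and> g ((iter c n) z) = z \<and>
          (\<forall>u\<in>ball ((iter c n) z) r. (iter c n) (g u) = u)"
  using assms
proof (induction n arbitrary: z)
  case 0
  show ?case by (rule exI[of _ "\<lambda>u. u"]) (simp add: holomorphic_on_ident)
next
  case (Suc n)
  have eq: "(iter c (Suc n)) y = (iter c n) (exp_map c y)" for y by (simp add: funpow_swap1)
  define w where "w = (iter c (Suc n)) z"
  have av: "(iter c i) 0 \<notin> ball w r" if "i < Suc n" for i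
    using Suc.prems(3)[OF that] unfolding w_def .
  obtain g1 where g1: "g1 holomorphic_on ball w r" "g1 w = exp_map c z"
      "\<And>u. u \<in> ball w r \<Longrightarrow> (iter c n) (g1 u) = u"
    using Suc.IH[of "exp_map c z"] Suc.prems(1,2) av unfolding w_def eq by force
  have nz: "g1 u / c \<noteq> 0" if "u \<in> ball w r" for u
  proof
    assume "g1 u / c = 0"
    then have "g1 u = 0" using \<open>c \<noteq> 0\<close> by simp
    then have "(iter c n) 0 = u" using g1(3)[OF that] by simp
    then show False using av[of n] that by simp
  qed
  have hol: "(\<lambda>u. g1 u / c) holomorphic_on ball w r" using \<open>c \<noteq> 0\<close> by (intro holomorphic_intros g1) auto
  have contr: "contractible (ball w r)" by (simp add: convex_imp_contractible)
  obtain l where l: "l holomorphic_on ball w r" "\<And>u. u \<in> ball w r \<Longrightarrow> g1 u / c = exp (l u)"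
    using contractible_imp_holomorphic_log[OF hol contr] nz by blast
  \<comment> \<open>\<open>l w - z\<close> is a multiple of 2 \<pi> i; subtracting it makes the
    branch pass through \<open>z\<close>.\<close>
  define g where "g = (\<lambda>u. l u - l w + z)"
  have "w \<in> ball w r" using \<open>r > 0\<close> by simp
  then have lw: "exp (l w) = exp z" using l(2) g1(2) \<open>c \<noteq> 0\<close> by (simp add: exp_map_def flip: l(2))
  have "exp_map c (g u) = g1 u" if "u \<in> ball w r" for u
    using l(2)[OF that] lw \<open>c \<noteq> 0\<close> by (simp add: exp_map_def g_def exp_add exp_diff field_simps)
  then have "(iter c (Suc n)) (g u) = u" if "u \<in> ball w r" for u
    using g1(3) that by (simp only: eq)
  moreover have "g holomorphic_on ball w r" unfolding g_def by (intro holomorphic_intros l)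
  moreover have "g w = z" by (simp add: g_def)
  ultimately show ?case unfolding w_def[symmetric] by blast
qed

definition density_point :: "complex set \<Rightarrow> complex \<Rightarrow> bool" where
  "density_point A z \<longleftrightarrow> (\<forall>\<eta>>0. \<exists>r0>0. \<forall>r. 0 < r \<and> r < r0 \<longrightarrow>
     measure lebesgue (ball z r - A) < \<eta> * measure lebesgue (ball z r))"

lemma negligible_not_density_point:
  assumes "A \<in> sets lebesgue"
  shows "negligible {z \<in> A. \<not> density_point A z}"
proof -
  define N where "N = (\<lambda>k::nat. {z \<in> A. \<forall>r0>0. \<exists>r. 0 < r \<and> r < r0 \<and>
     measure lebesgue (ball z r - A) \<ge> inverse (real (Suc k)) * measure lebesgue (ball z r)})"
  have "{z \<in> A. \<not> density_point A z} \<subseteq> (\<Union>k. N k)"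
  proof
    fix z assume "z \<in> {z \<in> A. \<not> density_point A z}"
    then obtain \<eta> where \<eta>: "z \<in> A" "\<eta> > 0" and *: "\<not> (\<exists>r0>0. \<forall>r. 0 < r \<and> r < r0 \<longrightarrow>
         measure lebesgue (ball z r - A) < \<eta> * measure lebesgue (ball z r))"
      unfolding density_point_def by blast
    have **: "\<exists>r. 0 < r \<and> r < r0 \<and> measure lebesgue (ball z r - A) \<ge> \<eta> * measure lebesgue (ball z r)"
      if "r0 > 0" for r0
      using * that by (meson not_le)
    obtain k where k: "inverse (real (Suc k)) < \<eta>" using reals_Archimedean[OF \<eta>(2)] by blast
    have "z \<in> N k" unfolding N_def
    proof (intro CollectI conjI allI impI \<eta>(1))
      fix r0 :: real assume "r0 > 0"
      then obtain r where r: "0 < r" "r < r0" "measure lebesgue (ball z r - A) \<ge> \<eta> * measure lebesgue (ball z r)"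
        using ** by blast
      have "inverse (real (Suc k)) * measure lebesgue (ball z r) \<le> \<eta> * measure lebesgue (ball z r)"
        using k by (intro mult_right_mono) auto
      with r show "\<exists>r. 0 < r \<and> r < r0 \<and>
         measure lebesgue (ball z r - A) \<ge> inverse (real (Suc k)) * measure lebesgue (ball z r)"
        by (meson order_trans)
    qed
    then show "z \<in> (\<Union>k. N k)" by blast
  qed
  moreover have "negligible (\<Union>k. N k)"
    unfolding N_def
  proof (rule negligible_countable_Union)
    fix S
    assume "S \<in> range (\<lambda>k. {z \<in> A. \<forall>r0>0. \<exists>r. 0 < r \<and> r < r0 \<and>
      measure lebesgue (ball z r - A) \<ge> inverse (real (Suc k)) * measure lebesgue (ball z r)})"
    then obtain k where S: "S = {z \<in> A. \<forall>r0>0. \<exists>r. 0 < r \<and> r < r0 \<and>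
      measure lebesgue (ball z r - A) \<ge> inverse (real (Suc k)) * measure lebesgue (ball z r)}"
      by blast
    show "negligible S" unfolding S by (rule negligible_nondensity_points[OF assms]) simp
  qed simp
  ultimately show ?thesis by (rule negligible_subset[rotated])
qed

text \<open>The inverse branch on the ball of radius \<open>4 * \<rho>\<close> has bounded
  distortion on the ball of radius \<rho>. It carries that ball into a tiny ball about the density
  point, where the complement of \<open>A\<close> has small relative area, and mapping forward
  scales areas by comparable factors everywhere.\<close>

lemma blowup_density:
  assumes c: "c \<noteq> 0" and A: "compact A" and z: "density_point A z" and "\<rho> > 0" "\<epsilon> > 0"
  shows "\<exists>\<Lambda>. \<forall>n. \<Lambda> \<le> cmod (deriv (iter c n) z) \<longrightarrow>
     (\<forall>i<n. (iter c i) 0 \<notin> ball ((iter c n) z) (4 * \<rho>)) \<longrightarrow>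
     measure lebesgue (ball ((iter c n) z) \<rho> - (iter c n) ` A) \<le> \<epsilon>"
proof -
  obtain C where C: "C \<ge> 1" and dist: "\<And>g w r u v. r > 0 \<Longrightarrow> g holomorphic_on ball w r \<Longrightarrow> inj_on g (ball w r) \<Longrightarrow>
     u \<in> ball w (r/4) \<Longrightarrow> v \<in> ball w (r/4) \<Longrightarrow> cmod (deriv g u) \<le> C * cmod (deriv g v)"
    using univalent_distortion by blast
  \<comment> \<open>Chosen so that \<open>(C * D)\<^sup>2 * 2 * \<eta> * pi * (C * \<rho> /
    D)\<^sup>2 = \<epsilon>\<close>, where \<open>D\<close> cancels.\<close>
  define \<eta> where "\<eta> = \<epsilon> / (2 * pi * C^4 * \<rho>\<^sup>2)"
  have \<eta>: "\<eta> > 0" using C \<open>\<rho> > 0\<close> \<open>\<epsilon> > 0\<close> by (simp add: \<eta>_def)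
  obtain r0 where r0: "r0 > 0" "\<And>r. 0 < r \<Longrightarrow> r < r0 \<Longrightarrow>
      measure lebesgue (ball z r - A) < \<eta> * measure lebesgue (ball z r)"
    using z \<eta> unfolding density_point_def by blast
  \<comment> \<open>Makes the radius \<open>C * \<rho> / D\<close> smaller than
    \<open>r0\<close>.\<close>
  define \<Lambda> where "\<Lambda> = C * \<rho> / r0 + 1"
  have "measure lebesgue (ball ((iter c n) z) \<rho> - (iter c n) ` A) \<le> \<epsilon>"
    if D: "\<Lambda> \<le> cmod (deriv (iter c n) z)"
      and av: "\<forall>i<n. (iter c i) 0 \<notin> ball ((iter c n) z) (4 * \<rho>)" for n
  proof -
    define F where "F = iter c n"
    define w where "w = F z"
    define D where "D = cmod (deriv F z)"
    have Dpos: "D \<ge> \<Lambda>" "\<Lambda> > 0" using D C \<open>\<rho> > 0\<close> r0 by (auto simp: D_def F_def \<Lambda>_def add_nonneg_pos)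
    have holF: "F holomorphic_on S" for S unfolding F_def by (rule exp_map_iterate_holomorphic)
    have Fder: "(F has_field_derivative deriv F y) (at y)" for y
      using holF[of UNIV] by (intro holomorphic_derivI[of F UNIV]) auto
    obtain g where g: "g holomorphic_on ball w (4 * \<rho>)" "g w = z" "\<And>u. u \<in> ball w (4 * \<rho>) \<Longrightarrow> F (g u) = u"
      using exp_map_iterate_inverse_branch[OF c, of "4 * \<rho>" n z] av \<open>\<rho> > 0\<close>
      unfolding F_def w_def by auto
    have inj: "inj_on g (ball w (4 * \<rho>))" using g(3) by (metis inj_onI)
    have gder: "(g has_field_derivative deriv g u) (at u)" if "u \<in> ball w (4 * \<rho>)" for u
      using g(1) that by (intro holomorphic_derivI[of g "ball w (4 * \<rho>)"]) auto
    have chain: "deriv F (g u) * deriv g u = 1" if u: "u \<in> ball w (4 * \<rho>)" for u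
    proof -
      have "((F \<circ> g) has_field_derivative deriv F (g u) * deriv g u) (at u)"
        using DERIV_chain[OF Fder gder[OF u]] .
      moreover have "((F \<circ> g) has_field_derivative 1) (at u)"
      proof (rule has_field_derivative_transform_within_open[OF DERIV_ident])
        show "open (ball w (4 * \<rho>))" "u \<in> ball w (4 * \<rho>)" using u by simp_all
      qed (simp add: g(3))
      ultimately show ?thesis by (rule DERIV_unique)
    qed
    have sub: "ball w \<rho> \<subseteq> ball w (4 * \<rho>)" using \<open>\<rho> > 0\<close> by auto
    have wb: "w \<in> ball w \<rho>" using \<open>\<rho> > 0\<close> by simp
    have g1: "cmod (deriv g w) = 1 / D"
      using chain[of w] wb sub Dpos unfolding g(2) D_def
      by (metis norm_mult norm_one nonzero_eq_divide_eq mult.commute subsetD less_le_trans less_irrefl)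
    have up: "cmod (deriv g u) \<le> C / D" if "u \<in> ball w \<rho>" for u
      using dist[of "4*\<rho>" g w u w] g(1) inj that wb \<open>\<rho> > 0\<close> g1 by simp
    have lo: "1 / D \<le> C * cmod (deriv g u)" if "u \<in> ball w \<rho>" for u
      using dist[of "4*\<rho>" g w w u] g(1) inj that wb \<open>\<rho> > 0\<close> g1 by simp
    have Fup: "cmod (deriv F (g u)) \<le> C * D" if u: "u \<in> ball w \<rho>" for u
    proof -
      have "cmod (deriv F (g u)) * cmod (deriv g u) = 1"
        using chain u sub by (metis norm_mult norm_one subsetD)
      moreover have "cmod (deriv F (g u)) * (1 / D) \<le> cmod (deriv F (g u)) * (C * cmod (deriv g u))"
        using lo[OF u] by (intro mult_left_mono) auto
      ultimately show ?thesis using Dpos by (simp add: field_simps)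
    qed
    define r where "r = C * \<rho> / D"
    have r: "0 < r" "r < r0"
    proof -
      show "0 < r" using C Dpos \<open>\<rho> > 0\<close> by (simp add: r_def)
      have "C * \<rho> / r0 < D" using Dpos by (simp add: \<Lambda>_def)
      then show "r < r0" using r0 Dpos by (simp add: r_def field_simps)
    qed
    have gsub: "g ` ball w \<rho> \<subseteq> ball z r"
    proof
      fix y assume "y \<in> g ` ball w \<rho>"
      then obtain u where u: "u \<in> ball w \<rho>" "y = g u" by blast
      have "cmod (g u - g w) \<le> C / D * cmod (u - w)"
      proof (rule field_differentiable_bound[of "ball w \<rho>" g "deriv g"])
        show "(g has_field_derivative deriv g x) (at x within ball w \<rho>)" if "x \<in> ball w \<rho>" for x
          using gder that sub by (meson has_field_derivative_at_within subsetD)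
      qed (use up u wb in auto)
      also have "\<dots> < C / D * \<rho>"
        using u C Dpos by (intro mult_strict_left_mono) (auto simp: dist_norm norm_minus_commute)
      finally show "y \<in> ball z r" using u g(2) by (simp add: r_def dist_norm norm_minus_commute)
    qed
    define G where "G = g ` ball w \<rho>"
    have opG: "open G" unfolding G_def
      using open_mapping_thm3[of g "ball w \<rho>"] g(1) inj sub
      by (meson holomorphic_on_subset inj_on_subset open_ball)
    have AL: "A \<in> sets lebesgue" using A by (simp add: compact_imp_closed borel_closed)
    have S1: "G - A \<in> sets lebesgue" using AL opG by (auto intro: borel_open)
    define e where "e = \<eta> * (pi * r\<^sup>2)"
    have e: "e > 0" using \<eta> r by (simp add: e_def)
    have "\<exists>T\<in>sets lebesgue. F ` (G - A) \<subseteq> T \<and>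
        emeasure lebesgue T \<le> ennreal ((C * D)\<^sup>2) * (emeasure lebesgue (G - A) + ennreal e)"
    proof (rule holomorphic_image_measure_le[OF opG holF _ S1 _ e])
      show "cmod (deriv F y) \<le> C * D" if "y \<in> G" for y using that Fup by (auto simp: G_def)
    qed (use C Dpos in auto)
    then obtain T where T: "T \<in> sets lebesgue" "F ` (G - A) \<subseteq> T"
        "emeasure lebesgue T \<le> ennreal ((C * D)\<^sup>2) * (emeasure lebesgue (G - A) + ennreal e)" by blast
    have le: "emeasure lebesgue (G - A) \<le> ennreal e"
    proof -
      have lm: "ball z r - A \<in> lmeasurable" using AL by (intro fmeasurable_Diff) auto
      have "emeasure lebesgue (G - A) \<le> emeasure lebesgue (ball z r - A)"
        using gsub AL by (intro emeasure_mono) (auto simp: G_def)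
      also have "\<dots> = ennreal (measure lebesgue (ball z r - A))"
        using lm by (simp add: emeasure_eq_measure2)
      also have "\<dots> \<le> ennreal (\<eta> * measure lebesgue (ball z r))"
        using r0(2)[OF r] by (intro ennreal_leI) simp
      also have "measure lebesgue (ball z r) = pi * r\<^sup>2" using r by (intro measure_ball_complex) simp
      finally show ?thesis by (simp add: e_def)
    qed
    have subT: "ball w \<rho> - F ` A \<subseteq> T"
    proof
      fix u assume u: "u \<in> ball w \<rho> - F ` A"
      then have "F (g u) = u" "g u \<in> G" using g(3) sub by (auto simp: G_def)
      then show "u \<in> T" using u T(2) by (metis DiffD2 DiffI image_eqI subsetD)
    qed
    have "emeasure lebesgue (ball w \<rho> - F ` A) \<le> emeasure lebesgue T"
      using subT T(1) by (intro emeasure_mono)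
    also have "\<dots> \<le> ennreal ((C * D)\<^sup>2) * (ennreal e + ennreal e)"
      using T(3) le by (meson add_right_mono mult_left_mono order_trans zero_le)
    also have "\<dots> = ennreal ((C * D)\<^sup>2 * (2 * e))"
      using e by (simp add: ennreal_mult ennreal_plus[symmetric] del: ennreal_plus)
    also have "(C * D)\<^sup>2 * (2 * e) = \<epsilon>"
      using Dpos C \<open>\<rho> > 0\<close> by (simp add: e_def \<eta>_def r_def field_simps power2_eq_square power4_eq_xxxx)
    finally have "emeasure lebesgue (ball w \<rho> - F ` A) \<le> ennreal \<epsilon>" .
    then have "enn2real (emeasure lebesgue (ball w \<rho> - F ` A)) \<le> enn2real (ennreal \<epsilon>)"
      by (rule enn2real_mono) simp
    then show ?thesis unfolding F_def[symmetric] w_def[symmetric] measure_def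
      using \<open>\<epsilon> > 0\<close> by simp
  qed
  then show ?thesis by blast
qed

section \<open>An expanding metric for postsingularly finite maps\<close>

abbreviation singular_orbit :: "complex \<Rightarrow> nat \<Rightarrow> complex" where
  "singular_orbit c i \<equiv> (iter c i) 0"

text \<open>The derivative of \<open>exp_map c\<close> at \<open>z\<close> is
  \<open>exp_map c z\<close>. Hence \<open>orbit_large\<close> makes the map strongly expanding at
  every point of the singular orbit, and it also keeps this orbit to the right of real part
  -1.\<close>

locale postsingularly_finite =
  fixes c p :: complex and n0 :: nat
  assumes n0: "n0 \<ge> 1" and orbit_n0: "singular_orbit c n0 = p" and fixed: "exp_map c p = p"
    and large: "cmod c > exp 5000"
    and orbit_large: "\<And>i. 1 \<le> i \<Longrightarrow> i \<le> n0 \<Longrightarrow> cmod (singular_orbit c i) > cmod c / 2"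
begin

definition PS :: "complex set" where "PS = range (singular_orbit c)"

lemma c_nonzero: "c \<noteq> 0" using large exp_gt_zero[of "5000::real"] by auto

lemma orbit_eventually_p: "i \<ge> n0 \<Longrightarrow> singular_orbit c i = p"
proof (induction i rule: dec_induct)
  case base then show ?case by (rule orbit_n0)
next
  case (step i)
  then have "exp_map c (singular_orbit c i) = p" using fixed by simp
  then show ?case by simp
qed

lemma finite_PS: "finite PS"
proof -
  have "PS \<subseteq> singular_orbit c ` {..n0}"
  proof
    fix x assume "x \<in> PS"
    then obtain i where i: "x = singular_orbit c i" by (auto simp: PS_def)
    show "x \<in> singular_orbit c ` {..n0}"
    proof (cases "i \<le> n0")
      case False
      then have "x = singular_orbit c n0" using orbit_eventually_p i orbit_n0 by simp
      then show ?thesis by blast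
    qed (simp add: i)
  qed
  then show ?thesis using finite_subset by blast
qed

lemma zero_in_PS: "0 \<in> PS"
  unfolding PS_def by (rule range_eqI[of _ _ 0]) simp

lemma exp_map_in_PS: "a \<in> PS \<Longrightarrow> exp_map c a \<in> PS"
proof -
  assume "a \<in> PS"
  then obtain i where "a = singular_orbit c i" by (auto simp: PS_def)
  then have "exp_map c a = singular_orbit c (Suc i)" by simp
  then show ?thesis unfolding PS_def by (rule range_eqI)
qed

lemma orbit_large': "i \<ge> 1 \<Longrightarrow> cmod (singular_orbit c i) > cmod c / 2"
proof (cases "i \<le> n0")
  case False
  then show ?thesis using orbit_eventually_p[of i] orbit_large[of n0] orbit_n0 n0 by simp
qed (rule orbit_large)

lemma exp_map_PS_large: "a \<in> PS \<Longrightarrow> cmod (exp_map c a) > cmod c / 2"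
proof -
  assume "a \<in> PS"
  then obtain i where "a = singular_orbit c i" by (auto simp: PS_def)
  then have "exp_map c a = singular_orbit c (Suc i)" by simp
  then show ?thesis using orbit_large'[of "Suc i"] by simp
qed

lemma norm_exp_map: "cmod (exp_map c z) = cmod c * exp (Re z)"
  by (simp add: exp_map_def norm_mult)

lemma Re_PS: "a \<in> PS \<Longrightarrow> Re a > -1"
proof -
  assume "a \<in> PS"
  then have "cmod c * exp (Re a) > cmod c * (1/2)" using exp_map_PS_large norm_exp_map by simp
  then have "exp (Re a) > 1/2" using c_nonzero by (simp add: mult_less_cancel_left)
  show "Re a > -1"
  proof (rule ccontr)
    assume "\<not> Re a > -1"
    then have "exp (Re a) \<le> exp (-1)" by simp
    also have "\<dots> = inverse (exp (1::real))" by (rule exp_minus)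
    also have "\<dots> \<le> inverse 2" using exp_ge_add_one_self[of "1::real"] by (intro le_imp_inverse_le) auto
    finally show False using \<open>exp (Re a) > 1/2\<close> by simp
  qed
qed

section \<open>Distance to the singular orbit and the expanding metric\<close>

definition dPS :: "complex \<Rightarrow> real" where "dPS z = infdist z PS"

lemma dPS_nonneg: "dPS z \<ge> 0" by (simp add: dPS_def infdist_nonneg)

lemma dPS_le: "a \<in> PS \<Longrightarrow> dPS z \<le> dist z a" by (simp add: dPS_def infdist_le)

lemma dPS_attained: "\<exists>a\<in>PS. dPS z = dist z a"
proof -
  have "closed PS" using finite_PS by (simp add: finite_imp_closed)
  then show ?thesis unfolding dPS_def using infdist_attains_inf[of PS z] zero_in_PS by blast
qed

lemma dPS_pos: "z \<notin> PS \<Longrightarrow> dPS z > 0"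
  using dPS_attained[of z] by auto

text \<open>For positive \<open>t\<close> this is \<open>t * ln (exp 4096 / t)\<close>, so
  \<open>1 / phi0\<close> is, up to a constant factor, the density of the hyperbolic metric of the
  punctured disc of radius \<open>exp 4096\<close>.\<close>

definition phi0 :: "real \<Rightarrow> real" where "phi0 t = t * (4096 - ln t)"

text \<open>The metric \<open>\<bar>dz\<bar> / phi z\<close>, a crude substitute for the hyperbolic metric of the complement of
  the singular orbit, is expanded by the map. The logarithm absorbs the distortion near the orbit,
  and the linear growth far to the left corresponds to the points that are mapped near \<open>0\<close>. The constants only have to satisfy
  \<open>2 * 2048 = 4096 < 5000\<close>, up to a margin.\<close>

definition phi :: "complex \<Rightarrow> real" where
  "phi z = (if Re z < -2048 then 2 * (- Re z) else phi0 (min 1 (dPS z)))"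

lemma phi0_mono: "0 < t \<Longrightarrow> t \<le> s \<Longrightarrow> s \<le> 1 \<Longrightarrow> phi0 t \<le> phi0 s"
proof -
  assume t: "0 < t" "t \<le> s" "s \<le> 1"
  have "ln (s/t) \<le> s/t - 1" using t by (intro ln_le_minus_one) auto
  then have "ln s - ln t \<le> (s - t)/t" using t by (simp add: ln_div diff_divide_distrib)
  then have 1: "t * (ln s - ln t) \<le> s - t" using t by (simp add: field_simps)
  have "ln s \<le> 0" using t by simp
  then have "(s - t) * 1 \<le> (s - t) * (4096 - ln s)"
    using t \<open>ln s \<le> 0\<close> by (intro mult_left_mono) linarith+
  with 1 show ?thesis unfolding phi0_def by (simp add: algebra_simps)
qed

lemma phi0_pos: "0 < t \<Longrightarrow> t \<le> 1 \<Longrightarrow> phi0 t > 0"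
  unfolding phi0_def by (intro mult_pos_pos) (use ln_le_zero_iff[of t] in linarith)+

lemma phi_pos: "z \<notin> PS \<Longrightarrow> phi z > 0"
  using phi0_pos[of "min 1 (dPS z)"] dPS_pos[of z] by (simp add: phi_def)

lemma phi_le: "w \<notin> PS \<Longrightarrow> \<not> Re w < -2048 \<Longrightarrow> dPS w \<le> s \<Longrightarrow> s \<le> 1 \<Longrightarrow> phi w \<le> phi0 s"
  using phi0_mono[of "min 1 (dPS w)" s] dPS_pos[of w] by (simp add: phi_def min_def split: if_splits)

lemma phi_le_4096: "w \<notin> PS \<Longrightarrow> \<not> Re w < -2048 \<Longrightarrow> phi w \<le> 4096"
  using phi0_mono[of "min 1 (dPS w)" 1] dPS_pos[of w] by (simp add: phi_def phi0_def)

text \<open>\<open>cmod (exp_map c z)\<close> is the modulus of the derivative, so the map expands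
  at least by 2 here. The critical case is \<open>z\<close> far to the left with image
  \<open>w\<close> close to 0: then \<open>- ln (cmod w)\<close> is below
  \<open>- Re z - 5000\<close>, and the linear growth of \<open>phi\<close> at \<open>z\<close> pays
  for the logarithm at \<open>w\<close>.\<close>

lemma phi_expanding_far:
  assumes z: "z \<notin> PS" "exp_map c z \<notin> PS" "dPS z \<ge> 1"
  shows "2 * phi (exp_map c z) \<le> cmod (exp_map c z) * phi z"
proof -
  define w where "w = exp_map c z"
  have w: "w \<notin> PS" using z by (simp add: w_def)
  have nw: "cmod w = cmod c * exp (Re z)" by (simp add: w_def norm_exp_map)
  have "exp 5000 * exp (Re z) < cmod w" unfolding nw using large by (intro mult_strict_right_mono) auto
  then have gt: "exp (5000 + Re z) < cmod w" by (simp add: exp_add)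
  have lin: "5001 + Re z < cmod w" using gt exp_ge_add_one_self[of "5000 + Re z"] by linarith
  have "2 * phi w \<le> cmod w * phi z"
  proof (cases "Re z < -2048")
    case True
    define x where "x = - Re z"
    have phz: "phi z = 2 * x" and x: "x > 2048" using True by (auto simp: phi_def x_def)
    show ?thesis
    proof (cases "Re w < -2048")
      case True
      then have "phi w \<le> 2 * cmod w" using abs_Re_le_cmod[of w] by (simp add: phi_def)
      moreover have "cmod w * 4096 \<le> cmod w * (2 * x)" using x by (intro mult_left_mono) auto
      ultimately show ?thesis using phz norm_ge_zero[of w] by (simp only:)
    next
      case False
      show ?thesis
      proof (cases "cmod w \<ge> 1")
        case True
        \<comment> \<open>Either \<open>x\<close> itself reaches 4096, or \<open>x < 4096\<close>
          forces \<open>cmod w \<ge> 2\<close> and \<open>x > 2048\<close> gives the rest.\<close>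
        have "cmod w * x \<ge> 4096"
        proof (cases "x \<ge> 4096")
          case t: True
          have "1 * 4096 \<le> cmod w * x" using True t by (intro mult_mono) auto
          then show ?thesis by simp
        next
          case False
          then have "cmod w \<ge> 2" using lin by (simp add: x_def)
          then have "2 * 2048 \<le> cmod w * x" using x by (intro mult_mono) auto
          then show ?thesis by simp
        qed
        then show ?thesis using phi_le_4096[OF w False] phz by simp
      next
        case lt: False
        have wpos: "0 < cmod w" using w zero_in_PS by auto
        have "phi w \<le> phi0 (cmod w)"
          using phi_le[OF w False, of "cmod w"] dPS_le[OF zero_in_PS, of w] lt by (simp add: dist_norm)
        also have "\<dots> \<le> cmod w * x"
        proof -
          have "ln (exp (5000 + Re z)) \<le> ln (cmod w)" using gt wpos by (subst ln_le_cancel_iff) auto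
          then show ?thesis unfolding phi0_def by (intro mult_left_mono) (auto simp: x_def)
        qed
        finally show ?thesis using phz by simp
      qed
    qed
  next
    case False
    then have phz: "phi z = 4096" using z by (simp add: phi_def phi0_def)
    have big: "cmod w \<ge> 2" using lin False by simp
    show ?thesis
    proof (cases "Re w < -2048")
      case True
      then have "phi w \<le> 2 * cmod w" using abs_Re_le_cmod[of w] by (simp add: phi_def)
      then show ?thesis using phz big by simp
    next
      case F: False
      show ?thesis using phi_le_4096[OF w F] phz big by simp
    qed
  qed
  then show ?thesis by (simp add: w_def)
qed

lemma norm_one_minus_exp_le: "cmod \<delta> = t \<Longrightarrow> t \<le> 1 \<Longrightarrow> cmod (1 - exp (- \<delta>)) \<le> t * (1 + 2 * t)"
proof -
  assume t: "cmod \<delta> = t" "t \<le> 1"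
  have t0: "t \<ge> 0" using t by auto
  have "cmod (exp (-\<delta>) - exp 0) \<le> exp t * cmod (-\<delta> - 0)"
  proof (rule field_differentiable_bound[of "cball 0 t" exp exp])
    show "(exp has_field_derivative exp x) (at x within cball 0 t)" for x :: complex
      by (rule DERIV_exp[THEN has_field_derivative_at_within])
    show "cmod (exp x) \<le> exp t" if "x \<in> cball 0 t" for x :: complex
      using that complex_Re_le_cmod[of x] by simp
    show "- \<delta> \<in> cball 0 t" "0 \<in> cball (0::complex) t" using t t0 by simp_all
  qed simp
  also have "\<dots> \<le> (1 + 2 * t) * t"
  proof -
    have "exp t \<le> 1 + t + t\<^sup>2" using exp_bound t t0 by blast
    also have "\<dots> \<le> 1 + 2 * t" using t t0 by (simp add: power2_eq_square mult_left_le)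
    finally show ?thesis using t t0 by (simp add: mult_right_mono)
  qed
  finally show ?thesis by (simp add: norm_minus_commute mult.commute)
qed

text \<open>Write \<open>t\<close> for \<open>dPS z\<close> and \<open>K\<close> for
  \<open>4096 - ln t\<close>. If the image \<open>w\<close> stays near the singular orbit, its
  distance is at most \<open>cmod w * t * (1 + 2 * t)\<close>, so its logarithmic term is at most
  \<open>K - 4998\<close>; this beats the distortion \<open>1 + 2 * t\<close> and leaves a factor
  \<open>1 + 1/K\<close>. In all other cases the expansion is at least by 2.\<close>

lemma phi_expanding_near:
  assumes z: "z \<notin> PS" "exp_map c z \<notin> PS" "dPS z < 1"
  shows "(1 + 1 / (4096 - ln (dPS z))) * phi (exp_map c z) \<le> cmod (exp_map c z) * phi z"
proof -
  define t where "t = dPS z"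
  define w where "w = exp_map c z"
  have w: "w \<notin> PS" using z by (simp add: w_def)
  have t: "0 < t" "t < 1" using z dPS_pos by (auto simp: t_def)
  obtain a where a: "a \<in> PS" "t = dist z a" using dPS_attained by (auto simp: t_def)
  define \<delta> where "\<delta> = z - a"
  have \<delta>: "cmod \<delta> = t" "z = a + \<delta>" by (auto simp: \<delta>_def a dist_norm)
  define m where "m = cmod (exp_map c a)"
  have wexp: "w = exp_map c a * exp \<delta>" by (simp add: w_def exp_map_def \<delta>(2) exp_add)
  define K where "K = 4096 - ln t"
  have K: "K \<ge> 4096" using t by (simp add: K_def)
  have "Re z > -2" using Re_PS[OF a(1)] \<delta> t abs_Re_le_cmod[of \<delta>] by (simp add: abs_le_iff)
  then have phz: "phi z = t * K" using t by (simp add: phi_def phi0_def K_def t_def)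
  have lnw: "ln (cmod w) \<ge> 4998"
  proof -
    have "ln 2 \<le> (1::real)" using ln_le_minus_one[of 2] by simp
    moreover have "ln m > ln (cmod c / 2)" unfolding m_def
      using exp_map_PS_large[OF a(1)] c_nonzero by (subst ln_less_cancel_iff) auto
    moreover have "ln (cmod c) > ln (exp 5000)" using large c_nonzero by (subst ln_less_cancel_iff) auto
    moreover have "ln (cmod c / 2) = ln (cmod c) - ln 2" using c_nonzero by (subst ln_divide_pos) auto
    ultimately have "ln m \<ge> 4999" by simp
    moreover have "ln (cmod w) = ln m + Re \<delta>"
      using c_nonzero by (simp add: wexp norm_mult m_def ln_mult exp_map_def)
    moreover have "Re \<delta> \<ge> -1" using \<delta> t abs_Re_le_cmod[of \<delta>] by (simp add: abs_le_iff)
    ultimately show ?thesis by simp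
  qed
  have wpos: "cmod w > 0" using w zero_in_PS by auto
  have wbig: "cmod w \<ge> 4999"
    using lnw wpos exp_ge_add_one_self[of "ln (cmod w)"] by simp
  \<comment> \<open>The displacement is expressed through \<open>w\<close> instead of
    \<open>exp_map c a\<close>, because \<open>cmod w\<close> is the derivative at
    \<open>z\<close>.\<close>
  define s where "s = cmod w * (t * (1 + 2 * t))"
  have s': "s = cmod w * t * (1 + 2 * t)" by (simp add: s_def)
  have spos: "s > 0" using wpos t by (simp add: s_def)
  have sle: "dist w (exp_map c a) \<le> s"
  proof -
    have "w - exp_map c a = w * (1 - exp (-\<delta>))" by (simp add: wexp algebra_simps exp_minus)
    then have "dist w (exp_map c a) = cmod w * cmod (1 - exp (-\<delta>))" by (simp add: dist_norm norm_mult)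
    also have "\<dots> \<le> s" unfolding s_def
      using norm_one_minus_exp_le[of \<delta> t] \<delta> t by (intro mult_left_mono) auto
    finally show ?thesis .
  qed
  have s3: "s \<le> 3 * (cmod w * t)"
  proof -
    have "cmod w * t * (1 + 2 * t) \<le> cmod w * t * 3" using t wpos by (intro mult_left_mono) auto
    then show ?thesis by (simp add: s_def mult_ac)
  qed
  have wt: "cmod w * t > 0" using wpos t by simp
  have Kle: "1 + 1/K \<le> 2" using K by simp
  have phw: "phi w > 0" using phi_pos[OF w] .
  have from2: "(1 + 1/K) * phi w \<le> cmod w * phi z" if "2 * phi w \<le> cmod w * phi z"
  proof -
    have "(1 + 1/K) * phi w \<le> 2 * phi w" using Kle phw by (intro mult_right_mono) auto
    with that show ?thesis by linarith
  qed
  have "(1 + 1/K) * phi w \<le> cmod w * phi z"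
  proof (cases "Re w < -2048")
    case True
    have "- Re w \<le> s + 1"
      using sle abs_Re_le_cmod[of "w - exp_map c a"] Re_PS[OF exp_map_in_PS[OF a(1)]]
      by (simp add: dist_norm abs_le_iff)
    then have "phi w \<le> 4 * s" using True by (simp add: phi_def)
    also have "\<dots> \<le> 12 * (cmod w * t)" using s3 by linarith
    finally have "2 * phi w \<le> 24 * (cmod w * t)" by linarith
    also have "\<dots> \<le> K * (cmod w * t)" using K wt by (intro mult_right_mono) auto
    finally show ?thesis by (intro from2) (simp add: phz mult_ac)
  next
    case Re: False
    have dw: "dPS w \<le> s" using dPS_le[OF exp_map_in_PS[OF a(1)], of w] sle by simp
    have p4: "phi w \<le> 4096" by (rule phi_le_4096[OF w Re])
    show ?thesis
    proof (cases "s \<ge> 1")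
      case True
      show ?thesis
      proof (cases "cmod w * t \<ge> 2")
        case True
        then have "2 * 4096 \<le> cmod w * t * K" using K by (intro mult_mono) auto
        then show ?thesis using p4 by (intro from2) (simp add: phz mult_ac)
      next
        case False
        \<comment> \<open>Since \<open>cmod w\<close> is at least \<open>exp 4998\<close>,
          \<open>t\<close> must be tiny; this raises \<open>K\<close> to at least 4096 + 4998 -
          1.\<close>
        then have "ln (cmod w * t) < ln 2" using wt by (subst ln_less_cancel_iff) auto
        moreover have "ln 2 \<le> (1::real)" using ln_le_minus_one[of 2] by simp
        ultimately have "ln (cmod w) + ln t < 1" using wpos t by (simp add: ln_mult)
        then have K2: "K \<ge> 9093" using lnw by (simp add: K_def)
        have "4999 * t \<le> cmod w * t" using wbig t by (intro mult_right_mono) auto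
        then have t2: "t \<le> 1/100" using False by simp
        have "cmod w * t * (1 + 2 * t) \<le> cmod w * t * (102/100)"
          using t2 wt by (intro mult_left_mono) auto
        then have "cmod w * t \<ge> 100/102" using True s' by linarith
        then have "100/102 * 9093 \<le> cmod w * t * K" using K2 by (intro mult_mono) auto
        then show ?thesis using p4 by (intro from2) (simp add: phz mult_ac)
      qed
    next
      case False
      have "cmod w * t * 1 \<le> cmod w * t * (1 + 2 * t)" using wt t by (intro mult_left_mono) auto
      then have wt1: "cmod w * t < 1" using False s' by linarith
      have "phi w \<le> phi0 s" using phi_le[OF w Re dw] False by simp
      also have "phi0 s \<le> s * (K - 4998)" unfolding phi0_def
      proof (intro mult_left_mono)
        have "ln s = ln (cmod w) + ln t + ln (1 + 2 * t)"
          unfolding s_def using wpos t by (simp add: ln_mult)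
        moreover have "ln (1 + 2 * t) \<ge> 0" using t by simp
        ultimately show "4096 - ln s \<le> K - 4998" using lnw by (simp add: K_def)
      qed (use spos in simp)
      finally have "phi w \<le> cmod w * t * ((1 + 2 * t) * (K - 4998))" unfolding s' by (simp only: mult_ac)
      then have "(1 + 1/K) * phi w \<le> (1 + 1/K) * (cmod w * t * ((1 + 2 * t) * (K - 4998)))"
        using K by (intro mult_left_mono) auto
      also have "\<dots> = cmod w * t * ((1 + 2 * t) * ((1 + 1/K) * (K - 4998)))" by (simp add: mult_ac)
      also have "\<dots> \<le> cmod w * t * K"
      proof (intro mult_left_mono)
        have "(1 + 1/K) * (K - 4998) = K - 4997 - 4998/K" using K by (simp add: field_simps)
        also have "\<dots> \<le> K - 4997" using K by simp
        finally have 1: "(1 + 1/K) * (K - 4998) \<le> K - 4997" .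
        have "4999 * t \<le> cmod w * t" using wbig t by (intro mult_right_mono) auto
        then have t2: "t \<le> 1/4999" using wt1 by simp
        \<comment> \<open>Bounds \<open>t * (- ln t)\<close> by 1, so that \<open>2 * t * K\<close>,
          the cost of the factor \<open>1 + 2 * t\<close>, is at most 4.\<close>
        have "ln (1/t) \<le> 1/t - 1" using t by (intro ln_le_minus_one) auto
        then have "- ln t \<le> 1/t" using t by (simp add: ln_div)
        then have "t * (- ln t) \<le> t * (1/t)" using t by (intro mult_left_mono) auto
        then have "t * (- ln t) \<le> 1" using t by simp
        then have "2 * t * K \<le> 8192 * t + 2" by (simp add: K_def algebra_simps)
        then have tK: "2 * t * K \<le> 4" using t2 by linarith
        have "(1 + 2 * t) * ((1 + 1/K) * (K - 4998)) \<le> (1 + 2 * t) * (K - 4997)"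
          using 1 t by (intro mult_left_mono) auto
        also have "\<dots> \<le> K - 4997 + 2 * t * K" using t by (simp add: algebra_simps)
        finally show "(1 + 2 * t) * ((1 + 1/K) * (K - 4998)) \<le> K" using tK by linarith
      qed (use wt in simp)
      finally show ?thesis by (simp only: phz mult_ac)
    qed
  qed
  then show ?thesis by (simp add: w_def K_def t_def)
qed

lemma phi_expanding:
  assumes "z \<notin> PS" "exp_map c z \<notin> PS"
  shows "phi (exp_map c z) \<le> cmod (exp_map c z) * phi z"
proof (cases "dPS z \<ge> 1")
  case True
  then show ?thesis using phi_expanding_far[OF assms] phi_pos[OF assms(2)] by linarith
next
  case False
  have "ln (dPS z) < 0" using False dPS_pos[OF assms(1)] by simp
  then have "1 * phi (exp_map c z) \<le> (1 + 1 / (4096 - ln (dPS z))) * phi (exp_map c z)"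
    using phi_pos[OF assms(2)] by (intro mult_right_mono) auto
  then show ?thesis using phi_expanding_near[OF assms] False by linarith
qed

lemma phi_expanding_uniform:
  assumes "\<rho> > 0"
  shows "\<exists>\<kappa>>0. \<forall>z. z \<notin> PS \<longrightarrow> exp_map c z \<notin> PS \<longrightarrow> dPS z \<ge> \<rho> \<longrightarrow>
     (1 + \<kappa>) * phi (exp_map c z) \<le> cmod (exp_map c z) * phi z"
proof -
  define r where "r = min 1 \<rho>"
  have r: "0 < r" "r \<le> 1" using assms by (auto simp: r_def)
  define \<kappa> where "\<kappa> = 1 / (4096 - ln r)"
  have lnr: "ln r \<le> 0" using r by simp
  have \<kappa>: "\<kappa> > 0" "\<kappa> \<le> 1" using lnr by (auto simp: \<kappa>_def field_simps)
  have "(1 + \<kappa>) * phi (exp_map c z) \<le> cmod (exp_map c z) * phi z"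
    if z: "z \<notin> PS" "exp_map c z \<notin> PS" "dPS z \<ge> \<rho>" for z
  proof (cases "dPS z \<ge> 1")
    case True
    have "(1 + \<kappa>) * phi (exp_map c z) \<le> 2 * phi (exp_map c z)"
      using \<kappa> phi_pos[OF z(2)] by (intro mult_right_mono) auto
    then show ?thesis using phi_expanding_far[OF z(1,2) True] by linarith
  next
    case False
    have "ln r \<le> ln (dPS z)" using r z(3) False by (subst ln_le_cancel_iff) (auto simp: r_def min_def split: if_splits)
    moreover have "ln (dPS z) < 0" using False dPS_pos[OF z(1)] by simp
    ultimately have "\<kappa> \<le> 1 / (4096 - ln (dPS z))" unfolding \<kappa>_def by (intro divide_left_mono mult_pos_pos) auto
    then have "(1 + \<kappa>) * phi (exp_map c z) \<le> (1 + 1 / (4096 - ln (dPS z))) * phi (exp_map c z)"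
      using phi_pos[OF z(2)] by (intro mult_right_mono) auto
    then show ?thesis using phi_expanding_near[OF z(1,2)] False by linarith
  qed
  with \<kappa> show ?thesis by blast
qed

text \<open>In the metric of \<open>phi\<close> no step contracts, and each visit at distance at
  least \<rho> expands by \<open>1 + \<kappa>\<close>. As \<open>phi\<close> is bounded below at
  such visits, comparing the metric at \<open>z\<close> and at a visit turns this into growth of the
  Euclidean derivative.\<close>

lemma derivative_growth_along_returns:
  assumes z: "\<And>n. (iter c n) z \<notin> PS" and "\<rho> > 0"
    and inf: "infinite {n. dPS ((iter c n) z) \<ge> \<rho>}"
  shows "\<exists>N. \<forall>n\<ge>N. dPS ((iter c n) z) \<ge> \<rho> \<longrightarrow> \<Lambda> \<le> cmod (deriv (iter c n) z)"
proof -
  let ?f = "\<lambda>n. (iter c n) z"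
  let ?D = "\<lambda>n. cmod (deriv (iter c n) z)"
  define V where "V = {n. dPS (?f n) \<ge> \<rho>}"
  obtain \<kappa> where \<kappa>: "\<kappa> > 0" "\<And>z. z \<notin> PS \<Longrightarrow> exp_map c z \<notin> PS \<Longrightarrow> dPS z \<ge> \<rho> \<Longrightarrow>
     (1 + \<kappa>) * phi (exp_map c z) \<le> cmod (exp_map c z) * phi z"
    using phi_expanding_uniform[OF \<open>\<rho> > 0\<close>] by blast
  have grow: "(1 + \<kappa>) ^ card (V \<inter> {..<n}) * phi (?f n) \<le> ?D n * phi z" for n
  proof (induction n)
    case (Suc n)
    define b where "b = (if n \<in> V then 1 + \<kappa> else 1)"
    have "V \<inter> {..<Suc n} = (if n \<in> V then insert n (V \<inter> {..<n}) else V \<inter> {..<n})"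
      by (auto simp: less_Suc_eq)
    then have card: "(1 + \<kappa>) ^ card (V \<inter> {..<Suc n}) = (1 + \<kappa>) ^ card (V \<inter> {..<n}) * b"
      by (simp add: b_def)
    have zz: "?f n \<notin> PS" "exp_map c (?f n) \<notin> PS" using z[of n] z[of "Suc n"] by auto
    have step: "b * phi (?f (Suc n)) \<le> cmod (?f (Suc n)) * phi (?f n)"
      using \<kappa>(2)[OF zz] phi_expanding[OF zz] by (simp add: b_def V_def)
    have "(1 + \<kappa>) ^ card (V \<inter> {..<Suc n}) * phi (?f (Suc n)) =
        (1 + \<kappa>) ^ card (V \<inter> {..<n}) * (b * phi (?f (Suc n)))" by (simp add: card mult_ac)
    also have "\<dots> \<le> (1 + \<kappa>) ^ card (V \<inter> {..<n}) * (cmod (?f (Suc n)) * phi (?f n))"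
      using step \<kappa> by (intro mult_left_mono) auto
    also have "\<dots> = cmod (?f (Suc n)) * ((1 + \<kappa>) ^ card (V \<inter> {..<n}) * phi (?f n))" by (simp add: mult_ac)
    also have "\<dots> \<le> cmod (?f (Suc n)) * (?D n * phi z)" using Suc by (intro mult_left_mono) auto
    also have "\<dots> = ?D (Suc n) * phi z"
      by (simp only: deriv_exp_map_iterate_Suc norm_mult mult.assoc)
    finally show ?case .
  qed (simp add: id_def)
  define m where "m = min 4096 (phi0 (min 1 \<rho>))"
  have m: "m > 0" using phi0_pos[of "min 1 \<rho>"] \<open>\<rho> > 0\<close> by (simp add: m_def)
  have phim: "phi (?f n) \<ge> m" if "n \<in> V" for n
    using that phi0_mono[of "min 1 \<rho>" "min 1 (dPS (?f n))"] \<open>\<rho> > 0\<close>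
    by (auto simp: phi_def m_def V_def min_le_iff_disj)
  have phz: "phi z > 0" using phi_pos z[of 0] by simp
  obtain k where k: "\<Lambda> * phi z / m < (1 + \<kappa>) ^ k"
    using real_arch_pow[of "1 + \<kappa>"] \<kappa> by auto
  obtain S where S: "finite S" "card S = k" "S \<subseteq> V"
    using infinite_arbitrarily_large[of V k] inf by (auto simp: V_def)
  define N where "N = Suc (Max (insert 0 S))"
  have "\<Lambda> \<le> ?D n" if n: "n \<ge> N" "n \<in> V" for n
  proof -
    have "S \<subseteq> V \<inter> {..<n}"
    proof
      fix x assume x: "x \<in> S"
      then have "x \<le> Max (insert 0 S)" using S(1) by (intro Max_ge) auto
      then show "x \<in> V \<inter> {..<n}" using x S(3) n(1) by (auto simp: N_def)
    qed
    then have "k \<le> card (V \<inter> {..<n})" using S card_mono by (metis finite_Int finite_lessThan)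
    then have "(1 + \<kappa>) ^ k \<le> (1 + \<kappa>) ^ card (V \<inter> {..<n})" using \<kappa> by (intro power_increasing) auto
    then have "(1 + \<kappa>) ^ k * m \<le> (1 + \<kappa>) ^ card (V \<inter> {..<n}) * phi (?f n)"
      using phim[OF n(2)] m \<kappa> by (intro mult_mono) auto
    also have "\<dots> \<le> ?D n * phi z" by (rule grow)
    finally have "(1 + \<kappa>) ^ k * m \<le> ?D n * phi z" .
    moreover have "\<Lambda> * phi z < (1 + \<kappa>) ^ k * m" using k m by (simp add: field_simps)
    ultimately have "\<Lambda> * phi z < ?D n * phi z" by linarith
    then show ?thesis using phz by (simp add: mult_less_cancel_right)
  qed
  then show ?thesis by (intro exI[of _ N]) (auto simp: V_def)
qed

end

section \<open>Recurrence of postsingularly finite maps\<close>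

text \<open>Countably many branches of the logarithm cover the preimage. The principal one is not
  differentiable on its cut, so a second family, rotated by \<pi>, treats the points whose
  exponential lies on the cut.\<close>

lemma negligible_exp_map_preimage:
  assumes "c \<noteq> 0" "negligible N"
  shows "negligible (exp_map c -` N)"
proof -
  define L where "L = (\<lambda>\<sigma> (k::int) w. Ln (\<sigma> * w / c) + (of_int (2 * k) * pi) * \<i> + (1 - \<sigma>) / 2 * pi * \<i>)"
  define X where "X = (\<lambda>\<sigma> k. L \<sigma> k ` (N \<inter> {w. \<sigma> * w / c \<notin> \<real>\<^sub>\<le>\<^sub>0}))"
  have neg: "negligible (X \<sigma> k)" for \<sigma> k
  proof -
    have "L \<sigma> k differentiable_on (N \<inter> {w. \<sigma> * w / c \<notin> \<real>\<^sub>\<le>\<^sub>0})"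
    proof -
      have "L \<sigma> k holomorphic_on {w. \<sigma> * w / c \<notin> \<real>\<^sub>\<le>\<^sub>0}"
        unfolding L_def using \<open>c \<noteq> 0\<close> by (intro holomorphic_intros) auto
      then show ?thesis
        using holomorphic_on_imp_differentiable_on differentiable_on_subset by (metis inf_le2)
    qed
    then show ?thesis unfolding X_def
      using negligible_subset[OF assms(2) Int_lower1]
      by (intro negligible_differentiable_image_negligible) simp_all
  qed
  have "exp_map c -` N \<subseteq> (\<Union>k. X 1 k) \<union> (\<Union>k. X (-1) k)"
  proof
    fix z assume z: "z \<in> exp_map c -` N"
    have e: "exp_map c z / c = exp z" using \<open>c \<noteq> 0\<close> by (simp add: exp_map_def)
    show "z \<in> (\<Union>k. X 1 k) \<union> (\<Union>k. X (-1) k)"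
    proof (cases "exp z \<in> \<real>\<^sub>\<le>\<^sub>0")
      case False
      have "exp z = exp (Ln (exp z))" by simp
      then obtain k :: int where "z = Ln (exp z) + (of_int (2 * k) * pi) * \<i>"
        unfolding exp_eq by blast
      then have "z = L 1 k (exp_map c z)" by (simp add: L_def e)
      then have "z \<in> X 1 k" using z False e unfolding X_def by auto
      then show ?thesis by blast
    next
      case True
      then have F: "- exp z \<notin> \<real>\<^sub>\<le>\<^sub>0"
        using exp_not_eq_zero[of z] by (auto simp: complex_nonpos_Reals_iff complex_eq_iff)
      have "exp (z - pi * \<i>) = - exp z" by (simp add: exp_diff exp_pi_i')
      also have "\<dots> = exp (Ln (- exp z))" by simp
      finally obtain k :: int where "z - pi * \<i> = Ln (- exp z) + (of_int (2 * k) * pi) * \<i>"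
        unfolding exp_eq by blast
      then have "z = L (-1) k (exp_map c z)" by (simp add: L_def e algebra_simps)
      then have "z \<in> X (-1) k" using z F e unfolding X_def by auto
      then show ?thesis by blast
    qed
  qed
  moreover have "negligible ((\<Union>k. X 1 k) \<union> (\<Union>k. X (-1) k))"
    by (intro negligible_Un negligible_countable_Union) (auto simp: neg)
  ultimately show ?thesis by (rule negligible_subset[rotated])
qed

lemma negligible_iterate_preimage:
  assumes "c \<noteq> 0" "negligible N"
  shows "negligible ((iter c n) -` N)"
proof (induction n)
  case (Suc n)
  have "(iter c (Suc n)) -` N = exp_map c -` ((iter c n) -` N)"
    unfolding funpow_Suc_right by (simp only: vimage_comp)
  then show ?case using negligible_exp_map_preimage[OF assms(1) Suc] by (simp only:)
qed (use assms in simp)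

lemma nonnegligible_compact_subset:
  assumes "A \<in> sets lebesgue" "\<not> negligible A"
  obtains K where "compact K" "K \<subseteq> A" "\<not> negligible K"
proof -
  obtain N C where NC: "negligible N" "\<And>n::nat. compact (C n)" "A = (\<Union>n. C n) \<union> N"
    using lebesgue_regular_inner[OF assms(1)] by metis
  have "\<exists>n. \<not> negligible (C n)"
  proof (rule ccontr)
    assume "\<nexists>n. \<not> negligible (C n)"
    then have "negligible (\<Union>n. C n)" by (intro negligible_countable_Union) auto
    then show False using NC(1,3) assms(2) by (simp add: negligible_Un)
  qed
  then show thesis using NC that by blast
qed

lemma exp_map_iterate_continuous: "continuous_on S (iter c n)"
  using exp_map_iterate_holomorphic holomorphic_on_imp_continuous_on by blast

lemma closed_iterate_vimage: "closed S \<Longrightarrow> closed ((iter c n) -` S)"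
  by (intro continuous_closed_vimage field_differentiable_imp_continuous_at exp_map_iterate_differentiable)

section \<open>Almost every orbit returns to a compact set off the singular orbit\<close>

context postsingularly_finite
begin

text \<open>Along such orbits the derivative at least doubles at each step, and the margin 40 keeps
  the singular orbit out of balls of radius 40. So if the set were not null, blowing up at a density
  point would fill a ball of radius 10 up to area 1. But this ball contains a unit disc, of area
  \<pi>, that is mapped into the left half-plane.\<close>

lemma negligible_Re_bounded_below:
  assumes M: "M \<ge> 0" "\<And>a. a \<in> PS \<Longrightarrow> Re a + 40 < M"
  shows "negligible {z. \<forall>n. Re ((iter c n) z) \<ge> M}" (is "negligible ?E")
proof (rule ccontr)
  assume "\<not> negligible ?E"
  have "closed ?E"
  proof -
    have "closed (\<Inter>n. (iter c n) -` {z. M \<le> Re z})"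
      by (intro closed_INT ballI closed_iterate_vimage closed_halfspace_Re_ge)
    moreover have "?E = (\<Inter>n. (iter c n) -` {z. M \<le> Re z})" by auto
    ultimately show ?thesis by simp
  qed
  then have "?E \<in> sets lebesgue" by (simp add: borel_closed)
  then obtain A where A: "compact A" "A \<subseteq> ?E" "\<not> negligible A"
    using nonnegligible_compact_subset \<open>\<not> negligible ?E\<close> by blast
  have "A \<in> sets lebesgue" using A by (simp add: compact_imp_closed borel_closed)
  from negligible_not_density_point[OF this] obtain z where z: "z \<in> A" "density_point A z"
    using A(3) negligible_subset by (metis (mono_tags, lifting) mem_Collect_eq subsetI)
  have ReM: "Re ((iter c n) z) \<ge> M" for n using z A by blast
  have c2: "cmod c \<ge> 2" using large exp_ge_add_one_self[of "5000::real"] by linarith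
  have D: "cmod (deriv (iter c n) z) \<ge> 2 ^ n" for n
  proof (induction n)
    case (Suc n)
    have "2 * 1 \<le> cmod c * exp (Re ((iter c n) z))"
      using c2 ReM[of n] M(1) by (intro mult_mono) auto
    then have "2 \<le> cmod ((iter c (Suc n)) z)" using norm_exp_map by simp
    then have "2 * 2 ^ n \<le> cmod ((iter c (Suc n)) z) * cmod (deriv (iter c n) z)"
      using Suc by (intro mult_mono) auto
    then show ?case by (simp only: deriv_exp_map_iterate_Suc norm_mult power_Suc)
  qed (simp add: id_def)
  obtain \<Lambda> where \<Lambda>: "\<And>n. \<Lambda> \<le> cmod (deriv (iter c n) z) \<Longrightarrow>
     \<forall>i<n. (iter c i) 0 \<notin> ball ((iter c n) z) (4 * 10) \<Longrightarrow>
     measure lebesgue (ball ((iter c n) z) 10 - (iter c n) ` A) \<le> 1"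
    using blowup_density[OF c_nonzero A(1) z(2), of 10 1] by auto
  obtain n where n: "\<Lambda> < 2 ^ n" using real_arch_pow[of 2 \<Lambda>] by auto
  define w where "w = (iter c n) z"
  have av: "\<forall>i<n. (iter c i) 0 \<notin> ball ((iter c n) z) (4 * 10)"
  proof (intro allI impI notI)
    fix i assume "(iter c i) 0 \<in> ball ((iter c n) z) (4 * 10)"
    then have "cmod ((iter c n) z - (iter c i) 0) < 40" by (simp add: dist_norm)
    then have "Re ((iter c n) z) < Re ((iter c i) 0) + 40"
      using complex_Re_le_cmod[of "(iter c n) z - (iter c i) 0"] by simp
    moreover have "Re ((iter c i) 0) + 40 < M" by (intro M(2)) (simp add: PS_def)
    ultimately show False using ReM[of n] by simp
  qed
  have le1: "measure lebesgue (ball w 10 - (iter c n) ` A) \<le> 1"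
    unfolding w_def by (intro \<Lambda> av) (use n D[of n] in linarith)
  define u where "u = exp_map c w"
  have u: "u \<noteq> 0" using c_nonzero by (simp add: u_def exp_map_def)
  \<comment> \<open>A vertical shift by at most \<pi> moves the image of \<open>w\<close> to the
    negative real axis.\<close>
  define s where "s = Arg (- (of_real (cmod u) / u))"
  define b where "b = w + \<i> * of_real s"
  have s: "\<bar>s\<bar> \<le> 4" using mpi_less_Arg[of "- (of_real (cmod u) / u)"] Arg_le_pi[of "- (of_real (cmod u) / u)"] pi_less_4
    by (simp add: s_def)
  have "exp (\<i> * of_real s) = - (of_real (cmod u) / u)"
    using Arg_eq[of "- (of_real (cmod u) / u)"] u unfolding s_def by (simp add: norm_divide)
  then have fb: "exp_map c b = - of_real (cmod u)"
    using u by (simp add: b_def exp_map_def exp_add u_def field_simps)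
  have sub: "ball b 1 \<subseteq> ball w 10 - (iter c n) ` A"
  proof
    fix y assume y: "y \<in> ball b 1"
    have "dist w b \<le> 4" using s by (simp add: b_def dist_norm norm_mult)
    then have "y \<in> ball w 10" using y dist_triangle[of w y b] by simp
    moreover have "y \<notin> (iter c n) ` A"
    proof
      assume "y \<in> (iter c n) ` A"
      then obtain x where x: "x \<in> A" "y = (iter c n) x" by blast
      then have "exp_map c y = (iter c (Suc n)) x" by simp
      then have ge: "Re (exp_map c y) \<ge> M" using x A(2) by (simp del: funpow.simps) blast
      have "exp_map c y = exp_map c b * exp (y - b)" by (simp add: exp_map_def exp_diff)
      also have "\<dots> = - (of_real (cmod u) * exp (y - b))" by (simp add: fb)
      finally have "Re (exp_map c y) = - (cmod u * (exp (Re (y - b)) * cos (Im (y - b))))"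
        by (simp add: Re_exp)
      moreover have "cos (Im (y - b)) > 0"
      proof (rule cos_gt_zero_pi)
        have "\<bar>Im (y - b)\<bar> < 1" using y abs_Im_le_cmod[of "y - b"] by (simp add: dist_norm norm_minus_commute)
        then show "- (pi / 2) < Im (y - b)" "Im (y - b) < pi / 2" using pi_gt3 by linarith+
      qed
      ultimately have "Re (exp_map c y) < 0" using u by simp
      then show False using ge M(1) by simp
    qed
    ultimately show "y \<in> ball w 10 - (iter c n) ` A" by blast
  qed
  have "compact ((iter c n) ` A)"
    by (intro compact_continuous_image exp_map_iterate_continuous A)
  then have lm: "ball w 10 - (iter c n) ` A \<in> lmeasurable"
    by (intro fmeasurable_Diff) (auto simp: compact_imp_closed borel_closed)
  have "measure lebesgue (ball b 1) \<le> measure lebesgue (ball w 10 - (iter c n) ` A)"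
    using sub lm by (intro measure_mono_fmeasurable) auto
  then show False using le1 pi_gt3 measure_ball_complex[of 1 b] by simp
qed

text \<open>Near \<open>a\<close> in \<open>PS\<close> the map is almost linear with a factor
  \<open>exp_map c a\<close> of modulus at least 4; losing at most a half in
  \<open>exp \<delta> - 1\<close> leaves 2. The separation constant \<sigma> ensures that
  \<open>exp_map c a\<close> is the point of \<open>PS\<close> nearest to the image.\<close>

lemma singular_orbit_repelling:
  "\<exists>\<rho>>0. \<rho> \<le> 1 \<and> (\<forall>z. dPS z < \<rho> \<longrightarrow> 2 * dPS z \<le> dPS (exp_map c z) \<and> dPS (exp_map c z) \<le> 1)"
proof -
  define X where "X = insert 1 ((\<lambda>(a, b). dist a b / 2) ` {(a, b) \<in> PS \<times> PS. a \<noteq> b})"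
  define \<sigma> where "\<sigma> = Min X"
  have finX: "finite X" unfolding X_def
    by (intro finite.insertI finite_imageI finite_subset[OF _ finite_cartesian_product[OF finite_PS finite_PS]]) auto
  have "\<forall>x\<in>X. x > 0" by (auto simp: X_def)
  then have \<sigma>: "\<sigma> > 0" using finX by (simp add: \<sigma>_def X_def)
  have \<sigma>1: "\<sigma> \<le> 1" unfolding \<sigma>_def using finX by (intro Min_le) (auto simp: X_def)
  have sep: "dist a b \<ge> 2 * \<sigma>" if "a \<in> PS" "b \<in> PS" "a \<noteq> b" for a b
  proof -
    have "dist a b / 2 \<in> X" unfolding X_def using that by (intro insertI2 image_eqI[of _ _ "(a, b)"]) auto
    then have "\<sigma> \<le> dist a b / 2" unfolding \<sigma>_def using finX by (intro Min_le)
    then show ?thesis by simp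
  qed
  define B where "B = Max (insert 1 ((\<lambda>a. cmod (exp_map c a)) ` PS))"
  have B: "cmod (exp_map c a) \<le> B" if "a \<in> PS" for a
    unfolding B_def using that finite_PS by (intro Max_ge) auto
  have B1: "B \<ge> 1" unfolding B_def using finite_PS by (intro Max_ge) auto
  \<comment> \<open>The bound \<open>1/6\<close> keeps the error of the linearization below
    \<open>t / 2\<close>; the other bound keeps the image within \<sigma> of
    \<open>exp_map c a\<close>.\<close>
  define \<rho> where "\<rho> = min (1/6) (\<sigma> / (3 * B))"
  have \<rho>: "\<rho> > 0" "\<rho> \<le> 1/6" "\<rho> \<le> \<sigma> / (3 * B)" using \<sigma> B1 by (auto simp: \<rho>_def)
  have "2 * dPS z \<le> dPS (exp_map c z) \<and> dPS (exp_map c z) \<le> 1" if dz: "dPS z < \<rho>" for z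
  proof -
    define t where "t = dPS z"
    obtain a where a: "a \<in> PS" "t = dist z a" using dPS_attained by (auto simp: t_def)
    define \<delta> where "\<delta> = z - a"
    have \<delta>: "cmod \<delta> = t" "z = a + \<delta>" by (auto simp: \<delta>_def a dist_norm)
    have t: "t \<ge> 0" "t < \<rho>" using dz by (auto simp: t_def dPS_nonneg)
    have up: "cmod (exp x - 1) \<le> 3 * t" if x: "cmod x \<le> t" for x
    proof -
      have "cmod (1 - exp (- (- x))) \<le> cmod (-x) * (1 + 2 * cmod (-x))"
        using x t \<rho> by (intro norm_one_minus_exp_le) auto
      also have "\<dots> \<le> t * 3" using x t \<rho> by (intro mult_mono) auto
      finally show ?thesis by (simp add: norm_minus_commute)
    qed
    have "cmod ((exp \<delta> - \<delta>) - (exp 0 - 0)) \<le> (3 * t) * cmod (\<delta> - 0)"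
    proof (rule field_differentiable_bound[of "cball 0 t" "\<lambda>x. exp x - x" "\<lambda>x. exp x - 1"])
      show "((\<lambda>x. exp x - x) has_field_derivative exp x - 1) (at x within cball 0 t)" for x :: complex
        by (intro derivative_eq_intros) auto
      show "\<delta> \<in> cball 0 t" "0 \<in> cball (0::complex) t" using \<delta> t by simp_all
    qed (use up in simp_all)
    then have "cmod (exp \<delta> - 1 - \<delta>) \<le> 3 * t * t" using \<delta> by (simp add: algebra_simps)
    also have "\<dots> \<le> (1/2) * t" using t \<rho> by (intro mult_right_mono) auto
    finally have lo: "cmod (exp \<delta> - 1) \<ge> t / 2"
      using norm_triangle_ineq2[of \<delta> "exp \<delta> - 1"] \<delta> by (simp add: norm_minus_commute algebra_simps)
    have fa: "exp_map c a \<in> PS" by (rule exp_map_in_PS[OF a(1)])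
    have eq: "dist (exp_map c z) (exp_map c a) = cmod (exp_map c a) * cmod (exp \<delta> - 1)"
      by (simp add: dist_norm exp_map_def \<delta>(2) exp_add algebra_simps flip: norm_mult)
    have "dist (exp_map c z) (exp_map c a) \<le> B * (3 * t)"
      unfolding eq using B[OF a(1)] up[of \<delta>] \<delta> B1 by (intro mult_mono) auto
    also have "\<dots> < B * (3 * (\<sigma> / (3 * B)))" using t \<rho> B1 by (intro mult_strict_left_mono) auto
    also have "\<dots> = \<sigma>" using B1 by simp
    finally have lt: "dist (exp_map c z) (exp_map c a) < \<sigma>" .
    obtain b where b: "b \<in> PS" "dPS (exp_map c z) = dist (exp_map c z) b" using dPS_attained by blast
    have "b = exp_map c a"
    proof (rule ccontr)
      assume "b \<noteq> exp_map c a"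
      then have "2 * \<sigma> \<le> dist b (exp_map c a)" using sep b fa by blast
      also have "\<dots> \<le> dist (exp_map c z) b + dist (exp_map c z) (exp_map c a)"
        by (metis dist_commute dist_triangle)
      also have "dist (exp_map c z) b \<le> dist (exp_map c z) (exp_map c a)"
        using dPS_le[OF fa] b by metis
      finally show False using lt by simp
    qed
    then have d: "dPS (exp_map c z) = cmod (exp_map c a) * cmod (exp \<delta> - 1)" using b eq by simp
    have "4 \<le> cmod (exp_map c a)"
      using exp_map_PS_large[OF a(1)] large exp_ge_add_one_self[of "5000::real"] by linarith
    then have "4 * (t / 2) \<le> cmod (exp_map c a) * cmod (exp \<delta> - 1)"
      using lo t by (intro mult_mono) auto
    then show ?thesis using d lt \<sigma>1 eq by (simp add: t_def)
  qed
  then show ?thesis using \<rho> by (intro exI[of _ \<rho>]) auto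
qed

text \<open>An orbit that comes near \<open>PS\<close> without hitting it is expelled, and its first
  point outside the neighbourhood is within distance 1 of \<open>PS\<close>, so it counts as a
  return. An orbit without further returns therefore stays at distance \<rho> and has modulus above
  \<open>cmod c * exp M\<close>; then its real parts remain at least \<open>M\<close> forever, which
  happens only on a null set.\<close>

lemma negligible_non_returning:
  "\<exists>\<rho>>0. \<exists>R. negligible {z. \<not> ((\<forall>n. (iter c n) z \<notin> PS) \<and>
     infinite {n. dPS ((iter c n) z) \<ge> \<rho> \<and> cmod ((iter c n) z) \<le> R})}"
proof -
  obtain \<rho> where \<rho>: "\<rho> > 0" "\<rho> \<le> 1" "\<And>z. dPS z < \<rho> \<Longrightarrow> 2 * dPS z \<le> dPS (exp_map c z)"
      "\<And>z. dPS z < \<rho> \<Longrightarrow> dPS (exp_map c z) \<le> 1"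
    using singular_orbit_repelling by blast
  obtain B where B: "\<And>a. a \<in> PS \<Longrightarrow> cmod a \<le> B" using finite_imp_bounded[OF finite_PS] bounded_iff by blast
  have B0: "B \<ge> 0" using B[OF zero_in_PS] by simp
  define M where "M = B + 41"
  have M0: "M \<ge> 0" using B0 by (simp add: M_def)
  have M: "Re a + 40 < M" if "a \<in> PS" for a
    using B[OF that] complex_Re_le_cmod[of a] by (simp add: M_def)
  define R where "R = max (B + 1) (cmod c * exp M)"
  let ?E = "{z. \<forall>n. Re ((iter c n) z) \<ge> M}"
  have E: "negligible ?E" by (rule negligible_Re_bounded_below[OF M0 M])
  let ?V = "\<lambda>z. {n. dPS ((iter c n) z) \<ge> \<rho> \<and> cmod ((iter c n) z) \<le> R}"
  have sub: "{z. \<not> ((\<forall>n. (iter c n) z \<notin> PS) \<and> infinite (?V z))} \<subseteq>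
      (\<Union>n. (iter c n) -` PS) \<union> (\<Union>n. (iter c n) -` ?E)"
  proof
    fix z assume "z \<in> {z. \<not> ((\<forall>n. (iter c n) z \<notin> PS) \<and> infinite (?V z))}"
    then have z: "(\<exists>n. (iter c n) z \<in> PS) \<or> finite (?V z)" by blast
    show "z \<in> (\<Union>n. (iter c n) -` PS) \<union> (\<Union>n. (iter c n) -` ?E)"
    proof (cases "\<exists>n. (iter c n) z \<in> PS")
      case False
      then have off: "(iter c n) z \<notin> PS" for n by blast
      have "finite (?V z)" using z False by blast
      then obtain m where m: "\<forall>n\<in>?V z. n < m" unfolding finite_nat_set_iff_bounded ..
      have novisit: "cmod ((iter c n) z) > R" if "n \<ge> m" "dPS ((iter c n) z) \<ge> \<rho>" for n
      proof (rule ccontr)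
        assume "\<not> cmod ((iter c n) z) > R"
        then have "n \<in> ?V z" using that by simp
        then show False using m that(1) by (meson leD)
      qed
      have far: "dPS ((iter c n) z) \<ge> \<rho>" if n: "n \<ge> m" for n
      proof (rule ccontr)
        assume neg: "\<not> dPS ((iter c n) z) \<ge> \<rho>"
        have stay: "dPS ((iter c (n + k)) z) < \<rho> \<and>
            2 ^ k * dPS ((iter c n) z) \<le> dPS ((iter c (n + k)) z)" for k
        proof (induction k)
          case (Suc k)
          let ?y = "(iter c (n + k)) z"
          have y: "(iter c (n + Suc k)) z = exp_map c ?y" by simp
          have le1: "dPS (exp_map c ?y) \<le> 1" using \<rho>(4) Suc by blast
          obtain a where a: "a \<in> PS" "dPS (exp_map c ?y) = dist (exp_map c ?y) a" using dPS_attained by blast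
          have "cmod (exp_map c ?y) \<le> cmod a + dist (exp_map c ?y) a"
            by (metis add.commute dist_norm norm_triangle_sub)
          also have "\<dots> \<le> R" using B[OF a(1)] le1 a(2) by (simp add: R_def)
          finally have "\<not> dPS (exp_map c ?y) \<ge> \<rho>"
            using novisit[of "n + Suc k"] n unfolding y by fastforce
          moreover have "2 * (2 ^ k * dPS ((iter c n) z)) \<le> dPS (exp_map c ?y)"
            using \<rho>(3)[of ?y] Suc by linarith
          ultimately show ?case unfolding y by simp
        qed (use neg in simp)
        obtain k where "1 / dPS ((iter c n) z) < 2 ^ k" using real_arch_pow[of 2] by auto
        then have "1 < 2 ^ k * dPS ((iter c n) z)" using dPS_pos[OF off[of n]] by (simp add: field_simps)
        then show False using stay[of k] \<rho>(2) by linarith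
      qed
      have "Re ((iter c (n + m)) z) \<ge> M" for n
      proof -
        have "R < cmod (exp_map c ((iter c (n + m)) z))"
          using novisit[of "Suc (n + m)"] far[of "Suc (n + m)"] by simp
        then have "cmod c * exp M < cmod c * exp (Re ((iter c (n + m)) z))"
          by (simp add: norm_exp_map R_def)
        then have "exp M < exp (Re ((iter c (n + m)) z))" using c_nonzero by (simp add: mult_less_cancel_left)
        then show ?thesis by simp
      qed
      then have "(iter c m) z \<in> ?E" by (simp add: funpow_add)
      then show ?thesis by blast
    qed blast
  qed
  have "negligible ((\<Union>n. (iter c n) -` PS) \<union> (\<Union>n. (iter c n) -` ?E))"
  proof (intro negligible_Un negligible_countable_Union)
    show "negligible T" if "T \<in> range (\<lambda>n. (iter c n) -` PS)" for T
      using that negligible_iterate_preimage[OF c_nonzero negligible_finite[OF finite_PS]] by blast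
    show "negligible T" if "T \<in> range (\<lambda>n. (iter c n) -` ?E)" for T
      using that negligible_iterate_preimage[OF c_nonzero E] by blast
  qed auto
  then show ?thesis using sub \<rho>(1) negligible_subset by blast
qed

text \<open>If no iterate of the ball hits \<open>z\<close>, the iterates omit the two preimages \<open>z1\<close> and
  \<open>z1 + 2 \<pi> \<i>\<close>, and Schottky's theorem bounds their derivatives along bounded returns.\<close>

lemma iterates_of_ball_cover:
  assumes z: "z \<noteq> 0" and "r > 0"
    and u: "\<And>\<Lambda>. \<exists>m. \<Lambda> \<le> cmod (deriv (iter c m) u) \<and> cmod ((iter c m) u) \<le> R"
  shows "\<exists>k. \<exists>y\<in>ball u r. (iter c k) y = z"
proof (rule ccontr)
  assume "\<not> ?thesis"
  then have no: "(iter c k) y \<noteq> z" if "y \<in> ball u r" for k y using that by blast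
  define z1 where "z1 = Ln (z / c)"
  have z1: "exp_map c z1 = z" "exp_map c (z1 + 2 * of_real pi * \<i>) = z"
    using z c_nonzero by (simp_all add: exp_map_def z1_def exp_add)
  define q where "q = 2 * of_real pi * \<i>"
  have q: "q \<noteq> 0" by (simp add: q_def)
  define r0 where "r0 = (R + cmod z1) / cmod q"
  define C where "C = exp (pi * exp (pi * (2 + 2 * r0 + 12 * (1/2) / (1 - 1/2))))"
  define \<Lambda> where "\<Lambda> = 8 * C * cmod q / r + 1"
  obtain m where m: "\<Lambda> \<le> cmod (deriv (iter c m) u)" "cmod ((iter c m) u) \<le> R" using u by blast
  define F where "F = iter c m"
  \<comment> \<open>This normalization sends the omitted values \<open>z1\<close> and
    \<open>z1 + q\<close> to 0 and 1; the factor \<open>r/2\<close> keeps the closed unit disc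
    inside the ball.\<close>
  define h where "h = (\<lambda>s. (F (u + of_real (r/2) * s) - z1) / q)"
  have arg: "u + of_real (r/2) * s \<in> ball u r" if "cmod s \<le> 1" for s
  proof -
    have "cmod (of_real (r/2) * s) \<le> (r/2) * 1"
      using that \<open>r > 0\<close> by (subst norm_mult) (auto intro!: mult_left_mono)
    then show ?thesis using \<open>r > 0\<close> by (simp add: dist_norm)
  qed
  have holh: "h holomorphic_on S" for S
  proof -
    have "(F \<circ> (\<lambda>s. u + of_real (r/2) * s)) holomorphic_on S"
      unfolding F_def by (rule holomorphic_on_compose_gen[OF _ exp_map_iterate_holomorphic[where S = UNIV]])
        (auto intro!: holomorphic_intros)
    then show ?thesis unfolding h_def comp_def by (intro holomorphic_intros q)
  qed
  have bound: "cmod (h s) \<le> C" if s: "cmod s \<le> 1/2" for s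
    unfolding C_def
  proof (rule Schottky[of h r0 "1/2" s])
    have "cmod (F u - z1) \<le> R + cmod z1" using m(2) norm_triangle_ineq4[of "F u" z1] by (simp add: F_def)
    then show "cmod (h 0) \<le> r0" by (simp add: h_def r0_def norm_divide divide_right_mono)
    show "\<not> (h s = 0 \<or> h s = 1)" if "s \<in> cball 0 1" for s
    proof
      let ?y = "u + of_real (r/2) * s"
      have y: "?y \<in> ball u r" using arg that by simp
      assume "h s = 0 \<or> h s = 1"
      then have "F ?y = z1 \<or> F ?y = z1 + 2 * of_real pi * \<i>"
        using q by (auto simp: h_def q_def field_simps)
      then have "exp_map c (F ?y) = z" using z1 by auto
      then have "(iter c (Suc m)) ?y = z" by (simp add: F_def)
      then show False using no[OF y] by blast
    qed
  qed (use s holh in auto)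
  have "cmod (deriv h 0) \<le> 2 * C / (1/2)"
    by (rule deriv_bound_ball[OF holh, where y = 0]) (use bound in auto)
  moreover have "deriv h 0 = deriv F u * of_real (r/2) / q"
  proof (rule DERIV_imp_deriv)
    have "(F has_field_derivative deriv F u) (at (u + of_real (r/2) * 0))"
      by (simp add: F_def DERIV_deriv_iff_field_differentiable exp_map_iterate_differentiable)
    moreover have "((\<lambda>s. u + of_real (r/2) * s) has_field_derivative of_real (r/2)) (at 0)"
      by (auto intro!: derivative_eq_intros)
    ultimately have "((\<lambda>s. F (u + of_real (r/2) * s)) has_field_derivative deriv F u * of_real (r/2)) (at 0)"
      by (rule DERIV_chain2)
    then have "((\<lambda>s. F (u + of_real (r/2) * s) - z1) has_field_derivative deriv F u * of_real (r/2) - 0) (at 0)"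
      by (intro DERIV_diff DERIV_const)
    then show "(h has_field_derivative deriv F u * of_real (r/2) / q) (at 0)"
      unfolding h_def by (intro DERIV_cdivide) simp
  qed
  ultimately have "cmod (deriv F u) * (r/2) / cmod q \<le> 4 * C"
    using \<open>r > 0\<close> by (simp add: norm_mult norm_divide)
  then have "cmod (deriv F u) \<le> 8 * C * cmod q / r"
    using \<open>r > 0\<close> q by (simp add: field_simps)
  then show False using m(1) by (simp add: \<Lambda>_def F_def)
qed

text \<open>For late returns the images of \<open>A\<close> fill \<open>ball w \<delta>\<close> up
  to small area, where \<open>w\<close> is a limit of returns of a density point \<open>z\<close>.
  Some iterate maps a point of this ball to \<open>z\<close>, so the ball contains a set
  \<open>?G\<close> of positive area that enters \<open>A\<close> after \<open>k\<close> steps. Once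
  the missing area is below that of \<open>?G\<close>, a point of \<open>A\<close> reaches
  \<open>?G\<close> and then \<open>A\<close>.\<close>

lemma compact_returns:
  assumes A: "compact A" "\<not> negligible A"
  shows "\<exists>n\<ge>j. A \<inter> (iter c n) ` A \<noteq> {}"
proof -
  obtain \<rho> R where \<rho>: "\<rho> > 0" and NR: "negligible {z. \<not> ((\<forall>n. (iter c n) z \<notin> PS) \<and>
     infinite {n. dPS ((iter c n) z) \<ge> \<rho> \<and> cmod ((iter c n) z) \<le> R})}" (is "negligible ?B1")
    using negligible_non_returning by blast
  have AL: "A \<in> sets lebesgue" using A by (simp add: compact_imp_closed borel_closed)
  have "\<not> A \<subseteq> {z \<in> A. \<not> density_point A z} \<union> ?B1"
    using A(2) negligible_Un[OF negligible_not_density_point[OF AL] NR] negligible_subset by blast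
  then obtain z where z: "z \<in> A" "density_point A z" "\<And>n. (iter c n) z \<notin> PS"
      "infinite {n. dPS ((iter c n) z) \<ge> \<rho> \<and> cmod ((iter c n) z) \<le> R}" by blast
  define V where "V = {n. dPS ((iter c n) z) \<ge> \<rho> \<and> cmod ((iter c n) z) \<le> R}"
  have infV: "infinite V" using z(4) by (simp add: V_def)
  let ?f = "\<lambda>n. (iter c n) z"
  obtain w r where r: "strict_mono r" "(\<lambda>k. ?f (enumerate V (r k))) \<longlonglongrightarrow> w"
  proof -
    have "\<forall>k. ?f (enumerate V k) \<in> cball 0 R"
      using enumerate_in_set[OF infV] by (simp add: V_def)
    then obtain l r where "strict_mono r" "((\<lambda>k. ?f (enumerate V k)) \<circ> r) \<longlonglongrightarrow> l"
      using seq_compactE[of "cball 0 R" "\<lambda>k. ?f (enumerate V k)"] compact_imp_seq_compact[OF compact_cball]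
      by blast
    then show thesis using that by (simp add: comp_def)
  qed
  have near: "\<exists>n\<ge>N. n \<in> V \<and> dist (?f n) w < \<eta>" if "\<eta> > 0" for \<eta> N
  proof -
    have "eventually (\<lambda>k. dist (?f (enumerate V (r k))) w < \<eta>) sequentially"
      using r(2) that by (rule tendstoD)
    then obtain k0 where k0: "\<And>k. k \<ge> k0 \<Longrightarrow> dist (?f (enumerate V (r k))) w < \<eta>"
      unfolding eventually_sequentially by blast
    let ?k = "max k0 N"
    have "N \<le> enumerate V (r ?k)"
      using le_enumerate[OF infV, of "r ?k"] seq_suble[OF r(1), of ?k] by simp
    moreover have "enumerate V (r ?k) \<in> V" by (rule enumerate_in_set[OF infV])
    ultimately show ?thesis using k0[of ?k] by auto
  qed
  have growth: "\<exists>N. \<forall>n\<ge>N. n \<in> V \<longrightarrow> \<Lambda> \<le> cmod (deriv (iter c n) z)" for \<Lambda>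
  proof -
    have "infinite {n. dPS (?f n) \<ge> \<rho>}"
      using infV by (rule contrapos_nn) (erule finite_subset[rotated], auto simp: V_def)
    from derivative_growth_along_returns[OF z(3) \<rho> this] show ?thesis by (fastforce simp: V_def)
  qed
  \<comment> \<open>A return has a disc of radius \<rho> free of the singular orbit: half of this
    radius serves for the distortion bound, \<open>\<rho> / 8\<close> is filled, and
    \<open>\<rho> / 16\<close> allows for moving the centre to \<open>w\<close>.\<close>
  define \<delta> where "\<delta> = \<rho> / 16"
  have \<delta>: "\<delta> > 0" using \<rho> by (simp add: \<delta>_def)
  have fill: "\<exists>n\<ge>N. n \<in> V \<and> measure lebesgue (ball w \<delta> - (iter c n) ` A) \<le> \<epsilon>" if eps: "\<epsilon> > 0" for \<epsilon> N
  proof -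
    obtain \<Lambda> where \<Lambda>: "\<And>n. \<Lambda> \<le> cmod (deriv (iter c n) z) \<Longrightarrow>
       \<forall>i<n. (iter c i) 0 \<notin> ball (?f n) (4 * (\<rho> / 8)) \<Longrightarrow>
       measure lebesgue (ball (?f n) (\<rho> / 8) - (iter c n) ` A) \<le> \<epsilon>"
      using blowup_density[OF c_nonzero A(1) z(2), of "\<rho> / 8" \<epsilon>] \<rho> eps by (metis divide_pos_pos zero_less_numeral)
    obtain N' where N': "\<And>n. n \<ge> N' \<Longrightarrow> n \<in> V \<Longrightarrow> \<Lambda> \<le> cmod (deriv (iter c n) z)"
      using growth[of \<Lambda>] by blast
    obtain n where n: "n \<ge> max N N'" "n \<in> V" "dist (?f n) w < \<delta>" using near[OF \<delta>] by blast
    have av: "\<forall>i<n. (iter c i) 0 \<notin> ball (?f n) (4 * (\<rho> / 8))"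
    proof (intro allI impI notI)
      fix i assume "(iter c i) 0 \<in> ball (?f n) (4 * (\<rho> / 8))"
      then have "dist (?f n) ((iter c i) 0) < \<rho>" using \<rho> by simp
      moreover have "dPS (?f n) \<le> dist (?f n) ((iter c i) 0)"
        by (intro dPS_le) (simp add: PS_def)
      ultimately show False using n(2) by (simp add: V_def)
    qed
    have le: "measure lebesgue (ball (?f n) (\<rho> / 8) - (iter c n) ` A) \<le> \<epsilon>"
      by (intro \<Lambda> N' av) (use n in simp_all)
    have cl: "closed ((iter c n) ` A)"
      by (intro compact_imp_closed compact_continuous_image exp_map_iterate_continuous A)
    have "ball w \<delta> \<subseteq> ball (?f n) (\<rho> / 8)"
    proof
      fix x assume "x \<in> ball w \<delta>"
      then show "x \<in> ball (?f n) (\<rho> / 8)" using n(3) dist_triangle[of "?f n" x w] by (simp add: \<delta>_def)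
    qed
    then have "measure lebesgue (ball w \<delta> - (iter c n) ` A) \<le> measure lebesgue (ball (?f n) (\<rho> / 8) - (iter c n) ` A)"
      using cl by (intro measure_mono_fmeasurable fmeasurable_Diff) (auto simp: borel_closed borel_open)
    then show ?thesis using le n by (intro exI[of _ n]) auto
  qed
  have "z \<noteq> 0" using z(3)[of 0] zero_in_PS by auto
  obtain n1 where n1: "n1 \<in> V" "dist (?f n1) w < \<delta> / 2" using near[of "\<delta> / 2"] \<delta> by auto
  have comp: "(iter c m) (?f n1) = ?f (m + n1)" for m by (simp add: funpow_add)
  \<comment> \<open>The covering lemma is applied at the orbit point \<open>?f n1\<close> near
    \<open>w\<close>, not at \<open>w\<close>, because growth of the derivative is known along the
    orbit of \<open>z\<close>.\<close>
  have "\<exists>k. \<exists>y\<in>ball (?f n1) (\<delta> / 2). (iter c k) y = z"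
  proof (rule iterates_of_ball_cover[OF \<open>z \<noteq> 0\<close>, where R = R])
    fix \<Lambda>
    have V': "infinite {m. m + n1 \<in> V}"
    proof
      assume "finite {m. m + n1 \<in> V}"
      then have "finite ((\<lambda>m. m + n1) ` {m. m + n1 \<in> V} \<union> {..<n1})" by simp
      moreover have "V \<subseteq> (\<lambda>m. m + n1) ` {m. m + n1 \<in> V} \<union> {..<n1}"
      proof
        fix x assume "x \<in> V"
        then show "x \<in> (\<lambda>m. m + n1) ` {m. m + n1 \<in> V} \<union> {..<n1}"
          by (cases "x < n1") (auto intro!: image_eqI[of _ _ "x - n1"])
      qed
      ultimately show False using infV finite_subset by blast
    qed
    have "infinite {m. dPS ((iter c m) (?f n1)) \<ge> \<rho>}"
      using V' by (rule contrapos_nn) (erule finite_subset[rotated], auto simp: V_def comp)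
    from derivative_growth_along_returns[OF _ \<rho> this, of \<Lambda>]
    obtain N where N: "\<And>m. m \<ge> N \<Longrightarrow> dPS ((iter c m) (?f n1)) \<ge> \<rho> \<Longrightarrow> \<Lambda> \<le> cmod (deriv (iter c m) (?f n1))"
      using z(3) comp by metis
    obtain m where "m > N" "m + n1 \<in> V"
      using V' unfolding infinite_nat_iff_unbounded by blast
    then show "\<exists>m. \<Lambda> \<le> cmod (deriv (iter c m) (?f n1)) \<and> cmod ((iter c m) (?f n1)) \<le> R"
      using N[of m] by (intro exI[of _ m]) (auto simp: V_def comp)
  qed (use \<delta> in simp)
  then obtain k y where ky: "y \<in> ball (?f n1) (\<delta> / 2)" "(iter c k) y = z" by blast
  have y: "y \<in> ball w \<delta>" using ky(1) n1(2) dist_triangle[of w y "?f n1"] by (simp add: dist_commute)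
  let ?G = "ball w \<delta> \<inter> (iter c k) -` A"
  \<comment> \<open>If \<open>?G\<close> were null, so would be its image, which contains the part
    of \<open>A\<close> near \<open>z\<close>, contrary to density.\<close>
  have Gneg: "\<not> negligible ?G"
  proof
    assume G: "negligible ?G"
    have "open ((iter c k) ` ball w \<delta>)"
    proof (rule open_mapping_thm2[where S = UNIV and f = "iter c k"])
      fix X :: "complex set" assume X: "open X" "X \<subseteq> UNIV" "X \<noteq> {}"
      show "\<not> (iter c k) constant_on X"
      proof
        assume "(iter c k) constant_on X"
        then obtain d where d: "\<And>x. x \<in> X \<Longrightarrow> (iter c k) x = d" unfolding constant_on_def by blast
        then have "X \<subseteq> (iter c k) -` {d}" by auto
        then have "negligible X"
          using negligible_iterate_preimage[OF c_nonzero, of "{d}" k] negligible_subset by auto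
        then show False using X open_not_negligible by blast
      qed
    qed (auto intro: exp_map_iterate_holomorphic)
    moreover have "z \<in> (iter c k) ` ball w \<delta>" using ky y by blast
    ultimately obtain e where e: "e > 0" "ball z e \<subseteq> (iter c k) ` ball w \<delta>"
      by (meson openE)
    have "negligible ((iter c k) ` ?G)"
    proof (rule negligible_differentiable_image_negligible[OF _ G])
      show "(iter c k) differentiable_on ?G"
        by (rule holomorphic_on_imp_differentiable_on, rule exp_map_iterate_holomorphic)
    qed simp
    moreover have "A \<inter> ball z e \<subseteq> (iter c k) ` ?G" using e(2) by auto
    ultimately have nAe: "negligible (A \<inter> ball z e)" using negligible_subset by blast
    obtain r0 where r0: "r0 > 0" "\<And>r. 0 < r \<Longrightarrow> r < r0 \<Longrightarrow>
        measure lebesgue (ball z r - A) < 1 * measure lebesgue (ball z r)"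
      using z(2) unfolding density_point_def by (metis zero_less_one)
    define t where "t = min e (r0 / 2)"
    have t: "0 < t" "t < r0" "t \<le> e" using e r0 by (auto simp: t_def)
    have "negligible (A \<inter> ball z t)"
      using t(3) by (intro negligible_subset[OF nAe]) auto
    then have "measure lebesgue ((ball z t - A) \<union> (A \<inter> ball z t)) = measure lebesgue (ball z t - A)"
      using AL by (intro measure_Un_null_set) (auto simp: negligible_iff_null_sets)
    moreover have "(ball z t - A) \<union> (A \<inter> ball z t) = ball z t" by blast
    ultimately show False using r0(2)[OF t(1,2)] by simp
  qed
  have "(iter c k) -` A \<in> sets lebesgue"
    using closed_iterate_vimage[OF compact_imp_closed[OF A(1)]] by (simp add: borel_closed)
  then have Glm: "?G \<in> lmeasurable" by (intro fmeasurable_Int_fmeasurable) auto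
  define q where "q = measure lebesgue ?G"
  have q: "q > 0" using Gneg negligible_iff_measure0[OF Glm] measure_nonneg[of lebesgue ?G]
    unfolding q_def by linarith
  obtain n where n: "n \<ge> j" "measure lebesgue (ball w \<delta> - (iter c n) ` A) \<le> q / 2"
    using fill[of "q / 2" j] q by auto
  have "\<not> ?G \<subseteq> ball w \<delta> - (iter c n) ` A"
  proof
    assume sub: "?G \<subseteq> ball w \<delta> - (iter c n) ` A"
    have cl: "closed ((iter c n) ` A)"
      by (intro compact_imp_closed compact_continuous_image exp_map_iterate_continuous A)
    have "q \<le> measure lebesgue (ball w \<delta> - (iter c n) ` A)"
      unfolding q_def using sub Glm cl
      by (intro measure_mono_fmeasurable fmeasurable_Diff) (auto simp: borel_closed borel_open dest: fmeasurableD)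
    then show False using n q by simp
  qed
  then obtain x where x: "x \<in> ?G" "x \<in> (iter c n) ` A" by blast
  then obtain a where "a \<in> A" "x = (iter c n) a" by blast
  then have "(iter c (k + n)) a \<in> A" using x by (simp add: funpow_add)
  then have "A \<inter> (iter c (k + n)) ` A \<noteq> {}" using \<open>a \<in> A\<close> by blast
  then show ?thesis using n(1) by (intro exI[of _ "k + n"]) auto
qed

text \<open>If the points of \<open>A\<close> without returns after time \<open>j\<close> were not
  null, they would contain a non-null compact set, and \<open>compact_returns\<close> would bring a
  point of it back after time \<open>j\<close>.\<close>

lemma negligible_finitely_many_returns:
  assumes A: "compact A"
  shows "negligible {x \<in> A. finite {n. (iter c n) x \<in> A}}"
proof -
  define B where "B = (\<lambda>j. {x \<in> A. \<forall>n\<ge>j. (iter c n) x \<notin> A})"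
  have "negligible (B j)" for j
  proof (rule ccontr)
    assume neg: "\<not> negligible (B j)"
    have cl: "closed ((iter c n) -` A)" for n
      using A by (intro closed_iterate_vimage compact_imp_closed)
    have "B j = A - (\<Union>n\<in>{j..}. (iter c n) -` A)" by (auto simp: B_def)
    moreover have "\<dots> \<in> sets lebesgue"
      using cl A by (intro sets.Diff sets.countable_UN'') (auto simp: borel_closed compact_imp_closed)
    ultimately have "B j \<in> sets lebesgue" by simp
    then obtain K where K: "compact K" "K \<subseteq> B j" "\<not> negligible K"
      using nonnegligible_compact_subset neg by blast
    obtain n where "n \<ge> j" "K \<inter> (iter c n) ` K \<noteq> {}" using compact_returns[OF K(1,3)] by blast
    then show False using K(2) by (auto simp: B_def)
  qed
  then have "negligible (\<Union>j. B j)" by (intro negligible_countable_Union) auto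
  moreover have "{x \<in> A. finite {n. (iter c n) x \<in> A}} \<subseteq> (\<Union>j. B j)"
  proof
    fix x assume x: "x \<in> {x \<in> A. finite {n. (iter c n) x \<in> A}}"
    then have "finite {n. (iter c n) x \<in> A}" by simp
    then obtain j where "\<forall>n\<in>{n. (iter c n) x \<in> A}. n < j" unfolding finite_nat_set_iff_bounded ..
    then have "x \<in> B j" using x by (auto simp: B_def)
    then show "x \<in> (\<Union>j. B j)" by blast
  qed
  ultimately show ?thesis by (rule negligible_subset)
qed

end

section \<open>Dilations and total variation\<close>

lemma emeasure_lborel_scale_le:
  fixes a :: complex
  assumes "a \<noteq> 0" "S \<in> sets borel"
  shows "emeasure lborel ((*) a -` S) \<le> ennreal (1 / (cmod a)\<^sup>2) * emeasure lborel S"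
proof -
  have meas: "(*) a -` S \<in> sets borel"
  proof -
    have "(*) a \<in> borel_measurable borel" by measurable
    from measurable_sets[OF this assms(2)] show ?thesis by simp
  qed
  have le: "emeasure lborel ((*) a -` S) \<le> ennreal (1 / (cmod a)\<^sup>2) * (emeasure lborel S + ennreal e)" if "e > 0" for e
  proof -
    have "\<exists>T\<in>sets lebesgue. (\<lambda>z. z / a) ` S \<subseteq> T \<and>
       emeasure lebesgue T \<le> ennreal ((1 / cmod a)\<^sup>2) * (emeasure lebesgue S + ennreal e)"
    proof (rule holomorphic_image_measure_le[where X = UNIV])
      show "(\<lambda>z. z / a) holomorphic_on UNIV" by (intro holomorphic_intros assms)
      show "cmod (deriv (\<lambda>z. z / a) z) \<le> 1 / cmod a" for z
      proof -
        have "((\<lambda>z. z / a) has_field_derivative 1 / a) (at z)"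
          using assms by (auto intro!: derivative_eq_intros)
        then show ?thesis by (simp add: DERIV_imp_deriv norm_divide)
      qed
    qed (use assms that in auto)
    then obtain T where T: "T \<in> sets lebesgue" "(\<lambda>z. z / a) ` S \<subseteq> T"
       "emeasure lebesgue T \<le> ennreal ((1 / cmod a)\<^sup>2) * (emeasure lebesgue S + ennreal e)" by blast
    have "(*) a -` S \<subseteq> T"
    proof
      fix x assume "x \<in> (*) a -` S"
      then have "a * x \<in> S" "x = (a * x) / a" using assms(1) by auto
      then show "x \<in> T" using T(2) by blast
    qed
    then have "emeasure lebesgue ((*) a -` S) \<le> emeasure lebesgue T" using T(1) by (rule emeasure_mono)
    then show ?thesis using T(3) meas assms(2) by (simp add: power_divide)
  qed
  show ?thesis
  proof (cases "emeasure lborel S = top")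
    case True
    then show ?thesis using assms(1) by (simp add: ennreal_mult_top)
  next
    case False
    show ?thesis
    proof (rule ennreal_le_epsilon)
      fix e :: real assume e: "0 < e"
      have "emeasure lborel ((*) a -` S) \<le> ennreal (1 / (cmod a)\<^sup>2) * (emeasure lborel S + ennreal (e * (cmod a)\<^sup>2))"
        using le e assms(1) by simp
      also have "\<dots> = ennreal (1 / (cmod a)\<^sup>2) * emeasure lborel S + ennreal (1 / (cmod a)\<^sup>2) * ennreal (e * (cmod a)\<^sup>2)"
        by (rule distrib_left)
      also have "ennreal (1 / (cmod a)\<^sup>2) * ennreal (e * (cmod a)\<^sup>2) = ennreal e"
        using e assms(1) by (simp flip: ennreal_mult)
      finally show "emeasure lborel ((*) a -` S) \<le> ennreal (1 / (cmod a)\<^sup>2) * emeasure lborel S + ennreal e" .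
    qed
  qed
qed

lemma borel_scale_vimage [measurable, simp]: "S \<in> sets borel \<Longrightarrow> (*) (a::complex) -` S \<in> sets borel"
proof -
  assume S: "S \<in> sets borel"
  have "(*) a \<in> borel_measurable borel" by measurable
  from measurable_sets[OF this S] show ?thesis by simp
qed

lemma compact_scale_nhd:
  fixes K U :: "complex set"
  assumes "compact K" "open U" "K \<subseteq> U"
  shows "\<exists>\<delta>>0. \<forall>a. cmod (a - 1) < \<delta> \<longrightarrow> (*) a ` K \<subseteq> U"
proof -
  obtain e where e: "e > 0" "\<And>x. x \<in> K \<Longrightarrow> ball x e \<subseteq> U"
    using compact_subset_open_imp_ball_epsilon_subset[OF assms] by (metis SUP_le_iff)
  obtain b where b: "b > 0" "\<And>x. x \<in> K \<Longrightarrow> cmod x \<le> b"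
    using compact_imp_bounded[OF assms(1)] bounded_pos by metis
  have "a * x \<in> U" if "cmod (a - 1) < e / b" "x \<in> K" for a x
  proof -
    have "cmod (a * x - x) = cmod (a - 1) * cmod x" by (simp add: algebra_simps flip: norm_mult)
    also have "\<dots> \<le> cmod (a - 1) * b" using b that by (intro mult_left_mono) auto
    also have "\<dots> < e" using that b by (simp add: field_simps)
    finally have "a * x \<in> ball x e" by (simp add: dist_norm norm_minus_commute)
    then show ?thesis using e that by blast
  qed
  then show ?thesis using e b by (intro exI[of _ "e / b"]) auto
qed

text \<open>\<open>B\<close> lies, up to small measure, between a compact \<open>L n\<close> and an
  open \<open>U\<close>. A small dilation maps \<open>L n\<close> into \<open>U\<close>, so a point
  of \<open>B\<close> whose dilate leaves \<open>B\<close> lies in \<open>B - L n\<close> or has its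
  dilate in \<open>U - B\<close>; pulling back the latter costs a factor of at most 4.\<close>

lemma lborel_scale_diff:
  fixes B :: "complex set"
  assumes B: "B \<in> sets borel" "emeasure lborel B < \<infinity>" and "\<epsilon> > 0"
  shows "\<exists>\<delta>>0. \<forall>a. cmod (a - 1) < \<delta> \<longrightarrow> measure lborel ((*) a -` (- B) \<inter> B) \<le> \<epsilon>"
proof -
  have BL: "B \<in> sets lebesgue" using B by simp
  obtain U where U: "open U" "B \<subseteq> U" "U - B \<in> lmeasurable" "emeasure lebesgue (U - B) < ennreal (\<epsilon> / 8)"
    using sets_lebesgue_outer_open[OF BL, of "\<epsilon> / 8"] \<open>\<epsilon> > 0\<close> by (metis divide_pos_pos zero_less_numeral)
  obtain N K where NK: "negligible N" "\<And>n::nat. compact (K n)" "B = (\<Union>n. K n) \<union> N"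
    using lebesgue_regular_inner[OF BL] by metis
  define L where "L = (\<lambda>n. \<Union>i\<le>n. K i)"
  have L: "compact (L n)" for n unfolding L_def using NK by (intro compact_UN) auto
  have LB: "L n \<in> sets borel" for n using L by (simp add: borel_compact)
  have "(\<lambda>n. emeasure lborel (B - L n)) \<longlonglongrightarrow> emeasure lborel (\<Inter>n. B - L n)"
  proof (rule Lim_emeasure_decseq)
    show "range (\<lambda>n. B - L n) \<subseteq> sets lborel" using LB B by auto
    show "decseq (\<lambda>n. B - L n)" by (force simp: decseq_def L_def)
    show "emeasure lborel (B - L n) \<noteq> \<infinity>" for n
    proof -
      have "emeasure lborel (B - L n) \<le> emeasure lborel B" using B by (intro emeasure_mono) auto
      then show ?thesis using B(2) by (auto simp: top_unique)
    qed
  qed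
  moreover have "emeasure lborel (\<Inter>n. B - L n) = 0"
  proof -
    have "(\<Inter>n. B - L n) \<subseteq> N" using NK(3) by (auto simp: L_def)
    then have "negligible (\<Inter>n. B - L n)" using NK(1) negligible_subset by blast
    moreover have "(\<Inter>n. B - L n) \<in> sets borel" using LB B by (intro sets.countable_INT) auto
    ultimately show ?thesis using negligible_iff_emeasure0[of "\<Inter>n. B - L n"] by simp
  qed
  ultimately have "(\<lambda>n. emeasure lborel (B - L n)) \<longlonglongrightarrow> 0" by simp
  then have "eventually (\<lambda>n. emeasure lborel (B - L n) < ennreal (\<epsilon> / 8)) sequentially"
    using \<open>\<epsilon> > 0\<close> by (intro order_tendstoD(2)) auto
  then obtain n where n: "emeasure lborel (B - L n) < ennreal (\<epsilon> / 8)"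
    by (meson eventually_sequentially order_refl)
  have LU: "L n \<subseteq> U" using NK(3) U(2) by (auto simp: L_def)
  obtain \<delta> where \<delta>: "\<delta> > 0" "\<And>a. cmod (a - 1) < \<delta> \<Longrightarrow> (*) a ` L n \<subseteq> U"
    using compact_scale_nhd[OF L U(1) LU] by blast
  have "measure lborel ((*) a -` (- B) \<inter> B) \<le> \<epsilon>" if a: "cmod (a - 1) < min \<delta> (1/2)" for a
  proof -
    have a2: "cmod a \<ge> 1/2" using a norm_triangle_ineq2[of 1 "1 - a"] by (simp add: norm_minus_commute)
    then have a0: "a \<noteq> 0" by auto
    have UB: "U - B \<in> sets borel" using U(1) B by auto
    have sub: "(*) a -` (- B) \<inter> B \<subseteq> (B - L n) \<union> (*) a -` (U - B)"
      using \<delta>(2)[of a] a by auto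
    have "emeasure lborel ((*) a -` (U - B)) \<le> ennreal (1 / (cmod a)\<^sup>2) * emeasure lborel (U - B)"
      by (rule emeasure_lborel_scale_le[OF a0 UB])
    also have "\<dots> \<le> ennreal 4 * ennreal (\<epsilon> / 8)"
    proof (intro mult_mono)
      have "(1/2)\<^sup>2 \<le> (cmod a)\<^sup>2" using a2 by (intro power_mono) auto
      then have "1 / (cmod a)\<^sup>2 \<le> 4" using a0 by (simp add: field_simps power2_eq_square)
      then show "ennreal (1 / (cmod a)\<^sup>2) \<le> ennreal 4" by (rule ennreal_leI)
      show "emeasure lborel (U - B) \<le> ennreal (\<epsilon> / 8)" using U(4) UB by simp
    qed auto
    also have "\<dots> = ennreal (4 * (\<epsilon> / 8))"
      using \<open>\<epsilon> > 0\<close> by (intro ennreal_mult[symmetric]) auto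
    also have "4 * (\<epsilon> / 8) = \<epsilon> / 2" by simp
    finally have 1: "emeasure lborel ((*) a -` (U - B)) \<le> ennreal (\<epsilon> / 2)" .
    have "emeasure lborel ((*) a -` (- B) \<inter> B) \<le> emeasure lborel ((B - L n) \<union> (*) a -` (U - B))"
      using sub LB B UB by (intro emeasure_mono) auto
    also have "\<dots> \<le> emeasure lborel (B - L n) + emeasure lborel ((*) a -` (U - B))"
      using LB B UB by (intro emeasure_subadditive) auto
    also have "\<dots> \<le> ennreal (\<epsilon> / 8) + ennreal (\<epsilon> / 2)" using n 1 by (intro add_mono) auto
    also have "\<dots> = ennreal (\<epsilon> / 8 + \<epsilon> / 2)" using \<open>\<epsilon> > 0\<close> by (simp flip: ennreal_plus)
    also have "\<dots> \<le> ennreal \<epsilon>" using \<open>\<epsilon> > 0\<close> by (intro ennreal_leI) simp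
    finally show ?thesis using \<open>\<epsilon> > 0\<close> enn2real_mono[of _ "ennreal \<epsilon>"] by (fastforce simp: measure_def)
  qed
  then show ?thesis using \<delta>(1) by (intro exI[of _ "min \<delta> (1/2)"]) auto
qed

abbreviation scale_diff :: "complex \<Rightarrow> complex set \<Rightarrow> complex \<Rightarrow> real" where
  "scale_diff a A x \<equiv> indicator A (a * x) - indicator A x"

lemma integrable_times_scale_diff:
  assumes "integrable lborel h" "A \<in> sets borel"
  shows "integrable lborel (\<lambda>x. h x * scale_diff a A x)"
proof (rule Bochner_Integration.integrable_bound[OF assms(1)])
  show "(\<lambda>x. h x * scale_diff a A x) \<in> borel_measurable lborel"
    using assms by measurable
qed (auto simp: indicator_def abs_mult)

text \<open>The radius \<delta> must not depend on \<open>A\<close>. A point of \<open>B\<close>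
  with dilate in \<open>A\<close> either has its dilate in \<open>B \<inter> A\<close>, where only
  the Jacobian matters, or outside \<open>B\<close>, which is controlled by \<open>B\<close>
  alone.\<close>

lemma scale_diff_indicator_upper:
  fixes B :: "complex set"
  assumes B: "B \<in> sets borel" "emeasure lborel B < \<infinity>" and "\<epsilon> > 0"
  shows "\<exists>\<delta>>0. \<forall>a. cmod (a - 1) < \<delta> \<longrightarrow> (\<forall>A\<in>sets borel.
     measure lborel (B \<inter> (*) a -` A) \<le> measure lborel (B \<inter> A) + \<epsilon>)"
proof -
  define b where "b = measure lborel B"
  have b: "b \<ge> 0" by (simp add: b_def)
  obtain \<delta> where \<delta>: "\<delta> > 0" "\<And>a. cmod (a - 1) < \<delta> \<Longrightarrow> measure lborel ((*) a -` (- B) \<inter> B) \<le> \<epsilon> / 2"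
    using lborel_scale_diff[OF B, of "\<epsilon> / 2"] \<open>\<epsilon> > 0\<close> by auto
  have "((\<lambda>a::complex. 1 / (cmod a)\<^sup>2 * b) \<longlongrightarrow> 1 / (cmod 1)\<^sup>2 * b) (nhds 1)"
    by (intro tendsto_intros filterlim_ident) auto
  then have "eventually (\<lambda>a::complex. 1 / (cmod a)\<^sup>2 * b < b + \<epsilon> / 2) (nhds 1)"
    using \<open>\<epsilon> > 0\<close> by (intro order_tendstoD(2)[of _ b]) auto
  then obtain d where d: "d > 0" "\<And>a. dist a 1 < d \<Longrightarrow> 1 / (cmod a)\<^sup>2 * b < b + \<epsilon> / 2"
    unfolding eventually_nhds_metric by blast
  show ?thesis
  proof (intro exI[of _ "min (min \<delta> d) 1"] conjI allI impI ballI)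
    fix a :: complex and A :: "complex set"
    assume a: "cmod (a - 1) < min (min \<delta> d) 1" and A: "A \<in> sets borel"
    have a0: "a \<noteq> 0" using a by auto
    have fin: "emeasure lborel (B \<inter> X) < \<infinity>" if "X \<in> sets borel" for X
      using emeasure_mono[of "B \<inter> X" B lborel] B by (auto simp: le_less_trans)
    have fin': "B \<inter> X \<in> fmeasurable lborel" if "X \<in> sets borel" for X
      using fin[OF that] that B by (intro fmeasurableI) auto
    define Y where "Y = B \<inter> A"
    have Y: "Y \<in> sets borel" "emeasure lborel Y < \<infinity>" "Y \<in> fmeasurable lborel"
      using B A fin[of A] fin'[of A] by (auto simp: Y_def)
    have "B \<inter> (*) a -` A \<subseteq> (B \<inter> (*) a -` Y) \<union> (B \<inter> (*) a -` (- B))" by (auto simp: Y_def)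
    moreover have meas: "B \<inter> (*) a -` Y \<in> fmeasurable lborel" "B \<inter> (*) a -` (- B) \<in> fmeasurable lborel"
      using fin' Y B by auto
    ultimately have "measure lborel (B \<inter> (*) a -` A) \<le> measure lborel ((B \<inter> (*) a -` Y) \<union> (B \<inter> (*) a -` (- B)))"
      using A B by (intro measure_mono_fmeasurable) auto
    also have "\<dots> \<le> measure lborel (B \<inter> (*) a -` Y) + measure lborel (B \<inter> (*) a -` (- B))"
      using meas by (intro measure_Un_le) auto
    also have "measure lborel (B \<inter> (*) a -` (- B)) \<le> \<epsilon> / 2"
      using \<delta>(2)[of a] a by (simp add: Int_commute)
    also have "measure lborel (B \<inter> (*) a -` Y) \<le> 1 / (cmod a)\<^sup>2 * measure lborel Y"
    proof -
      have "emeasure lborel (B \<inter> (*) a -` Y) \<le> emeasure lborel ((*) a -` Y)"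
        using Y B by (intro emeasure_mono) auto
      also have "\<dots> \<le> ennreal (1 / (cmod a)\<^sup>2) * emeasure lborel Y"
        by (rule emeasure_lborel_scale_le[OF a0 Y(1)])
      also have "\<dots> = ennreal (1 / (cmod a)\<^sup>2 * measure lborel Y)"
        using Y(3) by (simp add: emeasure_eq_measure2 flip: ennreal_mult)
      finally have "enn2real (emeasure lborel (B \<inter> (*) a -` Y)) \<le> enn2real (ennreal (1 / (cmod a)\<^sup>2 * measure lborel Y))"
        by (rule enn2real_mono) simp
      then show ?thesis by (simp add: measure_def)
    qed
    also have "1 / (cmod a)\<^sup>2 * measure lborel Y \<le> measure lborel Y + \<epsilon> / 2"
    proof -
      have Yb: "measure lborel Y \<le> b" unfolding b_def
        using Y B by (intro measure_mono_fmeasurable) (auto simp: Y_def fmeasurable_def)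
      have t: "1 / (cmod a)\<^sup>2 * b < b + \<epsilon> / 2" using d(2)[of a] a by (simp add: dist_norm)
      show ?thesis
      proof (cases "1 / (cmod a)\<^sup>2 \<le> 1")
        case True
        then have "1 / (cmod a)\<^sup>2 * measure lborel Y \<le> 1 * measure lborel Y" by (intro mult_right_mono) auto
        then show ?thesis using \<open>\<epsilon> > 0\<close> by simp
      next
        case False
        then have "(1 / (cmod a)\<^sup>2 - 1) * measure lborel Y \<le> (1 / (cmod a)\<^sup>2 - 1) * b"
          using Yb by (intro mult_left_mono) auto
        then show ?thesis using t by (simp add: algebra_simps)
      qed
    qed
    finally show "measure lborel (B \<inter> (*) a -` A) \<le> measure lborel (B \<inter> A) + \<epsilon>" by (simp add: Y_def)
  qed (use \<delta> d in auto)
qed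

text \<open>The lower bound is the upper bound for the complement of \<open>A\<close>.\<close>

lemma scale_diff_indicator:
  fixes B :: "complex set"
  assumes B: "B \<in> sets borel" "emeasure lborel B < \<infinity>" and "\<epsilon> > 0"
  shows "\<exists>\<delta>>0. \<forall>a. cmod (a - 1) < \<delta> \<longrightarrow> (\<forall>A\<in>sets borel.
     \<bar>measure lborel (B \<inter> (*) a -` A) - measure lborel (B \<inter> A)\<bar> \<le> \<epsilon>)"
proof -
  obtain \<delta> where \<delta>: "\<delta> > 0" "\<And>a A. cmod (a - 1) < \<delta> \<Longrightarrow> A \<in> sets borel \<Longrightarrow>
     measure lborel (B \<inter> (*) a -` A) \<le> measure lborel (B \<inter> A) + \<epsilon>"
    using scale_diff_indicator_upper[OF assms] by blast
  have split: "measure lborel (B \<inter> - X) = measure lborel B - measure lborel (B \<inter> X)" if "X \<in> sets borel" for X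
  proof -
    have "B \<inter> - X = B - B \<inter> X" by blast
    moreover have "measure lborel (B - B \<inter> X) = measure lborel B - measure lborel (B \<inter> X)"
      using that B by (intro measure_Diff) auto
    ultimately show ?thesis by simp
  qed
  have "\<bar>measure lborel (B \<inter> (*) a -` A) - measure lborel (B \<inter> A)\<bar> \<le> \<epsilon>"
    if a: "cmod (a - 1) < \<delta>" and A: "A \<in> sets borel" for a A
  proof -
    have cA: "- A \<in> sets borel" using A by auto
    have "measure lborel (B \<inter> - ((*) a -` A)) \<le> measure lborel (B \<inter> - A) + \<epsilon>"
      using \<delta>(2)[OF a cA] by (simp add: vimage_Compl)
    then show ?thesis using \<delta>(2)[OF a A] A by (simp add: split abs_le_iff)
  qed
  then show ?thesis using \<delta>(1) by blast
qed

text \<open>Continuity of dilations in \<open>L\<^sup>1\<close>, stated as continuity in total variation of the dilated measure.\<close>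

lemma integral_scale_diff_small:
  fixes h :: "complex \<Rightarrow> real"
  assumes "integrable lborel h"
  shows "\<forall>\<epsilon>>0. \<exists>\<delta>>0. \<forall>a. cmod (a - 1) < \<delta> \<longrightarrow> (\<forall>A\<in>sets borel.
     \<bar>\<integral>x. h x * scale_diff a A x \<partial>lborel\<bar> \<le> \<epsilon>)"
  using assms
proof (induct rule: integrable_induct)
  case (base B c)
  show ?case
  proof (intro allI impI)
    fix \<epsilon> :: real assume "\<epsilon> > 0"
    have B: "B \<in> sets borel" "emeasure lborel B < \<infinity>" using base by auto
    define \<epsilon>' where "\<epsilon>' = \<epsilon> / (\<bar>c\<bar> + 1)"
    have "\<epsilon>' > 0" using \<open>\<epsilon> > 0\<close> by (simp add: \<epsilon>'_def add_nonneg_pos)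
    then obtain \<delta> where \<delta>: "\<delta> > 0" "\<And>a A. cmod (a - 1) < \<delta> \<Longrightarrow> A \<in> sets borel \<Longrightarrow>
       \<bar>measure lborel (B \<inter> (*) a -` A) - measure lborel (B \<inter> A)\<bar> \<le> \<epsilon>'"
      using scale_diff_indicator[OF B] by blast
    have "\<bar>\<integral>x. (indicator B x *\<^sub>R c) * scale_diff a A x \<partial>lborel\<bar> \<le> \<epsilon>"
      if a: "cmod (a - 1) < \<delta>" and A: "A \<in> sets borel" for a A
    proof -
      have fin: "emeasure lborel (B \<inter> X) < \<infinity>" if "X \<in> sets borel" for X
        using emeasure_mono[of "B \<inter> X" B lborel] B by (auto simp: le_less_trans)
      have "(\<integral>x. (indicator B x *\<^sub>R c) * scale_diff a A x \<partial>lborel) =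
          (\<integral>x. c * (indicator (B \<inter> (*) a -` A) x - indicator (B \<inter> A) x) \<partial>lborel)"
        by (intro Bochner_Integration.integral_cong) (auto simp: indicator_def)
      also have "\<dots> = c * (\<integral>x. indicator (B \<inter> (*) a -` A) x - indicator (B \<inter> A) x \<partial>lborel)"
        by (rule integral_mult_right_zero)
      also have "(\<integral>x. indicator (B \<inter> (*) a -` A) x - indicator (B \<inter> A) x \<partial>lborel) =
          measure lborel (B \<inter> (*) a -` A) - measure lborel (B \<inter> A)"
        using A B fin[of A] fin[of "(*) a -` A"]
        by (subst Bochner_Integration.integral_diff) (auto simp: integrable_indicator_iff)
      finally have "\<bar>\<integral>x. (indicator B x *\<^sub>R c) * scale_diff a A x \<partial>lborel\<bar> =
          \<bar>c\<bar> * \<bar>measure lborel (B \<inter> (*) a -` A) - measure lborel (B \<inter> A)\<bar>"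
        by (simp add: abs_mult)
      also have "\<dots> \<le> (\<bar>c\<bar> + 1) * \<epsilon>'" using \<delta>(2)[OF a A] by (intro mult_mono) auto
      also have "\<dots> = \<epsilon>" by (simp add: \<epsilon>'_def)
      finally show ?thesis .
    qed
    then show "\<exists>\<delta>>0. \<forall>a. cmod (a - 1) < \<delta> \<longrightarrow> (\<forall>A\<in>sets borel.
       \<bar>\<integral>x. (indicator B x *\<^sub>R c) * scale_diff a A x \<partial>lborel\<bar> \<le> \<epsilon>)"
      using \<delta>(1) by blast
  qed
next
  case (add f g)
  show ?case
  proof (intro allI impI)
    fix \<epsilon> :: real assume "\<epsilon> > 0"
    then have e2: "\<epsilon> / 2 > 0" by simp
    obtain \<delta>1 where \<delta>1: "\<delta>1 > 0" "\<And>a A. cmod (a - 1) < \<delta>1 \<Longrightarrow> A \<in> sets borel \<Longrightarrow>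
       \<bar>\<integral>x. f x * scale_diff a A x \<partial>lborel\<bar> \<le> \<epsilon> / 2" using add(2)[rule_format, OF e2] by blast
    obtain \<delta>2 where \<delta>2: "\<delta>2 > 0" "\<And>a A. cmod (a - 1) < \<delta>2 \<Longrightarrow> A \<in> sets borel \<Longrightarrow>
       \<bar>\<integral>x. g x * scale_diff a A x \<partial>lborel\<bar> \<le> \<epsilon> / 2" using add(4)[rule_format, OF e2] by blast
    have "\<bar>\<integral>x. (f x + g x) * scale_diff a A x \<partial>lborel\<bar> \<le> \<epsilon>"
      if a: "cmod (a - 1) < min \<delta>1 \<delta>2" and A: "A \<in> sets borel" for a A
    proof -
      have "(\<integral>x. (f x + g x) * scale_diff a A x \<partial>lborel) =
          (\<integral>x. f x * scale_diff a A x \<partial>lborel) + (\<integral>x. g x * scale_diff a A x \<partial>lborel)"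
        unfolding distrib_right
        by (intro Bochner_Integration.integral_add integrable_times_scale_diff add A)
      then show ?thesis using \<delta>1(2)[of a A] \<delta>2(2)[of a A] a A by auto
    qed
    then show "\<exists>\<delta>>0. \<forall>a. cmod (a - 1) < \<delta> \<longrightarrow> (\<forall>A\<in>sets borel.
       \<bar>\<integral>x. (f x + g x) * scale_diff a A x \<partial>lborel\<bar> \<le> \<epsilon>)"
      using \<delta>1(1) \<delta>2(1) by (intro exI[of _ "min \<delta>1 \<delta>2"]) auto
  qed
next
  case (lim f s)
  show ?case
  proof (intro allI impI)
    fix \<epsilon> :: real assume "\<epsilon> > 0"
    have "(\<lambda>i. \<integral>x. \<bar>f x - s i x\<bar> \<partial>lborel) \<longlonglongrightarrow> (\<integral>x. 0 \<partial>(lborel :: complex measure))"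
    proof (rule integral_dominated_convergence)
      show "integrable lborel (\<lambda>x. 3 * \<bar>f x\<bar>)" using lim by auto
      show "(\<lambda>x. \<bar>f x - s i x\<bar>) \<in> borel_measurable lborel" for i
        using lim by (intro borel_measurable_abs borel_measurable_diff) (auto dest: borel_measurable_integrable)
      have "(\<lambda>i. \<bar>f x - s i x\<bar>) \<longlonglongrightarrow> 0" for x
      proof -
        have "(\<lambda>i. \<bar>f x - s i x\<bar>) \<longlonglongrightarrow> \<bar>f x - f x\<bar>" using lim(3)[of x] by (intro tendsto_intros) auto
        then show ?thesis by simp
      qed
      then show "AE x in lborel. (\<lambda>i. \<bar>f x - s i x\<bar>) \<longlonglongrightarrow> 0" by simp
      have "norm \<bar>f x - s i x\<bar> \<le> 3 * \<bar>f x\<bar>" for i x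
        using lim(4)[of x i] by (auto simp: abs_le_iff)
      then show "AE x in lborel. norm \<bar>f x - s i x\<bar> \<le> 3 * \<bar>f x\<bar>" for i by simp
    qed simp
    then have "eventually (\<lambda>i. (\<integral>x. \<bar>f x - s i x\<bar> \<partial>lborel) < \<epsilon> / 2) sequentially"
      using \<open>\<epsilon> > 0\<close> by (intro order_tendstoD(2)) auto
    then obtain i where i: "(\<integral>x. \<bar>f x - s i x\<bar> \<partial>lborel) < \<epsilon> / 2"
      by (meson eventually_sequentially order_refl)
    have e2: "\<epsilon> / 2 > 0" using \<open>\<epsilon> > 0\<close> by simp
    obtain \<delta> where \<delta>: "\<delta> > 0" "\<And>a A. cmod (a - 1) < \<delta> \<Longrightarrow> A \<in> sets borel \<Longrightarrow>
       \<bar>\<integral>x. s i x * scale_diff a A x \<partial>lborel\<bar> \<le> \<epsilon> / 2" using lim(2)[rule_format, OF e2, of i] by blast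
    have "\<bar>\<integral>x. f x * scale_diff a A x \<partial>lborel\<bar> \<le> \<epsilon>"
      if a: "cmod (a - 1) < \<delta>" and A: "A \<in> sets borel" for a A
    proof -
      have int: "integrable lborel (\<lambda>x. f x - s i x)" using lim by (intro Bochner_Integration.integrable_diff) auto
      have "(\<integral>x. f x * scale_diff a A x \<partial>lborel) =
          (\<integral>x. (f x - s i x) * scale_diff a A x + s i x * scale_diff a A x \<partial>lborel)"
        by (intro Bochner_Integration.integral_cong) (auto simp: algebra_simps)
      also have "\<dots> = (\<integral>x. (f x - s i x) * scale_diff a A x \<partial>lborel) + (\<integral>x. s i x * scale_diff a A x \<partial>lborel)"
        by (intro Bochner_Integration.integral_add integrable_times_scale_diff int lim A)
      finally have eq: "(\<integral>x. f x * scale_diff a A x \<partial>lborel) = \<dots>" .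
      have "\<bar>\<integral>x. (f x - s i x) * scale_diff a A x \<partial>lborel\<bar> \<le> (\<integral>x. \<bar>f x - s i x\<bar> \<partial>lborel)"
      proof -
        have "norm (\<integral>x. (f x - s i x) * scale_diff a A x \<partial>lborel) \<le>
            (\<integral>x. norm ((f x - s i x) * scale_diff a A x) \<partial>lborel)" by (rule integral_norm_bound)
        also have "\<dots> \<le> (\<integral>x. \<bar>f x - s i x\<bar> \<partial>lborel)"
          using int integrable_times_scale_diff[OF int A]
          by (intro integral_mono) (auto simp: indicator_def)
        finally show ?thesis by simp
      qed
      then show ?thesis using eq i \<delta>(2)[OF a A] by linarith
    qed
    then show "\<exists>\<delta>>0. \<forall>a. cmod (a - 1) < \<delta> \<longrightarrow> (\<forall>A\<in>sets borel.
       \<bar>\<integral>x. f x * scale_diff a A x \<partial>lborel\<bar> \<le> \<epsilon>)" using \<delta>(1) by blast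
  qed
qed

section \<open>Perturbation of postsingularly finite parameters\<close>

lemma singular_orbit_holomorphic:
  assumes "\<gamma> holomorphic_on S"
  shows "(\<lambda>s. singular_orbit (\<gamma> s) n) holomorphic_on S"
proof (induction n)
  case (Suc n)
  have "(\<lambda>s. \<gamma> s * exp (singular_orbit (\<gamma> s) n)) holomorphic_on S"
    by (intro holomorphic_intros assms Suc)
  then show ?case by (simp only: exp_map_iterate_Suc)
qed simp

lemma singular_orbit_continuous: "continuous_on S (\<lambda>c. singular_orbit c n)"
  using singular_orbit_holomorphic[of "\<lambda>c. c" UNIV n] holomorphic_on_imp_continuous_on holomorphic_on_ident
    continuous_on_subset by blast

lemma singular_orbit_tendsto:
  assumes "(\<gamma> \<longlongrightarrow> c) F"
  shows "((\<lambda>s. singular_orbit (\<gamma> s) n) \<longlongrightarrow> singular_orbit c n) F"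
proof -
  have "isCont (\<lambda>c. singular_orbit c n) c"
    using singular_orbit_continuous[of UNIV n] by (simp add: continuous_on_eq_continuous_at)
  then show ?thesis using assms by (rule isCont_tendsto_compose)
qed

text \<open>The identity \<open>singular_orbit (P * exp (- P)) n = P\<close> says that \<open>P\<close> is a fixed point hit by the
  singular orbit. It cannot hold identically, since \<open>P * exp (- P)\<close> has a critical point at \<open>1\<close>.\<close>

lemma singular_orbit_not_identically_fixed:
  "\<exists>P. singular_orbit (P * exp (- P)) n \<noteq> P"
proof (rule ccontr)
  assume "\<nexists>P. singular_orbit (P * exp (- P)) n \<noteq> P"
  then have all: "singular_orbit (P * exp (- P)) n = P" for P by blast
  have "(\<lambda>c. singular_orbit c n) holomorphic_on UNIV"
    by (rule singular_orbit_holomorphic[of "\<lambda>c. c", OF holomorphic_on_ident])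
  then obtain D where D: "((\<lambda>c. singular_orbit c n) has_field_derivative D) (at (1 * exp (- 1)))"
    using holomorphic_derivI[OF _ open_UNIV UNIV_I] by blast
  have "((\<lambda>P::complex. P * exp (- P)) has_field_derivative 0) (at 1)"
    by (auto intro!: derivative_eq_intros)
  from DERIV_chain2[OF D this] have "((\<lambda>P. singular_orbit (P * exp (- P)) n) has_field_derivative D * 0) (at 1)" .
  then have "((\<lambda>P::complex. P) has_field_derivative 0) (at 1)" using all by simp
  then have "(0::complex) = 1" using DERIV_ident DERIV_unique by blast
  then show False by simp
qed

lemma norm_Ln_le_10:
  assumes "1/2 \<le> cmod s" "cmod s \<le> 7"
  shows "cmod (Ln s) \<le> 10"
proof -
  have s: "s \<noteq> 0" using assms by auto
  have "ln (cmod s) \<le> 6" using ln_le_minus_one[of "cmod s"] s assms by simp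
  moreover have "- ln (cmod s) \<le> 1"
  proof -
    have "ln (1 / cmod s) \<le> 1 / cmod s - 1" using s by (intro ln_le_minus_one) auto
    also have "1 / cmod s \<le> 2" using assms s by (simp add: field_simps)
    finally show ?thesis using s by (simp add: ln_div)
  qed
  ultimately have "\<bar>Re (Ln s)\<bar> \<le> 6" using s by simp
  moreover have "\<bar>Im (Ln s)\<bar> \<le> 4"
    using mpi_less_Im_Ln[OF s] Im_Ln_le_pi[OF s] pi_less_4 by simp
  ultimately show ?thesis using cmod_le[of "Ln s"] by simp
qed

text \<open>Another fixed point \<open>s * p\<close> of the map with fixed point \<open>p\<close>: the two parameters
  \<open>p * exp (- p)\<close> and \<open>s * p * exp (- s * p)\<close> agree iff \<open>exp (p * (s - 1)) = s\<close>.\<close>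

lemma second_fixed_point:
  assumes p: "cmod p \<ge> 100"
  shows "\<exists>s. \<exists>m::int. Re s \<ge> 1/2 \<and> 3 < cmod s \<and> cmod s < 7 \<and> p * (s - 1) = Ln s + 2 * of_int m * of_real pi * \<i>"
proof -
  \<comment> \<open>Makes \<open>cmod v\<close> lie between 4 and 5; the sign of \<open>m\<close>
    gives \<open>Re v \<ge> 0\<close>. As \<open>Ln s / p\<close> is small, \<open>1 + v\<close> is
    nearly fixed by \<open>T\<close>, and Brouwer's theorem on the disc of radius \<open>1/2\<close>
    about it yields a true fixed point.\<close>
  define M where "M = \<lceil>4 * cmod p / (2 * pi)\<rceil>"
  have "4 * cmod p / (2 * pi) \<le> of_int M" "of_int M < 4 * cmod p / (2 * pi) + 1"
    unfolding M_def by linarith+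
  then have "4 * cmod p / (2 * pi) * (2 * pi) \<le> of_int M * (2 * pi)"
      "of_int M * (2 * pi) < (4 * cmod p / (2 * pi) + 1) * (2 * pi)"
    by (intro mult_right_mono mult_strict_right_mono; simp)+
  then have M: "4 * cmod p \<le> 2 * of_int M * pi" "2 * of_int M * pi < 4 * cmod p + 8"
    using pi_less_4 by (auto simp: algebra_simps)
  define m where "m = (if Im p \<ge> 0 then M else - M)"
  define v where "v = 2 * of_int m * of_real pi * \<i> / p"
  have p0: "p \<noteq> 0" using p by auto
  have M0: "of_int M \<ge> (0::real)" using M(1) p by (smt (verit) mult_nonneg_nonneg mult_neg_pos norm_ge_zero pi_gt_zero)
  have nv: "cmod v = 2 * of_int M * pi / cmod p"
    using M0 by (simp add: v_def m_def norm_divide norm_mult)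
  have v4: "4 \<le> cmod v" "cmod v \<le> 5" using M p p0 by (auto simp: nv field_simps)
  have Rev: "Re v \<ge> 0"
  proof -
    have "Re v = 2 * of_int m * pi * Im p / (cmod p)\<^sup>2"
      by (simp add: v_def Re_divide cmod_power2)
    moreover have "of_int m * Im p \<ge> (0::real)" using M0 by (auto simp: m_def mult_nonpos_nonpos mult_nonneg_nonpos)
    then have "(2 * pi) * (of_int m * Im p) \<ge> 0"
      by (rule mult_nonneg_nonneg[rotated]) simp
    ultimately show ?thesis by (simp add: mult_ac divide_nonneg_nonneg)
  qed
  have s: "Re s \<ge> 1/2" "cmod s \<le> 13/2" if "s \<in> cball (1 + v) (1/2)" for s
  proof -
    have d: "cmod (1 + v - s) \<le> 1/2" using that by (simp add: dist_norm)
    show "Re s \<ge> 1/2" using d abs_Re_le_cmod[of "1 + v - s"] Rev by (simp add: abs_le_iff)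
    have "cmod s \<le> cmod (1 + v) + 1/2" using d norm_triangle_ineq2[of s "1 + v"] by (simp add: norm_minus_commute)
    then show "cmod s \<le> 13/2" using norm_triangle_ineq[of 1 v] v4 by simp
  qed
  define T where "T = (\<lambda>s. 1 + (Ln s + 2 * of_int m * of_real pi * \<i>) / p)"
  have "continuous_on (cball (1 + v) (1/2)) T"
    unfolding T_def by (intro continuous_intros) (use s(1) p0 in \<open>force simp: complex_nonpos_Reals_iff\<close>)+
  moreover have "T \<in> cball (1 + v) (1/2) \<rightarrow> cball (1 + v) (1/2)"
  proof
    fix s assume sb: "s \<in> cball (1 + v) (1/2)"
    have "cmod (Ln s) \<le> 10"
      using s[OF sb] complex_Re_le_cmod[of s] by (intro norm_Ln_le_10) linarith+
    then have "cmod (Ln s / p) \<le> 1/2" using p p0 by (simp add: norm_divide field_simps)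
    then show "T s \<in> cball (1 + v) (1/2)"
      by (simp add: T_def v_def dist_norm add_divide_distrib norm_minus_commute)
  qed
  ultimately obtain s0 where s0: "s0 \<in> cball (1 + v) (1/2)" "T s0 = s0"
    using brouwer_ball[of "1/2" "1 + v" T] by auto
  have eq: "p * (s0 - 1) = Ln s0 + 2 * of_int m * of_real pi * \<i>"
  proof -
    have "s0 - 1 = (Ln s0 + 2 * of_int m * of_real pi * \<i>) / p"
      using s0(2) unfolding T_def by (metis add_diff_cancel_left')
    then show ?thesis using p0 by simp
  qed
  have "cmod (1 + v) \<ge> cmod v"
  proof -
    have "(cmod (1 + v))\<^sup>2 = (1 + Re v)\<^sup>2 + (Im v)\<^sup>2" by (simp add: cmod_power2)
    also have "\<dots> \<ge> (Re v)\<^sup>2 + (Im v)\<^sup>2" using Rev by (simp add: power2_eq_square algebra_simps)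
    finally show ?thesis by (simp add: cmod_power2[symmetric] power_mono_iff)
  qed
  moreover have "cmod s0 \<ge> cmod (1 + v) - 1/2"
    using s0(1) norm_triangle_ineq2[of "1 + v" s0] by (simp add: dist_norm)
  ultimately have "cmod s0 > 3" using v4 by simp
  then show ?thesis using s[OF s0(1)] eq by (intro exI[of _ s0] exI[of _ m]) auto
qed

text \<open>The map with parameter \<open>C s\<close> fixes both \<open>P s\<close> and
  \<open>s * P s\<close>, and \<open>s0\<close> gives back \<open>c\<close> and \<open>p\<close>.
  The points \<open>P s + u k s\<close> form a backward chain from \<open>s * P s\<close> towards
  \<open>P s\<close>: each is mapped to the previous one, and the first to \<open>s * P s\<close>.
  As \<open>u k\<close> tends to 0 uniformly and \<open>G\<close> vanishes at \<open>s0\<close>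
  without being constant, Hurwitz's theorem solves \<open>G s = u k s\<close>, which puts the
  singular orbit on the chain at time \<open>n0\<close>.\<close>

lemma (in postsingularly_finite) next_parameter:
  assumes "\<epsilon> > 0" and p_large: "3/4 * cmod c < cmod p"
  shows "\<exists>c' p' n1. cmod (c' - c) < \<epsilon> \<and> n0 < n1 \<and> postsingularly_finite c' p' n1 \<and>
     2 * cmod p \<le> cmod p' \<and> 3/4 * cmod c' < cmod p' \<and>
     (\<forall>i. n0 \<le> i \<and> i \<le> n1 \<longrightarrow> cmod p - 12 \<le> cmod (singular_orbit c' i))"
proof -
  have cbig: "cmod c > 5001" using large exp_ge_add_one_self[of "5000::real"] by linarith
  then have pbig: "cmod p > 3000" using p_large by simp
  obtain s0 and m :: int where s0: "Re s0 \<ge> 1/2" "3 < cmod s0" "cmod s0 < 7"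
      "p * (s0 - 1) = Ln s0 + 2 * of_int m * of_real pi * \<i>"
    using second_fixed_point[of p] pbig by auto
  have s01: "s0 \<noteq> 1" using s0(2) by auto
  define P where "P = (\<lambda>s. (Ln s + 2 * of_int m * of_real pi * \<i>) / (s - 1))"
  define C where "C = (\<lambda>s. P s * exp (- P s))"
  have P0: "P s0 = p" using s0(4) s01 by (simp add: P_def field_simps)
  have C0: "C s0 = c" using fixed by (simp add: C_def P0 exp_map_def exp_minus field_simps)
  have nonpos: "s0 \<notin> \<real>\<^sub>\<le>\<^sub>0" using s0(1) by (auto simp: complex_nonpos_Reals_iff)
  have Plim: "(P \<longlongrightarrow> p) (nhds s0)" unfolding P0[symmetric] P_def
    by (intro tendsto_intros filterlim_ident) (use nonpos s01 in auto)
  have Clim: "(C \<longlongrightarrow> c) (nhds s0)" unfolding C0[symmetric] C_def P0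
    by (intro tendsto_intros Plim)
  have Lnlim: "((\<lambda>s. Ln s) \<longlongrightarrow> Ln s0) (nhds s0)"
    by (intro tendsto_Ln filterlim_ident nonpos)
  \<comment> \<open>All conditions are open, hence persist near \<open>s0\<close>; 11 relaxes the
    bound 10 for \<open>cmod (Ln s0)\<close>.\<close>
  define Q where "Q = (\<lambda>s. Re s > 1/4 \<and> 3 < cmod s \<and> cmod (Ln s) < 11 \<and> cmod (P s - p) < 1 \<and>
     cmod (C s - c) < \<epsilon> \<and> cmod (C s) > exp 5000 \<and> 3/4 * cmod (C s) < cmod (P s) \<and>
     (\<forall>i\<in>{1..n0}. cmod (C s) / 2 < cmod (singular_orbit (C s) i)))"
  have "eventually Q (nhds s0)"
    unfolding Q_def
  proof (intro eventually_conj)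
    show "eventually (\<lambda>s. Re s > 1/4) (nhds s0)"
      by (rule order_tendstoD(1)[OF tendsto_Re[OF filterlim_ident]]) (use s0 in simp)
    show "eventually (\<lambda>s. 3 < cmod s) (nhds s0)"
      by (rule order_tendstoD(1)[OF tendsto_norm[OF filterlim_ident]]) (use s0 in simp)
    have "cmod (Ln s0) \<le> 10" using s0 by (intro norm_Ln_le_10) auto
    then show "eventually (\<lambda>s. cmod (Ln s) < 11) (nhds s0)"
      by (intro order_tendstoD(2)[OF tendsto_norm[OF Lnlim]]) simp
    show "eventually (\<lambda>s. cmod (P s - p) < 1) (nhds s0)"
      by (rule order_tendstoD(2)[OF tendsto_norm[OF tendsto_diff[OF Plim tendsto_const]]]) simp
    show "eventually (\<lambda>s. cmod (C s - c) < \<epsilon>) (nhds s0)"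
      by (rule order_tendstoD(2)[OF tendsto_norm[OF tendsto_diff[OF Clim tendsto_const]]]) (use assms in simp)
    show "eventually (\<lambda>s. exp 5000 < cmod (C s)) (nhds s0)"
      by (rule order_tendstoD(1)[OF tendsto_norm[OF Clim] large])
    have "((\<lambda>s. cmod (P s) - 3/4 * cmod (C s)) \<longlongrightarrow> cmod p - 3/4 * cmod c) (nhds s0)"
      by (intro tendsto_intros Plim Clim)
    from order_tendstoD(1)[OF this, of 0] p_large
    show "eventually (\<lambda>s. 3/4 * cmod (C s) < cmod (P s)) (nhds s0)" by simp
    have "eventually (\<lambda>s. cmod (C s) / 2 < cmod (singular_orbit (C s) i)) (nhds s0)" if "i \<in> {1..n0}" for i
    proof -
      have "((\<lambda>s. cmod (singular_orbit (C s) i) - cmod (C s) / 2) \<longlongrightarrow> cmod (singular_orbit c i) - cmod c / 2) (nhds s0)"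
        by (intro tendsto_intros singular_orbit_tendsto Clim) simp
      from order_tendstoD(1)[OF this, of 0] orbit_large[of i] that show ?thesis by simp
    qed
    then show "eventually (\<lambda>s. \<forall>i\<in>{1..n0}. cmod (C s) / 2 < cmod (singular_orbit (C s) i)) (nhds s0)"
      by (intro eventually_ball_finite) auto
  qed
  then obtain \<eta> where \<eta>: "\<eta> > 0" "\<And>s. dist s s0 < \<eta> \<Longrightarrow> Q s"
    unfolding eventually_nhds_metric by blast
  define S where "S = ball s0 \<eta>"
  have S: "open S" "connected S" "s0 \<in> S" using \<eta>(1) by (auto simp: S_def)
  have QS: "Q s" if "s \<in> S" for s using that \<eta>(2)[of s] by (simp add: S_def dist_commute)
  have Snp: "s \<notin> \<real>\<^sub>\<le>\<^sub>0" "s \<noteq> 1" "s \<noteq> 0" if "s \<in> S" for s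
    using QS[OF that] by (auto simp: Q_def complex_nonpos_Reals_iff)
  have Pbig: "cmod (P s) > cmod p - 1" if "s \<in> S" for s
    using QS[OF that] norm_triangle_ineq2[of p "P s"] by (simp add: Q_def norm_minus_commute)
  have Pnz: "P s \<noteq> 0" if "s \<in> S" for s using Pbig[OF that] pbig by auto
  have holP: "P holomorphic_on S" unfolding P_def
    by (intro holomorphic_intros) (use Snp in auto)
  have holC: "C holomorphic_on S" unfolding C_def by (intro holomorphic_intros holP)
  \<comment> \<open>With parameter \<open>P * exp (- P)\<close>, the point \<open>P + x\<close> is
    mapped to \<open>P * exp x\<close>. This equals \<open>P + v\<close> for
    \<open>x = Ln (1 + v / P)\<close>, and \<open>s * P\<close> for \<open>x = Ln s\<close>.\<close>
  define u where "u = (\<lambda>k s. ((\<lambda>v. Ln (1 + v / P s)) ^^ k) (Ln s))"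
  have u0: "u 0 s = Ln s" and uS: "u (Suc k) s = Ln (1 + u k s / P s)" for k s
    by (simp_all add: u_def)
  have ub: "cmod (u k s) \<le> 11 * (1/2) ^ k" if s: "s \<in> S" for k s
  proof (induction k)
    case 0
    then show ?case using QS[OF s] by (simp add: u0 Q_def)
  next
    case (Suc k)
    have "11 * (1/2) ^ k \<le> (11::real)" by (simp add: power_le_one)
    then have u11: "cmod (u k s) \<le> 11" using Suc by linarith
    have q: "cmod (u k s / P s) \<le> cmod (u k s) / 4"
      unfolding norm_divide using Pbig[OF s] pbig by (intro divide_left_mono mult_pos_pos) auto
    have "cmod (u k s / P s) < 1/2"
    proof -
      have "cmod (u k s) < (1/2) * cmod (P s)" using u11 Pbig[OF s] pbig by simp
      then show ?thesis using Pnz[OF s] by (simp add: norm_divide field_simps)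
    qed
    then have "cmod (u (Suc k) s) \<le> 2 * cmod (u k s / P s)" unfolding uS by (rule norm_Ln_le)
    also have "\<dots> \<le> (1/2) * cmod (u k s)" using q by simp
    finally show ?case using Suc by simp
  qed
  have u11: "cmod (u k s) \<le> 11" if "s \<in> S" for k s
  proof -
    have "11 * (1/2) ^ k \<le> (11::real)" by (simp add: power_le_one)
    then show ?thesis using ub[OF that, of k] by linarith
  qed
  have arg: "Re (1 + u k s / P s) > 0" if s: "s \<in> S" for k s
  proof -
    have "cmod (u k s) < 1 * cmod (P s)" using u11[OF s, of k] Pbig[OF s] pbig by simp
    then have "cmod (u k s / P s) < 1" using Pnz[OF s] by (simp add: norm_divide)
    then show ?thesis using abs_Re_le_cmod[of "u k s / P s"] by (simp add: abs_le_iff)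
  qed
  have argnp: "1 + u k s / P s \<notin> \<real>\<^sub>\<le>\<^sub>0" if "s \<in> S" for k s
    using arg[OF that, of k] unfolding complex_nonpos_Reals_iff by linarith
  have holu: "u k holomorphic_on S" for k
  proof (induction k)
    case 0
    have "(\<lambda>s. Ln s) holomorphic_on S" by (intro holomorphic_intros) (use Snp in auto)
    then show ?case by (simp add: u0[abs_def])
  next
    case (Suc k)
    have "(\<lambda>s. Ln (1 + u k s / P s)) holomorphic_on S"
      by (intro holomorphic_intros Suc holP) (use argnp Pnz in auto)
    then show ?case by (simp add: uS[abs_def])
  qed
  define G where "G = (\<lambda>s. singular_orbit (C s) n0 - P s)"
  have holG: "G holomorphic_on S" unfolding G_def
    by (intro holomorphic_intros singular_orbit_holomorphic holC holP)
  have G0: "G s0 = 0" by (simp add: G_def C0 P0 orbit_n0)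
  \<comment> \<open>If \<open>G\<close> vanished on \<open>S\<close>, then
    \<open>singular_orbit (z * exp (- z)) n0 = z\<close> on the open image of \<open>P\<close>,
    hence everywhere. That \<open>P\<close> is not constant follows since otherwise
    \<open>Ln\<close> would be affine near \<open>s0\<close> with the large slope
    \<open>p\<close>.\<close>
  have nonconst: "\<not> G constant_on S"
  proof
    assume "G constant_on S"
    then have Gz: "G s = 0" if "s \<in> S" for s using that S(3) G0 unfolding constant_on_def by metis
    have "\<not> P constant_on S"
    proof
      assume "P constant_on S"
      then have Pc: "P s = p" if "s \<in> S" for s using that S(3) P0 unfolding constant_on_def by metis
      have eq: "Ln s = p * (s - 1) - 2 * of_int m * of_real pi * \<i>" if "s \<in> S" for s
        using Pc[OF that] Snp(2)[OF that] by (simp add: P_def field_simps)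
      have "(Ln has_field_derivative inverse s0) (at s0)" by (rule has_field_derivative_Ln[OF nonpos])
      moreover have "(Ln has_field_derivative p) (at s0)"
      proof (rule has_field_derivative_transform_within_open[of "\<lambda>s. p * (s - 1) - 2 * of_int m * of_real pi * \<i>"])
        show "((\<lambda>s. p * (s - 1) - 2 * of_int m * of_real pi * \<i>) has_field_derivative p) (at s0)"
          by (auto intro!: derivative_eq_intros)
      qed (use S eq in auto)
      ultimately have "inverse s0 = p" by (rule DERIV_unique)
      then have "cmod p = inverse (cmod s0)" using norm_inverse by metis
      moreover have "inverse (cmod s0) \<le> inverse 3" using s0(2) by (intro le_imp_inverse_le) auto
      ultimately show False using pbig by simp
    qed
    then have op: "open (P ` S)" using open_mapping_thm[OF holP S(1,2) S(1)] by blast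
    have hol: "(\<lambda>z. singular_orbit (z * exp (- z)) n0) holomorphic_on UNIV"
      by (rule singular_orbit_holomorphic[of "\<lambda>z. z * exp (- z)"]) (intro holomorphic_intros)
    have "singular_orbit (z * exp (- z)) n0 = z" for z
    proof (rule analytic_continuation_open[OF op open_UNIV _ connected_UNIV subset_UNIV hol holomorphic_on_ident])
      show "P ` S \<noteq> {}" using S(3) by blast
      show "singular_orbit (z * exp (- z)) n0 = z" if "z \<in> P ` S" for z
        using that Gz by (auto simp: G_def C_def)
    qed simp
    then show False using singular_orbit_not_identically_fixed by blast
  qed
  have "\<exists>k. \<exists>s\<in>S. G s - u k s = 0"
  proof (rule ccontr)
    assume no: "\<not> ?thesis"
    have "G s0 \<noteq> 0"
    proof (rule Hurwitz_no_zeros[OF S(1,2) _ holG _ nonconst _ S(3), of "\<lambda>k s. G s - u k s"])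
      show "(\<lambda>s. G s - u k s) holomorphic_on S" for k by (intro holomorphic_intros holG holu)
      show "uniform_limit K (\<lambda>k s. G s - u k s) G sequentially" if K: "K \<subseteq> S" for K
      proof (rule uniform_limitI)
        fix e :: real assume "e > 0"
        have "(\<lambda>k. 11 * (1/2::real) ^ k) \<longlonglongrightarrow> 11 * 0"
          by (intro tendsto_intros LIMSEQ_realpow_zero) auto
        then have "eventually (\<lambda>k. 11 * (1/2::real) ^ k < e) sequentially"
          using \<open>e > 0\<close> by (intro order_tendstoD(2)) auto
        then show "eventually (\<lambda>k. \<forall>s\<in>K. dist (G s - u k s) (G s) < e) sequentially"
        proof eventually_elim
          case (elim k)
          show ?case
          proof
            fix s assume "s \<in> K"
            then have "cmod (u k s) \<le> 11 * (1/2) ^ k" using K by (intro ub) blast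
            then show "dist (G s - u k s) (G s) < e" using elim by (simp add: dist_norm)
          qed
        qed
      qed
      show "G s - u k s \<noteq> 0" if "s \<in> S" for k s using no that by blast
    qed
    then show False using G0 by simp
  qed
  then obtain k s where s: "s \<in> S" and ks: "singular_orbit (C s) n0 = P s + u k s"
    by (auto simp: G_def algebra_simps)
  define c' where "c' = C s"
  define p' where "p' = s * P s"
  have Qs: "Re s > 1/4" "3 < cmod s" "cmod (C s - c) < \<epsilon>" "cmod (C s) > exp 5000"
      "3/4 * cmod (C s) < cmod (P s)" "\<And>i. i \<in> {1..n0} \<Longrightarrow> cmod (C s) / 2 < cmod (singular_orbit (C s) i)"
    using QS[OF s] by (auto simp: Q_def)
  have preim: "exp_map c' (P s + u (Suc j) s) = P s + u j s" for j
  proof -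
    have "1 + u j s / P s \<noteq> 0" using arg[OF s, of j] by force
    then have "exp (u (Suc j) s) = 1 + u j s / P s" by (simp add: uS)
    then show ?thesis using Pnz[OF s]
      by (simp add: exp_map_def c'_def C_def exp_add exp_minus field_simps)
  qed
  have preim0: "exp_map c' (P s + u 0 s) = p'"
    using Snp(3)[OF s] by (simp add: exp_map_def c'_def C_def p'_def u0 exp_add exp_minus field_simps)
  have fixp: "exp_map c' p' = p'"
  proof -
    have "P s * (s - 1) = Ln s + 2 * of_int m * of_real pi * \<i>"
      using Snp(2)[OF s] by (simp add: P_def)
    then have "exp (P s * (s - 1)) = exp (Ln s) * exp (2 * of_int m * of_real pi * \<i>)"
      by (simp add: exp_add)
    also have "exp (2 * of_int m * of_real pi * \<i>) = 1" by (subst exp_eq_1) (auto intro!: exI[of _ m])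
    finally have e: "exp (P s * (s - 1)) = s" using Snp(3)[OF s] by simp
    have "exp (s * P s) * exp (- P s) = exp (P s * (s - 1))"
      by (simp add: exp_add[symmetric] algebra_simps)
    then show ?thesis using e by (simp add: exp_map_def c'_def C_def p'_def mult_ac)
  qed
  have orb: "singular_orbit c' (n0 + j) = P s + u (k - j) s" if "j \<le> k" for j
    using that
  proof (induction j)
    case 0
    then show ?case using ks by (simp add: c'_def)
  next
    case (Suc j)
    then have "singular_orbit c' (n0 + Suc j) = exp_map c' (P s + u (Suc (k - Suc j)) s)"
      by (simp add: Suc_diff_Suc)
    then show ?case using preim by simp
  qed
  have orb1: "singular_orbit c' (n0 + k + 1) = p'" using orb[of k] preim0 by simp
  have p'2: "2 * cmod p \<le> cmod p'"
  proof -
    have "3 * (cmod p - 1) \<le> cmod s * cmod (P s)"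
      using Qs(2) Pbig[OF s] pbig by (intro mult_mono) auto
    then show ?thesis using pbig by (simp add: p'_def norm_mult)
  qed
  have Ps_p': "cmod (P s) \<le> cmod p'"
  proof -
    have "1 * cmod (P s) \<le> cmod s * cmod (P s)" using Qs(2) by (intro mult_right_mono) auto
    then show ?thesis by (simp add: p'_def norm_mult)
  qed
  have mid: "cmod (P s) - 11 \<le> cmod (singular_orbit c' i)" if "n0 \<le> i" "i \<le> n0 + k + 1" for i
  proof (cases "i = n0 + k + 1")
    case True
    then show ?thesis using orb1 Ps_p' by simp
  next
    case False
    then have "i = n0 + (i - n0)" "i - n0 \<le> k" using that by auto
    then have "singular_orbit c' i = P s + u (k - (i - n0)) s" using orb by metis
    then show ?thesis using u11[OF s, of "k - (i - n0)"] norm_triangle_ineq2[of "P s" "- u (k - (i - n0)) s"] by simp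
  qed
  have "postsingularly_finite c' p' (n0 + k + 1)"
  proof
    \<comment> \<open>Up to \<open>n0\<close> this is part of \<open>Q\<close>; on the chain,
      \<open>3/4 * cmod c' - 11\<close> still exceeds \<open>cmod c' / 2\<close>, which is why fixed
      points are required to satisfy the bound with \<open>3/4\<close>.\<close>
    show "cmod c' / 2 < cmod (singular_orbit c' i)" if i: "1 \<le> i" "i \<le> n0 + k + 1" for i
    proof (cases "i \<le> n0")
      case True
      then show ?thesis using Qs(6)[of i] i by (simp add: c'_def)
    next
      case False
      have "cmod c' > 5001" using Qs(4) exp_ge_add_one_self[of "5000::real"] unfolding c'_def by linarith
      then show ?thesis using mid[of i] False i Qs(5) unfolding c'_def[symmetric] by linarith
    qed
    show "singular_orbit c' (n0 + k + 1) = p'" by (rule orb1)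
    show "exp_map c' p' = p'" by (rule fixp)
    show "exp 5000 < cmod c'" using Qs(4) by (simp add: c'_def)
  qed simp
  moreover have "cmod p - 12 \<le> cmod (singular_orbit c' i)" if "n0 \<le> i \<and> i \<le> n0 + k + 1" for i
    using mid[of i] that Pbig[OF s] by linarith
  moreover have "3/4 * cmod c' < cmod p'" using Qs(5) Ps_p' by (simp add: c'_def)
  ultimately show ?thesis using Qs(3) p'2
    by (intro exI[of _ c'] exI[of _ p'] exI[of _ "n0 + k + 1"]) (auto simp: c'_def)
qed

section \<open>Masses of preimages\<close>

lemma iterate_vimage_borel [simp, measurable]:
  assumes "A \<in> sets borel"
  shows "(iter c n) -` A \<in> sets borel"
proof -
  have "(iter c n) \<in> borel_measurable borel"
    by (intro borel_measurable_continuous_onI exp_map_iterate_continuous)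
  from measurable_sets[OF this assms] show ?thesis by simp
qed

lemma negligible_iff_lborel_null: "A \<in> sets borel \<Longrightarrow> negligible A \<longleftrightarrow> emeasure lborel A = 0"
  using negligible_iff_emeasure0[of A] by simp

lemma exists_nonnegligible_compact_subset:
  assumes "A \<in> sets lebesgue" "emeasure lebesgue A > 0"
  obtains K where "compact K" "K \<subseteq> A" "emeasure lborel K > 0"
proof -
  have "\<not> negligible A" using assms negligible_iff_emeasure0[OF assms(1)] by auto
  then obtain K where K: "compact K" "K \<subseteq> A" "\<not> negligible K"
    using nonnegligible_compact_subset assms(1) by blast
  then have "emeasure lborel K \<noteq> 0" using negligible_iff_lborel_null[of K] by (simp add: borel_compact)
  then show thesis using K that by (simp add: zero_less_iff_neq_zero)
qed

locale reference_measure = finite_measure \<mu> for \<mu> :: "complex measure" +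
  assumes sets_eq [simp, measurable_cong]: "sets \<mu> = sets borel"
    and null_iff: "\<And>N. N \<in> sets borel \<Longrightarrow> emeasure \<mu> N = 0 \<longleftrightarrow> emeasure lborel N = 0"

lemma reference_measure_exists: "\<exists>\<mu>. reference_measure \<mu>"
proof -
  obtain h :: "complex \<Rightarrow> ennreal" where h: "h \<in> borel_measurable lborel" "integral\<^sup>N lborel h \<noteq> \<infinity>" "\<And>x. 0 < h x"
    using sigma_finite_measure.Ex_finite_integrable_function[OF sigma_finite_lborel] by fastforce
  have "reference_measure (density lborel h)"
  proof (intro reference_measure.intro reference_measure_axioms.intro finite_measureI)
    show "emeasure (density lborel h) (space (density lborel h)) \<noteq> \<infinity>"
      using h by (simp add: emeasure_density)
    show "sets (density lborel h) = sets borel" by simp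
    show "emeasure (density lborel h) N = 0 \<longleftrightarrow> emeasure lborel N = 0" if N: "N \<in> sets borel" for N
    proof -
      have "N \<in> null_sets (density lborel h) \<longleftrightarrow> (AE x in lborel. x \<notin> N)"
        using null_sets_density_iff[OF h(1)] N h(3) by (simp add: less_le)
      also have "\<dots> \<longleftrightarrow> N \<in> null_sets lborel" using N by (intro AE_iff_null_sets[symmetric]) simp
      finally show ?thesis using N by (simp add: null_sets_def)
    qed
  qed
  then show ?thesis by blast
qed

lemma dilation_total_variation:
  fixes \<nu> :: "complex measure"
  assumes "finite_measure \<nu>" and sets: "sets \<nu> = sets borel" and ac: "absolutely_continuous lborel \<nu>" and "\<epsilon> > 0"
  shows "\<exists>\<delta>>0. \<forall>a. cmod (a - 1) < \<delta> \<longrightarrow> (\<forall>A\<in>sets borel. \<bar>measure \<nu> ((*) a -` A) - measure \<nu> A\<bar> \<le> \<epsilon>)"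
proof -
  interpret finite_measure \<nu> by fact
  have "sets \<nu> = sets lborel" using sets by simp
  from sigma_finite_measure.Radon_Nikodym[OF sigma_finite_lborel ac this] obtain f where f: "f \<in> borel_measurable lborel" "density lborel f = \<nu>" by blast
  define h where "h = (\<lambda>x. enn2real (f x))"
  have hm [measurable]: "h \<in> borel_measurable lborel" unfolding h_def using f(1) by measurable
  have "(\<integral>\<^sup>+x. f x \<partial>lborel) = emeasure \<nu> (space \<nu>)"
    using f by (auto simp: emeasure_density f(2)[symmetric])
  then have fin: "(\<integral>\<^sup>+x. f x \<partial>lborel) \<noteq> \<infinity>" by simp
  have ae: "AE x in lborel. f x = ennreal (h x)"
    using nn_integral_PInf_AE[OF f(1) fin] by eventually_elim (simp add: h_def less_top)
  have dens: "\<nu> = density lborel (\<lambda>x. ennreal (h x))"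
    unfolding f(2)[symmetric] using f(1) ae by (intro density_cong) auto
  have int: "integrable lborel h"
  proof (rule integrableI_nonneg)
    have "(\<integral>\<^sup>+x. ennreal (h x) \<partial>lborel) = (\<integral>\<^sup>+x. f x \<partial>lborel)"
      using ae by (intro nn_integral_cong_AE) auto
    then show "(\<integral>\<^sup>+x. ennreal (h x) \<partial>lborel) < \<infinity>" using fin by (simp add: less_top)
    show "h \<in> borel_measurable lborel" by (rule hm)
  qed (simp add: h_def)
  have meas: "measure \<nu> S = (\<integral>x. h x * indicator S x \<partial>lborel)" if S: "S \<in> sets borel" for S
  proof -
    have "measure \<nu> S = (\<integral>x. indicator S x \<partial>\<nu>)" using sets_eq_imp_space_eq[OF sets] by simp
    also have "\<dots> = (\<integral>x. h x *\<^sub>R indicator S x \<partial>lborel)"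
      unfolding dens using S hm by (intro integral_density) (simp_all add: h_def)
    finally show ?thesis by simp
  qed
  obtain \<delta> where \<delta>: "\<delta> > 0" "\<And>a A. cmod (a - 1) < \<delta> \<Longrightarrow> A \<in> sets borel \<Longrightarrow>
     \<bar>\<integral>x. h x * scale_diff a A x \<partial>lborel\<bar> \<le> \<epsilon>"
    using integral_scale_diff_small[OF int, rule_format, OF \<open>\<epsilon> > 0\<close>] by blast
  have "\<bar>measure \<nu> ((*) a -` A) - measure \<nu> A\<bar> \<le> \<epsilon>" if a: "cmod (a - 1) < \<delta>" and A: "A \<in> sets borel" for a A
  proof -
    have i: "integrable lborel (\<lambda>x. h x * indicator S x)" if "S \<in> sets borel" for S
      using integrable_real_mult_indicator[OF _ int, of S] that by simp
    have "measure \<nu> ((*) a -` A) - measure \<nu> A =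
        (\<integral>x. h x * indicator ((*) a -` A) x - h x * indicator A x \<partial>lborel)"
      using A by (simp add: meas i Bochner_Integration.integral_diff)
    also have "\<dots> = (\<integral>x. h x * scale_diff a A x \<partial>lborel)"
      by (intro Bochner_Integration.integral_cong) (auto simp: algebra_simps indicator_def)
    finally show ?thesis using \<delta>(2)[OF a A] by simp
  qed
  then show ?thesis using \<delta>(1) by blast
qed

section \<open>Pullbacks of the reference measure under iterates\<close>

context reference_measure
begin

lemma space_eq [simp]: "space \<mu> = UNIV"
  using sets_eq_imp_space_eq[OF sets_eq] by simp

lemma iterate_vimage_null:
  assumes "c \<noteq> 0" "N \<in> sets borel" "emeasure lborel N = 0"
  shows "emeasure \<mu> ((iter c n) -` N) = 0"
proof -
  have "negligible N" using negligible_iff_lborel_null assms by blast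
  from negligible_iterate_preimage[OF assms(1) this, of n]
  have "emeasure lborel ((iter c n) -` N) = 0"
    using negligible_iff_lborel_null[OF iterate_vimage_borel[OF assms(2)]] by blast
  then show ?thesis using null_iff[OF iterate_vimage_borel[OF assms(2)]] by blast
qed

lemma iterate_measurable [measurable]: "(iter c n) \<in> measurable \<mu> borel"
  using borel_measurable_continuous_onI[OF exp_map_iterate_continuous]
  by (simp cong: measurable_cong_sets)

lemma distr_iterate_absolutely_continuous:
  assumes "c \<noteq> 0"
  shows "absolutely_continuous lborel (distr \<mu> borel (iter c n))"
  unfolding absolutely_continuous_def
proof
  fix N :: "complex set" assume "N \<in> null_sets lborel"
  then have N: "N \<in> sets borel" "emeasure lborel N = 0" by auto
  then show "N \<in> null_sets (distr \<mu> borel (iter c n))"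
    using iterate_vimage_null[OF assms N] by (simp add: null_sets_def emeasure_distr)
qed

text \<open>The last step is exchanged first: the preimage of \<open>A\<close> under
  \<open>exp_map c'\<close> is the preimage under \<open>exp_map c\<close> of a dilated set, so the
  error is a total variation for the image measure of \<open>Suc n\<close> steps of
  \<open>c\<close>. The remaining \<open>n\<close> steps are applied to a set that depends on
  \<open>c'\<close>, which is why the hypothesis has to be uniform over all sets.\<close>

lemma iterate_measure_perturbation:
  assumes "c \<noteq> 0" "\<epsilon> > 0"
  shows "\<exists>\<delta>>0. \<forall>c'. cmod (c' - c) < \<delta> \<longrightarrow> (\<forall>A\<in>sets borel.
     \<bar>measure \<mu> ((iter c' n) -` A) - measure \<mu> ((iter c n) -` A)\<bar> \<le> \<epsilon>)"
  using \<open>\<epsilon> > 0\<close>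
proof (induction n arbitrary: \<epsilon>)
  case 0
  then show ?case by (intro exI[of _ 1]) auto
next
  case (Suc n)
  then have e2: "\<epsilon> / 2 > 0" by simp
  obtain \<delta>1 where \<delta>1: "\<delta>1 > 0" "\<And>c' A. cmod (c' - c) < \<delta>1 \<Longrightarrow> A \<in> sets borel \<Longrightarrow>
     \<bar>measure \<mu> ((iter c' n) -` A) - measure \<mu> ((iter c n) -` A)\<bar> \<le> \<epsilon> / 2"
    using Suc.IH[OF e2] by blast
  define \<nu> where "\<nu> = distr \<mu> borel (iter c (Suc n))"
  have fin: "finite_measure \<nu>" unfolding \<nu>_def by (intro finite_measure_distr iterate_measurable)
  have \<nu>: "measure \<nu> S = measure \<mu> ((iter c (Suc n)) -` S)" if "S \<in> sets borel" for S
    unfolding \<nu>_def using that measure_distr[OF iterate_measurable[where c = c and n = "Suc n"], of S] by (simp only: space_eq Int_UNIV_right)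
  obtain \<delta>2 where \<delta>2: "\<delta>2 > 0" "\<And>a A. cmod (a - 1) < \<delta>2 \<Longrightarrow> A \<in> sets borel \<Longrightarrow>
     \<bar>measure \<nu> ((*) a -` A) - measure \<nu> A\<bar> \<le> \<epsilon> / 2"
    using dilation_total_variation[OF fin _ _ e2] distr_iterate_absolutely_continuous[OF assms(1), of "Suc n"]
    unfolding \<nu>_def by (metis sets_distr)
  have "\<bar>measure \<mu> ((iter c' (Suc n)) -` A) - measure \<mu> ((iter c (Suc n)) -` A)\<bar> \<le> \<epsilon>"
    if c': "cmod (c' - c) < min \<delta>1 (\<delta>2 * cmod c)" and A: "A \<in> sets borel" for c' A
  proof -
    define a where "a = c' / c"
    define B where "B = exp_map c' -` A"
    have B: "B \<in> sets borel" using iterate_vimage_borel[where c = c' and n = 1, OF A] by (simp add: B_def)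
    have "exp_map c' z = a * exp_map c z" for z using assms(1) by (simp add: exp_map_def a_def)
    then have B': "B = exp_map c -` ((*) a -` A)" by (auto simp: B_def)
    have pre: "(iter d (Suc n)) -` S = (iter d n) -` (exp_map d -` S)" for d S
      by (simp add: vimage_comp)
    have a1: "cmod (a - 1) < \<delta>2"
    proof -
      have "a - 1 = (c' - c) / c" using assms(1) by (simp add: a_def field_simps)
      then have "cmod (a - 1) = cmod (c' - c) / cmod c" by (simp only: norm_divide)
      moreover have "\<dots> < \<delta>2" using c' assms(1) by (simp add: divide_less_eq)
      ultimately show ?thesis by simp
    qed
    have "\<bar>measure \<mu> ((iter c' n) -` B) - measure \<mu> ((iter c n) -` B)\<bar> \<le> \<epsilon> / 2"
      using \<delta>1(2)[OF _ B] c' by simp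
    moreover have "\<bar>measure \<mu> ((iter c n) -` B) - measure \<mu> ((iter c (Suc n)) -` A)\<bar> \<le> \<epsilon> / 2"
      using \<delta>2(2)[OF a1 A] unfolding \<nu>[OF A] \<nu>[OF borel_scale_vimage[OF A]] B' pre .
    ultimately have "\<bar>measure \<mu> ((iter c' n) -` B) - measure \<mu> ((iter c (Suc n)) -` A)\<bar> \<le> \<epsilon>"
      by linarith
    moreover have "(iter c' (Suc n)) -` A = (iter c' n) -` B" unfolding B_def by (rule pre)
    ultimately show ?thesis by (simp only:)
  qed
  moreover have "min \<delta>1 (\<delta>2 * cmod c) > 0" using \<delta>1 \<delta>2 assms(1) by simp
  ultimately show ?case by blast
qed

text \<open>If \<open>A\<close> returned only within time \<open>N\<close>, no point would lie in more than \<open>N\<close> preimages of \<open>A\<close>.\<close>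

lemma dynamically_recurrentI:
  assumes unb: "\<And>A m. A \<in> sets borel \<Longrightarrow> emeasure lborel A > 0 \<Longrightarrow>
     \<exists>N. m \<le> (\<Sum>n<N. measure \<mu> ((iter c n) -` A))"
  shows "dynamically_recurrent (exp_map c)"
  unfolding dynamically_recurrent_def
proof (intro ballI impI notI)
  fix A :: "complex set"
  assume A: "A \<in> sets lebesgue" "emeasure lebesgue A > 0"
    and fin: "finite {n. 1 \<le> n \<and> A \<inter> (iter c n) ` A \<noteq> {}}"
  obtain K where K: "compact K" "K \<subseteq> A" "emeasure lborel K > 0"
    using exists_nonnegligible_compact_subset[OF A] by blast
  have KB: "K \<in> sets borel" using K by (simp add: borel_compact)
  obtain N0 where N0: "\<forall>n\<in>{n. 1 \<le> n \<and> A \<inter> (iter c n) ` A \<noteq> {}}. n < N0"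
    using fin unfolding finite_nat_set_iff_bounded ..
  \<comment> \<open>The successor covers the case \<open>m = n\<close> of \<open>gap\<close> even if
    \<open>N0 = 0\<close>.\<close>
  define L where "L = Suc N0"
  have gap: "m < n + L" if "(iter c n) x \<in> K" "(iter c m) x \<in> K" "n \<le> m" for n m x
  proof (cases "m = n")
    case False
    have "(iter c m) x = (iter c (m - n)) ((iter c n) x)"
      using that(3) by (metis add.commute comp_apply funpow_add le_add_diff_inverse)
    then have "A \<inter> (iter c (m - n)) ` A \<noteq> {}" using that K(2) by blast
    then have "m - n < N0" using N0 False that(3) by auto
    then show ?thesis by (simp add: L_def)
  qed (simp add: L_def)
  have count: "(\<Sum>n<N. indicator ((iter c n) -` K) x) \<le> real L" for N x
  proof -
    define I where "I = {n. n < N \<and> (iter c n) x \<in> K}"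
    have "card I \<le> L"
    proof (cases "I = {}")
      case False
      have finI: "finite I" by (simp add: I_def)
      have "I \<subseteq> {Min I..<Min I + L}"
      proof
        fix m assume m: "m \<in> I"
        have "Min I \<in> I" "Min I \<le> m" using finI False m by auto
        then show "m \<in> {Min I..<Min I + L}" using gap[of "Min I" x m] m by (auto simp: I_def)
      qed
      then have "card I \<le> card {Min I..<Min I + L}" by (intro card_mono) auto
      then show ?thesis by simp
    qed simp
    moreover have "(\<Sum>n\<in>I. 1::real) = (\<Sum>n<N. indicator ((iter c n) -` K) x)"
      by (rule sum.mono_neutral_cong_left) (auto simp: I_def)
    ultimately show ?thesis by simp
  qed
  have bound: "(\<Sum>n<N. measure \<mu> ((iter c n) -` K)) \<le> real L * measure \<mu> UNIV" for N
  proof -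
    have int: "integrable \<mu> (indicator ((iter c n) -` K) :: complex \<Rightarrow> real)" for n
      using KB by (intro integrable_real_indicator) (auto simp: less_top[symmetric])
    have "(\<Sum>n<N. measure \<mu> ((iter c n) -` K)) = (\<Sum>n<N. \<integral>x. indicator ((iter c n) -` K) x \<partial>\<mu>)"
      by simp
    also have "\<dots> = (\<integral>x. (\<Sum>n<N. indicator ((iter c n) -` K) x) \<partial>\<mu>)"
      by (intro Bochner_Integration.integral_sum[symmetric] int)
    also have "\<dots> \<le> (\<integral>x. real L \<partial>\<mu>)"
      using count int by (intro integral_mono Bochner_Integration.integrable_sum) auto
    also have "\<dots> = real L * measure \<mu> UNIV" by (simp add: mult.commute)
    finally show ?thesis .
  qed
  obtain N where "real L * measure \<mu> UNIV + 1 \<le> (\<Sum>n<N. measure \<mu> ((iter c n) -` K))"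
    using unb[OF KB K(3)] by blast
  then show False using bound[of N] by simp
qed

text \<open>By Borel-Cantelli, summability would let almost every point visit a compact
  \<open>K\<close> inside \<open>A\<close> only finitely often, while almost every point of
  \<open>K\<close> returns infinitely often.\<close>

lemma returns_not_summable:
  assumes "postsingularly_finite c p n0" and A: "A \<in> sets borel" "emeasure lborel A > 0"
  shows "\<not> summable (\<lambda>n. measure \<mu> ((iter c n) -` A))"
proof
  assume sum: "summable (\<lambda>n. measure \<mu> ((iter c n) -` A))"
  interpret postsingularly_finite c p n0 by fact
  have AL: "A \<in> sets lebesgue" "emeasure lebesgue A > 0" using A by auto
  obtain K where K: "compact K" "K \<subseteq> A" "emeasure lborel K > 0"
    using exists_nonnegligible_compact_subset[OF AL] by blast
  have KB: "K \<in> sets borel" using K by (simp add: borel_compact)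
  have "summable (\<lambda>n. measure \<mu> ((iter c n) -` K))"
  proof (rule summable_comparison_test'[OF sum])
    show "norm (measure \<mu> ((iter c n) -` K)) \<le> measure \<mu> ((iter c n) -` A)" for n
      using K(2) A KB by (auto intro!: finite_measure_mono)
  qed
  then have "AE x in \<mu>. eventually (\<lambda>n. x \<in> space \<mu> - (iter c n) -` K) sequentially"
    using KB by (intro borel_cantelli_AE1) (auto simp: less_top[symmetric])
  then obtain N where N: "N \<in> sets borel" "emeasure \<mu> N = 0"
      "{x. \<not> eventually (\<lambda>n. x \<in> space \<mu> - (iter c n) -` K) sequentially} \<subseteq> N"
    by (auto elim!: AE_E)
  have "negligible N" using N null_iff[OF N(1)] negligible_iff_lborel_null by blast
  moreover have "K \<subseteq> N \<union> {x \<in> K. finite {n. (iter c n) x \<in> K}}"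
  proof
    fix x assume x: "x \<in> K"
    show "x \<in> N \<union> {x \<in> K. finite {n. (iter c n) x \<in> K}}"
    proof (cases "x \<in> N")
      case False
      then have "eventually (\<lambda>n. x \<in> space \<mu> - (iter c n) -` K) sequentially" using N(3) by blast
      then obtain j where j: "\<And>n. n \<ge> j \<Longrightarrow> (iter c n) x \<notin> K" unfolding eventually_sequentially by auto
      have "{n. (iter c n) x \<in> K} \<subseteq> {..<j}"
      proof
        fix n assume "n \<in> {n. (iter c n) x \<in> K}"
        then show "n \<in> {..<j}" using j[of n] by (auto simp: not_less[symmetric])
      qed
      then show ?thesis using x finite_subset by blast
    qed blast
  qed
  ultimately have "negligible K"
    using negligible_Un[OF _ negligible_finitely_many_returns[OF K(1)]] negligible_subset by blast
  then show False using K(3) negligible_iff_lborel_null[OF KB] by simp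
qed

section \<open>Uniform lower bounds for return masses\<close>

definition return_mass :: "complex \<Rightarrow> complex set \<Rightarrow> nat \<Rightarrow> real" where
  "return_mass c A N = (\<Sum>n<N. measure \<mu> ((iter c n) -` A))"

lemma return_mass_mono:
  assumes "A \<in> sets borel" "A \<subseteq> B" "B \<in> sets borel"
  shows "return_mass c A N \<le> return_mass c B N"
  unfolding return_mass_def using assms
  by (intro sum_mono finite_measure_mono) auto

text \<open>By the divergence of the return masses, the densities of the image measures have infinite sum
  almost everywhere, so their partial sums are large off a set of small measure.\<close>

lemma return_mass_uniform:
  assumes psf: "postsingularly_finite c p n0" and "a > 0" "m > 0"
  shows "\<exists>N. \<forall>A\<in>sets borel. A \<subseteq> ball 0 R \<longrightarrow> ennreal a \<le> emeasure lborel A \<longrightarrow> m \<le> return_mass c A N"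
proof -
  interpret postsingularly_finite c p n0 by fact
  have "\<exists>h\<in>borel_measurable lborel. density lborel h = distr \<mu> borel (iter c n)" for n
    by (rule sigma_finite_measure.Radon_Nikodym[OF sigma_finite_lborel])
      (simp_all add: distr_iterate_absolutely_continuous c_nonzero)
  then obtain h where hm [measurable]: "\<And>n. h n \<in> borel_measurable lborel"
      and h: "\<And>n. density lborel (h n) = distr \<mu> borel (iter c n)" by metis
  define g where "g = (\<lambda>N x. \<Sum>n<N. h n x)"
  have gm [measurable]: "g N \<in> borel_measurable lborel" for N unfolding g_def by measurable
  have mass: "ennreal (return_mass c A N) = (\<integral>\<^sup>+x. g N x * indicator A x \<partial>lborel)"
    if A: "A \<in> sets borel" for A N
  proof -
    have "ennreal (return_mass c A N) = (\<Sum>n<N. emeasure \<mu> ((iter c n) -` A))"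
      by (simp add: return_mass_def emeasure_eq_measure)
    also have "\<dots> = (\<Sum>n<N. emeasure (density lborel (h n)) A)"
      unfolding h using A by (intro sum.cong refl) (simp add: emeasure_distr)
    also have "\<dots> = (\<Sum>n<N. \<integral>\<^sup>+x. h n x * indicator A x \<partial>lborel)"
      using A by (intro sum.cong refl emeasure_density) auto
    also have "\<dots> = (\<integral>\<^sup>+x. (\<Sum>n<N. h n x * indicator A x) \<partial>lborel)"
      using A by (intro nn_integral_sum[symmetric]) auto
    finally show ?thesis by (simp add: g_def sum_distrib_right)
  qed
  \<comment> \<open>Density at least \<open>l\<close> on a subset of measure at least
    \<open>a / 2\<close> gives mass at least \<open>m\<close>.\<close>
  define l where "l = ennreal (2 * m / a)"
  define D where "D = (\<lambda>N. {x \<in> ball 0 R. g N x < l})"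
  have DB: "D N \<in> sets borel" for N
  proof -
    have "{x \<in> space lborel. g N x < l} \<in> sets lborel" by measurable
    then have "ball 0 R \<inter> {x. g N x < l} \<in> sets borel" by simp
    moreover have "D N = ball 0 R \<inter> {x. g N x < l}" by (auto simp: D_def)
    ultimately show ?thesis by simp
  qed
  have Dsub: "D N \<subseteq> ball 0 R" for N by (auto simp: D_def)
  have ballfin: "emeasure lborel (ball (0::complex) R) < \<infinity>" 
    using emeasure_bounded_finite[OF bounded_ball[of "0::complex" R]] by simp
  have Dfin: "emeasure lborel (D N) \<noteq> \<infinity>" for N
    using emeasure_mono[OF Dsub, of lborel N] ballfin by (auto simp: top_unique)
  have InfB: "(\<Inter>N. D N) \<in> sets borel" using DB by (intro sets.countable_INT) auto
  \<comment> \<open>On the intersection all partial sums of the densities stay below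
    \<open>l\<close>, so its return masses would be bounded and the series summable.\<close>
  have null: "emeasure lborel (\<Inter>N. D N) = 0"
  proof (rule ccontr)
    assume "emeasure lborel (\<Inter>N. D N) \<noteq> 0"
    then have pos: "emeasure lborel (\<Inter>N. D N) > 0" by (simp add: zero_less_iff_neq_zero)
    have "l * emeasure lborel (ball (0::complex) R) < \<infinity>"
      using ballfin by (simp add: l_def ennreal_mult_less_top less_top)
    then obtain b where b: "b \<ge> 0" "l * emeasure lborel (ball (0::complex) R) = ennreal b"
      by (cases "l * emeasure lborel (ball (0::complex) R)") auto
    have "return_mass c (\<Inter>N. D N) N \<le> b" for N
    proof -
      have "ennreal (return_mass c (\<Inter>N. D N) N) \<le> (\<integral>\<^sup>+x. l * indicator (ball (0::complex) R) x \<partial>lborel)"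
        unfolding mass[OF InfB]
      proof (intro nn_integral_mono)
        fix x :: complex
        show "g N x * indicator (\<Inter>N. D N) x \<le> l * indicator (ball 0 R) x"
        proof (cases "x \<in> (\<Inter>N. D N)")
          case True
          then have "x \<in> D N" by blast
          then show ?thesis using True by (auto simp: D_def indicator_def less_imp_le)
        qed simp
      qed
      also have "\<dots> = ennreal b" using b(2) by (simp add: nn_integral_cmult_indicator)
      finally show ?thesis using b(1) by simp
    qed
    then have "summable (\<lambda>n. measure \<mu> ((iter c n) -` (\<Inter>N. D N)))"
      unfolding return_mass_def by (intro summableI_nonneg_bounded) auto
    then show False using returns_not_summable[OF psf InfB pos] by blast
  qed
  have "(\<lambda>N. emeasure lborel (D N)) \<longlonglongrightarrow> emeasure lborel (\<Inter>N. D N)"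
  proof (rule Lim_emeasure_decseq)
    show "range D \<subseteq> sets lborel" using DB by auto
    have "g M x \<le> g N x" if "M \<le> N" for M N x
      unfolding g_def using that by (intro sum_mono2) auto
    then show "decseq D" unfolding decseq_def D_def by (auto intro: le_less_trans)
    show "emeasure lborel (D N) \<noteq> \<infinity>" for N by (rule Dfin)
  qed
  then have "(\<lambda>N. emeasure lborel (D N)) \<longlonglongrightarrow> 0" unfolding null .
  then have "eventually (\<lambda>N. emeasure lborel (D N) < ennreal (a / 2)) sequentially"
    using \<open>a > 0\<close> by (intro order_tendstoD(2)) auto
  then obtain N where N: "emeasure lborel (D N) < ennreal (a / 2)"
    by (meson eventually_sequentially order_refl)
  have "m \<le> return_mass c A N"
    if A: "A \<in> sets borel" "A \<subseteq> ball 0 R" "ennreal a \<le> emeasure lborel A" for A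
  proof -
    have AD: "A - D N \<in> sets borel" using A DB by auto
    have big: "ennreal (a / 2) \<le> emeasure lborel (A - D N)"
    proof (rule ccontr)
      assume "\<not> ennreal (a / 2) \<le> emeasure lborel (A - D N)"
      then have small: "emeasure lborel (A - D N) < ennreal (a / 2)" by simp
      then obtain x where x: "emeasure lborel (A - D N) = ennreal x" "0 \<le> x" "x < a / 2"
        by (cases "emeasure lborel (A - D N)") (auto simp: ennreal_less_iff)
      obtain y where y: "emeasure lborel (D N) = ennreal y" "0 \<le> y" "y < a / 2"
        using N by (cases "emeasure lborel (D N)") (auto simp: ennreal_less_iff)
      have "emeasure lborel A \<le> emeasure lborel ((A - D N) \<union> D N)"
        using A(1) DB by (intro emeasure_mono) auto
      also have "\<dots> \<le> emeasure lborel (A - D N) + emeasure lborel (D N)"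
        using AD DB by (intro emeasure_subadditive) auto
      also have "\<dots> = ennreal (x + y)" unfolding x(1) y(1) using x(2) y(2) by (intro ennreal_plus[symmetric])
      also have "\<dots> < ennreal a" using x y by (intro ennreal_lessI) auto
      finally show False using A(3) by simp
    qed
    have "ennreal m = l * ennreal (a / 2)"
      unfolding l_def using \<open>a > 0\<close> \<open>m > 0\<close> by (subst ennreal_mult[symmetric]) auto
    also have "\<dots> \<le> l * emeasure lborel (A - D N)" using big by (rule mult_left_mono) simp
    also have "\<dots> = (\<integral>\<^sup>+x. l * indicator (A - D N) x \<partial>lborel)"
      using AD by (simp add: nn_integral_cmult_indicator)
    also have "\<dots> \<le> (\<integral>\<^sup>+x. g N x * indicator A x \<partial>lborel)"
    proof (intro nn_integral_mono)
      fix x :: complex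
      show "l * indicator (A - D N) x \<le> g N x * indicator A x"
        using A(2) by (auto simp: D_def indicator_def not_less)
    qed
    also have "\<dots> = ennreal (return_mass c A N)" using mass[OF A(1)] by simp
    finally show ?thesis using \<open>m > 0\<close> by (simp add: return_mass_def sum_nonneg)
  qed
  then show ?thesis by blast
qed

text \<open>Fixing \<open>N\<close> first reduces stability to finitely many iterates: each of the
  \<open>N\<close> terms loses at most \<open>1 / real (Suc N)\<close>, and aiming at
  \<open>m + 1\<close> absorbs the total.\<close>

lemma return_mass_uniform_stable:
  assumes psf: "postsingularly_finite c p n0" and "a > 0" "m > 0"
  shows "\<exists>N. \<exists>\<delta>>0. \<forall>c'. cmod (c' - c) < \<delta> \<longrightarrow> (\<forall>A\<in>sets borel. A \<subseteq> ball 0 R \<longrightarrow>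
     ennreal a \<le> emeasure lborel A \<longrightarrow> m \<le> return_mass c' A N)"
proof -
  interpret postsingularly_finite c p n0 by fact
  obtain N where N: "\<And>A. A \<in> sets borel \<Longrightarrow> A \<subseteq> ball 0 R \<Longrightarrow> ennreal a \<le> emeasure lborel A \<Longrightarrow> m + 1 \<le> return_mass c A N"
    using return_mass_uniform[OF psf \<open>a > 0\<close>, of "m + 1" R] \<open>m > 0\<close> by auto
  have pos: "1 / real (Suc N) > 0" by simp
  obtain d where d: "\<And>n. d n > 0" "\<And>n c' A. cmod (c' - c) < d n \<Longrightarrow> A \<in> sets borel \<Longrightarrow>
     \<bar>measure \<mu> ((iter c' n) -` A) - measure \<mu> ((iter c n) -` A)\<bar> \<le> 1 / real (Suc N)"
    using iterate_measure_perturbation[OF c_nonzero pos] by metis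
  define \<delta> where "\<delta> = Min (d ` {..N})"
  have \<delta>: "\<delta> > 0" "\<And>n. n \<le> N \<Longrightarrow> \<delta> \<le> d n" using d(1) by (auto simp: \<delta>_def)
  have "m \<le> return_mass c' A N"
    if c': "cmod (c' - c) < \<delta>" and A: "A \<in> sets borel" "A \<subseteq> ball 0 R" "ennreal a \<le> emeasure lborel A" for c' A
  proof -
    have "return_mass c A N - return_mass c' A N =
        (\<Sum>n<N. measure \<mu> ((iter c n) -` A) - measure \<mu> ((iter c' n) -` A))"
      by (simp add: return_mass_def sum_subtractf)
    also have "\<dots> \<le> (\<Sum>n<N. 1 / real (Suc N))"
    proof (rule sum_mono)
      fix n assume "n \<in> {..<N}"
      then have "cmod (c' - c) < d n" using c' \<delta>(2)[of n] by simp
      from d(2)[OF this A(1)] show "measure \<mu> ((iter c n) -` A) - measure \<mu> ((iter c' n) -` A) \<le> 1 / real (Suc N)"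
        by linarith
    qed
    also have "\<dots> \<le> 1" by simp
    finally show ?thesis using N[OF A] by simp
  qed
  then show ?thesis using \<delta>(1) by blast
qed

section \<open>Construction of the parameter\<close>

text \<open>Both clauses are required on a closed disc, so a common point of nested discs inherits
  them from all stages. One index controls the radius of the ball, the lower bound for the measure
  and the target mass, so that late stages serve every set and every target.\<close>

definition stage_ok :: "nat \<Rightarrow> complex \<Rightarrow> nat \<Rightarrow> real \<Rightarrow> bool" where
  "stage_ok k c n r \<longleftrightarrow> (\<forall>c'\<in>cball c r.
     (\<forall>i\<le>n. cmod (singular_orbit c i) - 1 \<le> cmod (singular_orbit c' i)) \<and>
     (\<exists>N. \<forall>A\<in>sets borel. A \<subseteq> ball 0 (real (Suc k)) \<longrightarrow> ennreal (1 / real (Suc k)) \<le> emeasure lborel A \<longrightarrow>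
        real (Suc k) \<le> return_mass c' A N))"

lemma exists_stage_ok:
  assumes psf: "postsingularly_finite c p n0" and "\<epsilon> > 0"
  shows "\<exists>r>0. r < \<epsilon> \<and> stage_ok k c n0 r"
proof -
  have pos: "1 / real (Suc k) > 0" "real (Suc k) > 0" by simp_all
  obtain N \<delta> where \<delta>: "\<delta> > 0" "\<And>c' A. cmod (c' - c) < \<delta> \<Longrightarrow> A \<in> sets borel \<Longrightarrow> A \<subseteq> ball 0 (real (Suc k)) \<Longrightarrow>
     ennreal (1 / real (Suc k)) \<le> emeasure lborel A \<Longrightarrow> real (Suc k) \<le> return_mass c' A N"
    using return_mass_uniform_stable[OF psf pos, of "real (Suc k)"] by blast
  have "eventually (\<lambda>c'. \<forall>i\<in>{..n0}. cmod (singular_orbit c i) - 1 < cmod (singular_orbit c' i)) (nhds c)"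
  proof (intro eventually_ball_finite ballI)
    fix i
    show "eventually (\<lambda>c'. cmod (singular_orbit c i) - 1 < cmod (singular_orbit c' i)) (nhds c)"
      by (rule order_tendstoD(1)[OF tendsto_norm[OF singular_orbit_tendsto[OF filterlim_ident]]]) simp
  qed simp
  then obtain d where d: "d > 0" "\<And>c' i. dist c' c < d \<Longrightarrow> i \<le> n0 \<Longrightarrow> cmod (singular_orbit c i) - 1 < cmod (singular_orbit c' i)"
    unfolding eventually_nhds_metric by auto
  define r where "r = min (min \<delta> d) \<epsilon> / 2"
  have r: "r > 0" "r < \<delta>" "r < d" "r < \<epsilon>" using \<delta>(1) d(1) \<open>\<epsilon> > 0\<close> by (auto simp: r_def)
  have "stage_ok k c n0 r"
    unfolding stage_ok_def
  proof (intro ballI conjI allI impI)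
    fix c' i assume "c' \<in> cball c r" "i \<le> n0"
    then show "cmod (singular_orbit c i) - 1 \<le> cmod (singular_orbit c' i)"
      using d(2)[of c' i] r by (simp add: dist_commute)
  next
    fix c' assume "c' \<in> cball c r"
    then have "cmod (c' - c) < \<delta>" using r by (simp add: dist_norm norm_minus_commute)
    then show "\<exists>N. \<forall>A\<in>sets borel. A \<subseteq> ball 0 (real (Suc k)) \<longrightarrow> ennreal (1 / real (Suc k)) \<le> emeasure lborel A \<longrightarrow>
        real (Suc k) \<le> return_mass c' A N" using \<delta>(2) by blast
  qed
  then show ?thesis using r by blast
qed

lemma parameter_sequence:
  "\<exists>c p n r. \<forall>k. postsingularly_finite (c k) (p k) (n k) \<and> 3/4 * cmod (c k) < cmod (p k) \<and> 2 ^ k \<le> cmod (p k) \<and>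
     r k > 0 \<and> stage_ok k (c k) (n k) (r k) \<and> cball (c (Suc k)) (r (Suc k)) \<subseteq> cball (c k) (r k) \<and> n k < n (Suc k) \<and>
     (\<forall>i. n k \<le> i \<and> i \<le> n (Suc k) \<longrightarrow> cmod (p k) - 12 \<le> cmod (singular_orbit (c (Suc k)) i))"
proof -
  define Inv where "Inv = (\<lambda>k (c, p, n, r). postsingularly_finite c p n \<and> 3/4 * cmod c < cmod p \<and> 2 ^ k \<le> cmod p \<and>
     r > 0 \<and> stage_ok k c n r)"
  define Step where "Step = (\<lambda>(c :: complex, p :: complex, n :: nat, r :: real) (c' :: complex, p' :: complex, n' :: nat, r' :: real). cball c' r' \<subseteq> cball c r \<and> n < n' \<and>
     (\<forall>i. n \<le> i \<and> i \<le> n' \<longrightarrow> cmod p - 12 \<le> cmod (singular_orbit c' i)))"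
  have "\<exists>f. \<forall>k. Inv k (f k) \<and> Step (f k) (f (Suc k))"
  proof (rule dependent_nat_choice)
    \<comment> \<open>A multiple of 2 \<pi> i gives \<open>exp c = 1\<close>: the singular orbit is
      0, c, c, ..., and \<open>c\<close> is its own fixed point.\<close>
    define c where "c = 2 * of_int \<lceil>exp (5000::real)\<rceil> * of_real pi * \<i>"
    have "exp (5000::real) \<le> \<bar>of_int \<lceil>exp (5000::real)\<rceil>\<bar>" by linarith
    then have "2 * pi * exp 5000 \<le> 2 * pi * \<bar>of_int \<lceil>exp (5000::real)\<rceil>\<bar>"
      by (rule mult_left_mono) simp
    also have "\<dots> = cmod c" by (simp add: c_def norm_mult)
    finally have "cmod c \<ge> 2 * pi * exp 5000" .
    moreover have "2 * pi * exp (5000::real) > 1 * exp 5000"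
      using pi_gt3 by (intro mult_strict_right_mono) auto
    ultimately have large: "exp 5000 < cmod c" by linarith
    have "exp c = 1" unfolding c_def by (subst exp_eq_1) auto
    then have "postsingularly_finite c c 1"
    proof unfold_locales
      fix i :: nat assume "1 \<le> i" "i \<le> 1"
      then have "i = 1" by simp
      moreover have "cmod c > 0" using large exp_gt_zero[of "5000::real"] by linarith
      ultimately show "cmod c / 2 < cmod (singular_orbit c i)" by (simp add: exp_map_def)
    qed (use large in \<open>auto simp: exp_map_def\<close>)
    moreover obtain r where "r > 0" "stage_ok 0 c 1 r" using exists_stage_ok[OF calculation, of 1 0] by auto
    moreover have "cmod c > 1" using large exp_ge_add_one_self[of "5000::real"] by linarith
    ultimately have "Inv 0 (c, c, 1, r)" by (auto simp: Inv_def)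
    then show "\<exists>x. Inv 0 x" by blast
  next
    fix x k assume x: "Inv k x"
    obtain c p n r where xeq: "x = (c, p, n, r)" by (cases x)
    have inv: "postsingularly_finite c p n" "3/4 * cmod c < cmod p" "2 ^ k \<le> cmod p" "r > 0" "stage_ok k c n r"
      using x by (auto simp: Inv_def xeq)
    \<comment> \<open>Moving the centre by less than \<open>r / 2\<close> and taking a radius below
      \<open>r / 2\<close> nests the discs.\<close>
    obtain c' p' n' where c': "cmod (c' - c) < r / 2" "n < n'" "postsingularly_finite c' p' n'"
        "2 * cmod p \<le> cmod p'" "3/4 * cmod c' < cmod p'"
        "\<And>i. n \<le> i \<and> i \<le> n' \<Longrightarrow> cmod p - 12 \<le> cmod (singular_orbit c' i)"
      using postsingularly_finite.next_parameter[OF inv(1), of "r / 2"] inv(2,4) by (metis half_gt_zero)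
    obtain r' where r': "r' > 0" "r' < r / 2" "stage_ok (Suc k) c' n' r'"
      using exists_stage_ok[OF c'(3), of "r / 2" "Suc k"] inv(4) by auto
    have "cball c' r' \<subseteq> cball c r"
    proof
      fix y assume "y \<in> cball c' r'"
      then show "y \<in> cball c r" using c'(1) r'(2) dist_triangle[of c y c']
        by (simp add: dist_norm norm_minus_commute)
    qed
    then have "Step x (c', p', n', r')" using c' by (simp add: Step_def xeq)
    moreover have "Inv (Suc k) (c', p', n', r')" using c' r' inv(3) by (simp add: Inv_def)
    ultimately show "\<exists>y. Inv (Suc k) y \<and> Step x y" by blast
  qed
  then obtain f where f: "\<And>k. Inv k (f k)" "\<And>k. Step (f k) (f (Suc k))" by blast
  show ?thesis
    using f unfolding Inv_def Step_def case_prod_beta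
    by (intro exI[of _ "\<lambda>k. fst (f k)"] exI[of _ "\<lambda>k. fst (snd (f k))"]
        exI[of _ "\<lambda>k. fst (snd (snd (f k)))"] exI[of _ "\<lambda>k. snd (snd (snd (f k)))"]) blast
qed

lemma exists_escaping_recurrent:
  "\<exists>c. c \<noteq> 0 \<and> escaping c \<and> dynamically_recurrent (exp_map c)"
proof -
  obtain cs ps n r where psf: "\<And>k. postsingularly_finite (cs k) (ps k) (n k)"
      and p_large: "\<And>k. 2 ^ k \<le> cmod (ps k)" and r: "\<And>k. r k > 0"
      and ok: "\<And>k. stage_ok k (cs k) (n k) (r k)"
      and nested: "\<And>k. cball (cs (Suc k)) (r (Suc k)) \<subseteq> cball (cs k) (r k)"
      and n: "\<And>k. n k < n (Suc k)"
      and orbit: "\<And>k i. n k \<le> i \<Longrightarrow> i \<le> n (Suc k) \<Longrightarrow> cmod (ps k) - 12 \<le> cmod (singular_orbit (cs (Suc k)) i)"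
    using parameter_sequence by blast
  have "\<Inter> (range (\<lambda>k. cball (cs k) (r k))) \<noteq> {}"
  proof (rule compact_nest)
    show "cball (cs k) (r k) \<noteq> {}" for k using r[of k] by auto
    show "cball (cs k) (r k) \<subseteq> cball (cs j) (r j)" if "j \<le> k" for j k
      using lift_Suc_antimono_le[of "\<lambda>k. cball (cs k) (r k)", OF nested that] .
  qed simp
  then obtain c where c: "\<And>k. c \<in> cball (cs k) (r k)" by blast
  have near: "cmod (singular_orbit (cs k) i) - 1 \<le> cmod (singular_orbit c i)" if "i \<le> n k" for k i
    using ok[of k] c[of k] that unfolding stage_ok_def by blast
  have "c \<noteq> 0"
  proof -
    interpret postsingularly_finite "cs 0" "ps 0" "n 0" by (rule psf)
    have "cmod (singular_orbit (cs 0) 1) - 1 \<le> cmod (singular_orbit c 1)" using n0 by (rule near)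
    then have "cmod (cs 0) - 1 \<le> cmod c" by (simp add: exp_map_def)
    then show ?thesis using large exp_ge_add_one_self[of "5000::real"] by auto
  qed
  moreover have "escaping c"
    unfolding escaping_def
  proof (rule filterlim_norm_at_top_imp_at_infinity, unfold filterlim_at_top, intro allI)
    fix Z :: real
    \<comment> \<open>13 = 12 + 1: in its block the orbit of stage \<open>Suc j\<close> has modulus
      at least \<open>cmod (ps j) - 12\<close>, and passing from that stage to \<open>c\<close>
      costs 1 more.\<close>
    obtain K where K: "Z + 13 < 2 ^ K" using real_arch_pow[of 2 "Z + 13"] by auto
    have "Z \<le> cmod (singular_orbit c i)" if i: "i \<ge> n K" for i
    proof -
      have "strict_mono n" using n by (simp add: strict_mono_Suc_iff)
      then have "i \<le> n i" using seq_suble by blast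
      define k where "k = (LEAST k. i \<le> n (Suc k))"
      have ex: "i \<le> n (Suc i)" using \<open>i \<le> n i\<close> n[of i] by linarith
      have k1: "i \<le> n (Suc k)" unfolding k_def using ex by (rule LeastI)
      \<comment> \<open>Neighbouring blocks share an endpoint: for \<open>i = n K\<close> the least
        index may be below \<open>K\<close>, and then block \<open>K\<close> is used
        instead.\<close>
      have k2: "n k \<le> i \<and> K \<le> k \<or> i = n K"
      proof (cases "K \<le> k")
        case True
        have "n k \<le> i"
        proof (cases "k = K")
          case False
          then obtain j where j: "k = Suc j" using True by (metis Suc_le_D le_neq_implies_less not0_implies_Suc gr_implies_not0)
          then have "j < k" by simp
          then have "\<not> i \<le> n (Suc j)" unfolding k_def by (rule not_less_Least)
          then show ?thesis using j by simp
        qed (use i in simp)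
        with True show ?thesis by blast
      next
        case False
        then have "n (Suc k) \<le> n K" using \<open>strict_mono n\<close> by (simp add: strict_mono_less_eq)
        then show ?thesis using k1 i by simp
      qed
      then obtain j where j: "n j \<le> i" "i \<le> n (Suc j)" "K \<le> j"
        using k1 n[of K] by (metis less_imp_le order_refl)
      have "(2::real) ^ K \<le> 2 ^ j" using j(3) by (intro power_increasing) auto
      then have "2 ^ K \<le> cmod (ps j)" using p_large[of j] by linarith
      then show ?thesis using orbit[OF j(1,2)] near[OF j(2)] K by linarith
    qed
    then show "eventually (\<lambda>i. Z \<le> cmod (singular_orbit c i)) sequentially"
      unfolding eventually_sequentially by blast
  qed
  moreover have "dynamically_recurrent (exp_map c)"
  proof (rule dynamically_recurrentI)
    fix A :: "complex set" and m :: real assume A: "A \<in> sets borel" "emeasure lborel A > 0"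
    have "(\<lambda>k. emeasure lborel (A \<inter> ball 0 (real k))) \<longlonglongrightarrow> emeasure lborel (\<Union>k. A \<inter> ball 0 (real k))"
      using A by (intro Lim_emeasure_incseq) (auto simp: incseq_def)
    moreover have "(\<Union>k. A \<inter> ball 0 (real k)) = A"
      using reals_Archimedean2 by fastforce
    ultimately have "(\<lambda>k. emeasure lborel (A \<inter> ball 0 (real k))) \<longlonglongrightarrow> emeasure lborel A" by simp
    from order_tendstoD(1)[OF this A(2)] obtain j where j: "emeasure lborel (A \<inter> ball 0 (real j)) > 0"
      by (meson eventually_sequentially order_refl)
    obtain q where q: "q > 0" "ennreal q \<le> emeasure lborel (A \<inter> ball 0 (real j))"
      using j by (metis ennreal_le_1 ennreal_1 le_cases zero_less_one ennreal_cases ennreal_less_zero_iff top_greatest order_refl)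
    obtain k0 where k0: "inverse (real (Suc k0)) < q" using reals_Archimedean[OF q(1)] by blast
    \<comment> \<open>Large enough for the ball, the measure bound and the target \<open>m\<close>
      at once.\<close>
    define k where "k = max (max j k0) (nat \<lceil>m\<rceil>)"
    define B where "B = A \<inter> ball 0 (real (Suc k))"
    have B: "B \<in> sets borel" using A(1) by (simp add: B_def)
    have "1 / real (Suc k) \<le> q"
    proof -
      have "inverse (real (Suc k)) \<le> inverse (real (Suc k0))" by (intro le_imp_inverse_le) (auto simp: k_def)
      then show ?thesis using k0 by (simp add: inverse_eq_divide)
    qed
    then have "ennreal (1 / real (Suc k)) \<le> ennreal q" by (rule ennreal_leI)
    also have "\<dots> \<le> emeasure lborel (A \<inter> ball 0 (real j))" by (rule q(2))
    also have "\<dots> \<le> emeasure lborel B"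
    proof (rule emeasure_mono)
      have "ball (0::complex) (real j) \<subseteq> ball 0 (real (Suc k))" by (intro subset_ball) (simp add: k_def)
      then show "A \<inter> ball 0 (real j) \<subseteq> B" by (auto simp: B_def)
    qed (use B in simp)
    finally have big: "ennreal (1 / real (Suc k)) \<le> emeasure lborel B" .
    have "\<exists>N. \<forall>A\<in>sets borel. A \<subseteq> ball 0 (real (Suc k)) \<longrightarrow>
        ennreal (1 / real (Suc k)) \<le> emeasure lborel A \<longrightarrow> real (Suc k) \<le> return_mass c A N"
      using ok[of k, unfolded stage_ok_def, rule_format, OF c[of k]] ..
    then obtain N where N: "\<forall>A\<in>sets borel. A \<subseteq> ball 0 (real (Suc k)) \<longrightarrow>
        ennreal (1 / real (Suc k)) \<le> emeasure lborel A \<longrightarrow> real (Suc k) \<le> return_mass c A N" ..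
    have "B \<subseteq> ball 0 (real (Suc k))" by (simp add: B_def)
    with N B big have "real (Suc k) \<le> return_mass c B N" by blast
    also have "\<dots> \<le> return_mass c A N" using A(1) B by (intro return_mass_mono) (auto simp: B_def)
    finally have "real (Suc k) \<le> return_mass c A N" .
    moreover have "m \<le> real (Suc k)" unfolding k_def by linarith
    ultimately show "\<exists>N. m \<le> (\<Sum>n<N. measure \<mu> ((iter c n) -` A))"
      unfolding return_mass_def by (meson order_trans)
  qed
  ultimately show ?thesis by blast
qed

end

theorem theorem2:
  shows "\<exists>c::complex. c \<noteq> 0 \<and> escaping c \<and> dynamically_recurrent (exp_map c)"
proof -
  obtain \<mu> where "reference_measure \<mu>" using reference_measure_exists by blast
  then show ?thesis by (rule reference_measure.exists_escaping_recurrent)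
qed

end
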